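(* For every pattern $\sigma\in\mathcal S_*$, as $n\to\infty$, $$\frac{X_{\sigma,n}-\mathbb E X_{\sigma,n}}{n^{|\sigma|-1/2}}=\frac{X_{\sigma,n}-\frac{1}{|\sigma|!}\binom{n}{|\sigma|}}{n^{|\sigma|-1/2}}\longrightarrow Z_\sigma\quad\text{in distribution}.$$ Moreover, this holds jointly for any finite family of patterns: for any $\sigma_1,\dots,\sigma_m\in\mathcal S_*$, the random vector $\left(\frac{X_{\sigma_i,n}-\mathbb E X_{\sigma_i,n}}{n^{|\sigma_i|-1/2}}\right)_{i=1}^m$ converges in distribution to $(Z_{\sigma_1},\dots,Z_{\sigma_m})$. Furthermore, all (joint) moments of these normalized variables converge to the corresponding (joint) moments of the limit variables; in particular, for any $\sigma,\tau\in\mathcal S_*$, $$\frac{\operatorname{Cov}(X_{\sigma,n},X_{\tau,n})}{n^{|\sigma|+|\tau|-1}}\to\Sigma_{\sigma,\tau}\qquad\text{as } n\to\infty.$$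
   Context: Let $\mathcal S_n$ be the set of permutations of $\{1,\dots,n\}$, and let $\mathcal S_*:=\bigcup_{k\ge1}\mathcal S_k$. For $\sigma\in\mathcal S_k$ write $|\sigma|=k$ for its length. The reduction $\mathrm{red}(a_1\dots a_k)$ of a sequence of $k$ distinct real numbers is the permutation $\rho\in\mathcal S_k$ with $\rho_i<\rho_j$ if and only if $a_i<a_j$, for all $i,j$. For $\pi\in\mathcal S_n$ and $\sigma\in\mathcal S_k$, the number of occurrences of the pattern $\sigma$ in $\pi$ is the number $X_\sigma(\pi)$ of index tuples $1\le i_1<\dots<i_k\le n$ with $\mathrm{red}(\pi_{i_1}\dots\pi_{i_k})=\sigma$. For each $n$, $\pi$ is chosen uniformly at random from $\mathcal S_n$, and $X_{\sigma,n}:=X_\sigma(\pi)$ (the same $\pi$ being used for all patterns $\sigma$). For $k\ge1$ and $1\le i\le k$ define $g_{k,i}(x):=\binom{k-1}{i-1}x^{i-1}(1-x)^{k-i}$. For $\sigma\in\mathcal S_k$ define $$G_\sigma(x,y):=\frac{1}{(k-1)!^2}\left(\sum_{i=1}^k g_{k,i}(x)\,g_{k,\sigma(i)}(y)-\frac1k\right).$$ For $\sigma,\tau\in\mathcal S_*$ (possibly of different lengths) define $$\Sigma_{\sigma,\tau}:=\int_0^1\int_0^1 G_\sigma(x,y)G_\tau(x,y)\,dx\,dy.$$ The variables $Z_\sigma$, $\sigma\in\mathcal S_*$, are jointly normal (possibly degenerate) random variables with $\mathbb E Z_\sigma=0$ and $\operatorname{Cov}(Z_\sigma,Z_\tau)=\Sigma_{\sigma,\tau}$;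 they exist since $(\Sigma_{\sigma,\tau})$ is non-negative definite. *)

theory Defs
  imports "HOL-Probability.Probability"
begin

text \<open>
  A permutation in \<open>S\<^sub>n\<close> is represented by its one-line notation, i.e. as a list of length \<open>n\<close>
  enumerating \<open>{1..n}\<close> without repetition. In this way a pattern carries its length
  (a function that permutes \<open>{1..k}\<close> does not determine \<open>k\<close>). List positions start at 0, hence
  \<open>\<sigma>(i)\<close> is written \<open>\<sigma> ! (i - 1)\<close>.
\<close>

definition perms :: "nat \<Rightarrow> nat list set" where
  "perms n = permutations_of_set {1..n}"

definition patterns :: "nat list set" where
  "patterns = (\<Union>k\<in>{1..}. perms k)"

definition red :: "real list \<Rightarrow> nat list" where
  "red a = (THE \<rho>. \<rho> \<in> perms (length a) \<and>
     (\<forall>i<length a. \<forall>j<length a. \<rho> ! i < \<rho> ! j \<longleftrightarrow> a ! i < a ! j))"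

text \<open>The index tuples are the strictly increasing lists of positions of \<open>\<pi>\<close>.\<close>

definition occ :: "nat list \<Rightarrow> nat list \<Rightarrow> nat" where
  "occ \<sigma> \<pi> = card {is. length is = length \<sigma> \<and> sorted_wrt (<) is \<and> set is \<subseteq> {..<length \<pi>} \<and>
     red (map (\<lambda>i. real (\<pi> ! i)) is) = \<sigma>}"

definition unif_perm :: "nat \<Rightarrow> nat list pmf" where
  "unif_perm n = pmf_of_set (perms n)"

definition mean_occ :: "nat list \<Rightarrow> nat \<Rightarrow> real" where
  "mean_occ \<sigma> n = measure_pmf.expectation (unif_perm n) (\<lambda>\<pi>. real (occ \<sigma> \<pi>))"

definition normalized_occ :: "nat list \<Rightarrow> nat \<Rightarrow> nat list \<Rightarrow> real" where
  "normalized_occ \<sigma> n \<pi> =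
     (real (occ \<sigma> \<pi>) - mean_occ \<sigma> n) / real n powr (real (length \<sigma>) - 1 / 2)"

definition g :: "nat \<Rightarrow> nat \<Rightarrow> real \<Rightarrow> real" where
  "g k i x = real ((k - 1) choose (i - 1)) * x ^ (i - 1) * (1 - x) ^ (k - i)"

definition G :: "nat list \<Rightarrow> real \<Rightarrow> real \<Rightarrow> real" where
  "G \<sigma> x y = (let k = length \<sigma> in
     1 / (fact (k - 1))\<^sup>2 * ((\<Sum>i=1..k. g k i x * g k (\<sigma> ! (i - 1)) y) - 1 / real k))"

definition Sigma_cov :: "nat list \<Rightarrow> nat list \<Rightarrow> real" where
  "Sigma_cov \<sigma> \<tau> = (LBINT y:{0..1}. (LBINT x:{0..1}. G \<sigma> x y * G \<tau> x y))"

definition covariance :: "'a measure \<Rightarrow> ('a \<Rightarrow> real) \<Rightarrow> ('a \<Rightarrow> real) \<Rightarrow> real" where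
  "covariance M X Y =
     (LINT \<omega>|M. (X \<omega> - (LINT \<omega>|M. X \<omega>)) * (Y \<omega> - (LINT \<omega>|M. Y \<omega>)))"

text \<open>
  Normal distributions are allowed to be degenerate, i.e. concentrated at one point. A family is
  jointly normal if all its finite linear combinations are normal.
\<close>

definition normal_rv :: "'a measure \<Rightarrow> ('a \<Rightarrow> real) \<Rightarrow> bool" where
  "normal_rv M X \<longleftrightarrow> X \<in> borel_measurable M \<and>
     ((\<exists>\<mu> s. s > 0 \<and> distributed M lborel X (normal_density \<mu> s)) \<or>
      (\<exists>c. AE \<omega> in M. X \<omega> = c))"

definition jointly_normal :: "'a measure \<Rightarrow> 'i set \<Rightarrow> ('i \<Rightarrow> 'a \<Rightarrow> real) \<Rightarrow> bool" where
  "jointly_normal M I Z \<longleftrightarrow>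
     (\<forall>J c. finite J \<and> J \<subseteq> I \<longrightarrow> normal_rv M (\<lambda>\<omega>. \<Sum>i\<in>J. c i * Z i \<omega>))"

text \<open>
  The library's \<open>weak_conv_m\<close> is restricted to measures on the real line. For random
  vectors, convergence in distribution is defined by bounded continuous test functions.
\<close>

definition converges_in_distribution ::
  "(nat \<Rightarrow> 'a measure) \<Rightarrow> (nat \<Rightarrow> 'a \<Rightarrow> 'c::topological_space) \<Rightarrow> 'b measure \<Rightarrow> ('b \<Rightarrow> 'c) \<Rightarrow> bool"
where
  "converges_in_distribution M X N Y \<longleftrightarrow>
     (\<forall>f :: 'c \<Rightarrow> real. continuous_on UNIV f \<and> bounded (range f) \<longrightarrow>
        (\<lambda>n. LINT \<omega>|M n. f (X n \<omega>)) \<longlonglongrightarrow> (LINT \<omega>|N. f (Y \<omega>)))"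

end

theory Submission
  imports Defs
begin

text \<open>
  Replace the random permutation by a word of \<open>n\<close> independent uniform letters from a large
  alphabet \<open>{0..<N}\<close>. A word with pairwise different letters is order isomorphic to exactly one
  permutation, each permutation arises equally often, and repeated letters have probability at most
  \<open>n\<^sup>2 / N\<close>. So any order invariant bounded statistic has almost the same mean under both models
  (\<open>expectation_unif_perm_approx\<close>). Either \<open>N\<close> tends to infinity for fixed \<open>n\<close>, which gives exact
  facts about permutations, or \<open>N = n\<^sup>3\<close>. In this way every random object is a finite average, and
  independence is the recursion of the average over the letters of the word.

  A pattern count is a U-statistic of the letters with two structural properties: changing one letter
  changes it by at most \<open>n\<^bsup>k-1\<^esup>\<close>, and its mixed second differences are at most \<open>2 n\<^bsup>k-2\<^esup>\<close>. The
  first property gives a bounded differences inequality, hence exponential moments of the normalized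
  counts that are bounded uniformly in \<open>n\<close> (\<open>normalized_occ_exp_le\<close>). The second one shows that
  the count is, up to an error whose root mean square is of order \<open>n\<^bsup>k-1\<^esup>\<close>, its mean plus its Hoeffding
  projection, a sum of functions of the single letters (\<open>word_avg_remainder_sq_le\<close>).

  The projection is explicit: that an index set containing \<open>i\<close> has \<open>i\<close> in the \<open>j\<close>-th place, and that
  the letter \<open>y\<close> is the \<open>\<sigma>(j)\<close>-th smallest one, is counted by two products of binomial coefficients, and
  after scaling these tend to Bernstein polynomials in \<open>i/n\<close> and in \<open>y/N\<close>. The result is
  \<open>n\<^bsup>k-1\<^esup> G\<^sub>\<sigma>(i/n, y/N)\<close> (\<open>proj_patcount_approx\<close>), and a Riemann sum turns the variance of a
  linear combination of patterns into the quadratic form of \<open>\<Sigma>\<close>. The characteristic function of a sum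
  of independent small letters factorizes, so the characteristic functions of all linear combinations
  converge to Gaussian ones (\<open>expectation_cos_limit\<close>).

  It remains to pass from characteristic functions to random vectors. In one dimension this is
  Levy's theorem. In several dimensions a bounded continuous \<open>f\<close> is written on a large ball as a
  continuous function of \<open>sin (x\<^sub>j / R)\<close>, which a polynomial approximates uniformly; a polynomial in
  these sines is a trigonometric sum (\<open>converges_in_distribution_if_cos_limits\<close>). The uniform exponential
  moments then give uniform integrability of all monomials, hence convergence of all joint
  moments, and the covariances are the mixed second moments.
\<close>

section \<open>Averages over words\<close>

definition avg :: "nat \<Rightarrow> (nat \<Rightarrow> 'a::real_normed_vector) \<Rightarrow> 'a" where
  "avg N f = (\<Sum>b<N. f b) /\<^sub>R real N"

text \<open>
  The mean over a uniformly random word of length \<open>n\<close>. Averaging over one letter after the other makes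
  an induction on \<open>n\<close> the same as conditioning on the first letter.
\<close>

primrec word_avg :: "nat \<Rightarrow> nat \<Rightarrow> (nat list \<Rightarrow> 'a::real_normed_vector) \<Rightarrow> 'a" where
  "word_avg N 0 f = f []"
| "word_avg N (Suc n) f = avg N (\<lambda>b. word_avg N n (\<lambda>l. f (b # l)))"

definition words :: "nat \<Rightarrow> nat \<Rightarrow> nat list set" where
  "words N n = {l. length l = n \<and> set l \<subseteq> {..<N}}"

lemma finite_words [simp]: "finite (words N n)"
  unfolding words_def using finite_lists_length_eq[of "{..<N}" n] by (simp add: conj_commute)

lemma words_0 [simp]: "words N 0 = {[]}"
  by (auto simp: words_def)

lemma sum_words_Suc: "(\<Sum>l\<in>words N (Suc n). f l) = (\<Sum>b<N. \<Sum>l\<in>words N n. f (b # l))"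
proof -
  have "(\<Sum>b<N. \<Sum>l\<in>words N n. f (b # l)) = (\<Sum>p\<in>{..<N} \<times> words N n. f (fst p # snd p))"
    by (simp add: sum.cartesian_product case_prod_unfold)
  also have "\<dots> = (\<Sum>l\<in>words N (Suc n). f l)"
    by (rule sum.reindex_bij_witness[where i="\<lambda>l. (hd l, tl l)" and j="\<lambda>p. fst p # snd p"])
       (auto simp: words_def length_Suc_conv)
  finally show ?thesis by simp
qed

lemma card_words: "card (words N n) = N ^ n"
  unfolding words_def using card_lists_length_eq[of "{..<N}" n] by (simp add: conj_commute)

lemma word_avg_eq_sum: "word_avg N n f = (\<Sum>l\<in>words N n. f l) /\<^sub>R real (N ^ n)"
  by (induction n arbitrary: f)
     (simp_all add: avg_def sum_words_Suc scaleR_sum_right[symmetric])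

lemma avg_cong: "(\<And>b. b < N \<Longrightarrow> f b = h b) \<Longrightarrow> avg N f = avg N h"
  by (auto simp: avg_def intro!: sum.cong)

lemma word_avg_cong: "(\<And>l. l \<in> words N n \<Longrightarrow> f l = h l) \<Longrightarrow> word_avg N n f = word_avg N n h"
  by (simp add: word_avg_eq_sum cong: sum.cong)

lemma avg_add: "avg N (\<lambda>b. f b + h b) = avg N f + avg N h"
  by (simp add: avg_def sum.distrib scaleR_right_distrib)

lemma avg_diff: "avg N (\<lambda>b. f b - h b) = avg N f - avg N h"
  by (simp add: avg_def sum_subtractf scaleR_right_diff_distrib)

lemma avg_const: "N > 0 \<Longrightarrow> avg N (\<lambda>b. c) = c"
  by (simp add: avg_def sum_constant_scaleR)

lemma avg_mult: "avg N (\<lambda>b. c * f b) = c * avg N f" for c :: "'a::real_normed_algebra"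
  by (simp add: avg_def sum_distrib_left)

lemma avg_sum: "avg N (\<lambda>b. \<Sum>i\<in>I. f i b) = (\<Sum>i\<in>I. avg N (f i))"
  unfolding avg_def by (subst sum.swap) (simp add: scaleR_sum_right)

lemma avg_mono: "(\<And>b. b < N \<Longrightarrow> f b \<le> h b) \<Longrightarrow> avg N f \<le> avg N h" for f :: "nat \<Rightarrow> real"
  by (auto simp: avg_def intro!: mult_left_mono sum_mono)

lemma norm_avg_le: "norm (avg N f) \<le> avg N (\<lambda>b. norm (f b))"
  by (auto simp: avg_def intro!: mult_left_mono norm_sum)

lemma word_avg_add: "word_avg N n (\<lambda>l. f l + h l) = word_avg N n f + word_avg N n h"
  by (simp add: word_avg_eq_sum sum.distrib scaleR_right_distrib)

lemma word_avg_diff: "word_avg N n (\<lambda>l. f l - h l) = word_avg N n f - word_avg N n h"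
  by (simp add: word_avg_eq_sum sum_subtractf scaleR_right_diff_distrib)

lemma word_avg_const: "N > 0 \<Longrightarrow> word_avg N n (\<lambda>l. c) = c"
  by (simp add: word_avg_eq_sum card_words sum_constant_scaleR)

lemma word_avg_mult: "word_avg N n (\<lambda>l. c * f l) = c * word_avg N n f" for c :: "'a::real_normed_algebra"
  by (simp add: word_avg_eq_sum sum_distrib_left)

lemma word_avg_sum: "word_avg N n (\<lambda>l. \<Sum>i\<in>I. f i l) = (\<Sum>i\<in>I. word_avg N n (f i))"
  unfolding word_avg_eq_sum by (subst sum.swap) (simp add: scaleR_sum_right)

lemma word_avg_mono: "(\<And>l. l \<in> words N n \<Longrightarrow> f l \<le> h l) \<Longrightarrow> word_avg N n f \<le> word_avg N n h"
  for f :: "nat list \<Rightarrow> real"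
  by (auto simp: word_avg_eq_sum intro!: mult_left_mono sum_mono)

lemma norm_word_avg_le: "norm (word_avg N n f) \<le> word_avg N n (\<lambda>l. norm (f l))"
  by (auto simp: word_avg_eq_sum intro!: mult_left_mono norm_sum)

text \<open>
  Fubini's theorem for one more independent letter.
\<close>

lemma avg_word_avg_swap: "avg N (\<lambda>b. word_avg N n (f b)) = word_avg N n (\<lambda>l. avg N (\<lambda>b. f b l))"
  unfolding word_avg_eq_sum avg_def
  by (simp add: scaleR_sum_right[symmetric] mult.commute) (subst sum.swap, simp)

text \<open>
  The letters of a random word are independent.
\<close>

lemma word_avg_prod:
  "word_avg N n (\<lambda>l. \<Prod>i<n. u i (l ! i)) = (\<Prod>i<n. avg N (u i))"
  for u :: "nat \<Rightarrow> nat \<Rightarrow> 'a::{real_normed_field}"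
proof (induction n arbitrary: u)
  case (Suc n)
  have "word_avg N (Suc n) (\<lambda>l. \<Prod>i<Suc n. u i (l ! i))
      = avg N (\<lambda>b. u 0 b * word_avg N n (\<lambda>l. \<Prod>i<n. u (Suc i) (l ! i)))"
    by (simp only: word_avg.simps prod.lessThan_Suc_shift nth_Cons_0 nth_Cons_Suc word_avg_mult)
  also have "\<dots> = avg N (u 0) * (\<Prod>i<n. avg N (u (Suc i)))"
    unfolding Suc[of "\<lambda>i. u (Suc i)"] using avg_mult[of N "\<Prod>i<n. avg N (u (Suc i))" "u 0"]
    by (subst (1 2) mult.commute)
  finally show ?case by (simp only: prod.lessThan_Suc_shift)
qed simp

section \<open>Functions with small differences\<close>

text \<open>
  The letters are arbitrary numbers here, not only members of an alphabet, so that one bound serves all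
  alphabets at the same time.
\<close>

definition diff_bdd :: "nat \<Rightarrow> real \<Rightarrow> (nat list \<Rightarrow> real) \<Rightarrow> bool" where
  "diff_bdd n c f \<longleftrightarrow> (\<forall>l i b. length l = n \<longrightarrow> i < n \<longrightarrow> \<bar>f l - f (l[i := b])\<bar> \<le> c)"

definition mixed_diff_bdd :: "nat \<Rightarrow> real \<Rightarrow> (nat list \<Rightarrow> real) \<Rightarrow> bool" where
  "mixed_diff_bdd n c f \<longleftrightarrow> (\<forall>l i j a b. length l = n \<longrightarrow> i < n \<longrightarrow> j < n \<longrightarrow> i \<noteq> j \<longrightarrow>
     \<bar>f l - f (l[i := a]) - f (l[j := b]) + f (l[i := a, j := b])\<bar> \<le> c)"

lemma diff_bddD: "diff_bdd n c f \<Longrightarrow> length l = n \<Longrightarrow> i < n \<Longrightarrow> \<bar>f l - f (l[i := b])\<bar> \<le> c"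
  by (simp add: diff_bdd_def)

lemma diff_bdd_Cons: "diff_bdd (Suc n) c f \<Longrightarrow> diff_bdd n c (\<lambda>l. f (b # l))"
  unfolding diff_bdd_def
proof (intro allI impI)
  fix l :: "nat list" and i a assume *: "\<forall>l i b. length l = Suc n \<longrightarrow> i < Suc n \<longrightarrow> \<bar>f l - f (l[i := b])\<bar> \<le> c"
    "length l = n" "i < n"
  show "\<bar>f (b # l) - f (b # l[i := a])\<bar> \<le> c"
    using *(1)[rule_format, of "b # l" "Suc i" a] *(2,3) by simp
qed

lemma words_length: "l \<in> words N n \<Longrightarrow> length l = n"
  by (simp add: words_def)

lemma abs_word_avg_diff_le:
  fixes f h :: "nat list \<Rightarrow> real"
  assumes "N > 0" "\<And>l. length l = n \<Longrightarrow> \<bar>f l - h l\<bar> \<le> c"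
  shows "\<bar>word_avg N n f - word_avg N n h\<bar> \<le> c"
proof -
  have "norm (word_avg N n (\<lambda>l. f l - h l)) \<le> word_avg N n (\<lambda>l. norm (f l - h l))"
    by (rule norm_word_avg_le)
  also have "\<dots> \<le> word_avg N n (\<lambda>l. c)"
    by (rule word_avg_mono) (use assms words_length in \<open>auto simp: real_norm_def\<close>)
  finally show ?thesis using assms by (simp add: word_avg_diff word_avg_const)
qed

lemma abs_avg_diff_le:
  fixes f :: "nat \<Rightarrow> real"
  assumes "N > 0" "\<And>a. a < N \<Longrightarrow> \<bar>x - f a\<bar> \<le> c"
  shows "\<bar>x - avg N f\<bar> \<le> c"
proof -
  have "norm (avg N (\<lambda>a. x - f a)) \<le> avg N (\<lambda>a. norm (x - f a))"
    by (rule norm_avg_le)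
  also have "\<dots> \<le> avg N (\<lambda>a. c)"
    by (rule avg_mono) (use assms in auto)
  finally show ?thesis using assms by (simp add: avg_diff avg_const)
qed

lemma diff_bdd_head:
  assumes "N > 0" "diff_bdd (Suc n) c f"
  shows "\<bar>word_avg N n (\<lambda>l. f (a # l)) - word_avg N n (\<lambda>l. f (b # l))\<bar> \<le> c"
proof (rule abs_word_avg_diff_le)
  fix l :: "nat list" assume "length l = n"
  then show "\<bar>f (a # l) - f (b # l)\<bar> \<le> c"
    using diff_bddD[OF assms(2), of "a # l" 0 b] by simp
qed fact

lemma sq_le_sq_if_abs_le: "\<bar>x\<bar> \<le> c \<Longrightarrow> x\<^sup>2 \<le> c\<^sup>2" for x c :: real
  using power_mono[of "\<bar>x\<bar>" c 2] by simp

lemma exp_minus_le: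
  fixes u :: real
  assumes "0 \<le> u"
  shows "exp (- u) \<le> 1 - u + u\<^sup>2"
proof -
  have "0 \<le> 1 - u + u\<^sup>2"
    using sum_squares_ge_zero[of "1 - u / 2" "u"] zero_le_power2[of "1 - u / 2"]
    by (simp add: power2_eq_square algebra_simps)
  then have "(1 - u + u\<^sup>2) * (1 + u) \<le> (1 - u + u\<^sup>2) * exp u"
    using exp_ge_add_one_self[of u] by (intro mult_left_mono) auto
  moreover have "1 \<le> (1 - u + u\<^sup>2) * (1 + u)"
    using assms by (simp add: algebra_simps power2_eq_square)
  ultimately have "1 \<le> (1 - u + u\<^sup>2) * exp u" by linarith
  then show ?thesis by (simp add: exp_minus field_simps)
qed

text \<open>
  This plays the part of Hoeffding's lemma: for a variable of mean zero the linear term averages to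
  zero and only \<open>exp (x\<^sup>2)\<close> is left.
\<close>

lemma exp_le_add_exp_sq: "exp x \<le> x + exp (x\<^sup>2)" for x :: real
proof -
  have e: "1 + x\<^sup>2 \<le> exp (x\<^sup>2)" by (rule exp_ge_add_one_self)
  consider "x \<ge> 1" | "0 \<le> x" "x \<le> 1" | "- 1 \<le> x" "x \<le> 0" | "x \<le> - 1" by linarith
  then show ?thesis
  proof cases
    case 1
    then have "x \<le> x\<^sup>2" by (simp add: power2_eq_square)
    then show ?thesis using 1 by (smt (verit) exp_le_cancel_iff)
  next
    case 2
    then have "exp x \<le> 1 + x + x\<^sup>2" by (rule exp_bound)
    then show ?thesis using e by linarith
  next
    case 3
    then have "exp x \<le> 1 + x + x\<^sup>2" using exp_minus_le[of "- x"] by simp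
    then show ?thesis using e by linarith
  next
    case 4
    then have "- x \<le> x\<^sup>2" using mult_mono[of 1 "-x" "-x" "-x"] by (simp add: power2_eq_square)
    moreover have "exp x \<le> 1" using 4 by simp
    ultimately show ?thesis using e by linarith
  qed
qed

lemma avg_exp_le:
  fixes m :: "nat \<Rightarrow> real"
  assumes "N > 0" "\<And>b. b < N \<Longrightarrow> \<bar>m b - avg N m\<bar> \<le> c"
  shows "avg N (\<lambda>b. exp (m b)) \<le> exp (c\<^sup>2) * exp (avg N m)"
proof -
  let ?z = "\<lambda>b. m b - avg N m"
  have "avg N (\<lambda>b. exp (?z b)) \<le> avg N (\<lambda>b. ?z b + exp (c\<^sup>2))"
  proof (rule avg_mono)
    fix b assume "b < N"
    then have "(?z b)\<^sup>2 \<le> c\<^sup>2" by (intro sq_le_sq_if_abs_le assms(2))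
    then show "exp (?z b) \<le> ?z b + exp (c\<^sup>2)"
      using exp_le_add_exp_sq[of "?z b"] by (smt (verit) exp_le_cancel_iff)
  qed
  also have "\<dots> = exp (c\<^sup>2)" using assms(1) by (simp add: avg_add avg_diff avg_const)
  finally have "avg N (\<lambda>b. exp (?z b)) * exp (avg N m) \<le> exp (c\<^sup>2) * exp (avg N m)"
    by (rule mult_right_mono) simp
  also have "avg N (\<lambda>b. exp (?z b)) * exp (avg N m) = avg N (\<lambda>b. exp (m b))"
    using avg_mult[of N "exp (avg N m)" "\<lambda>b. exp (?z b)"]
    by (simp add: mult.commute exp_diff)
  finally show ?thesis .
qed

text \<open>
  The bounded differences inequality in its exponential form. Given the first letter, the induction
  hypothesis bounds the average over the other letters; the conditional means move by at most \<open>c\<close> with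
  the first letter, so \<open>avg_exp_le\<close> contributes one more factor \<open>exp (c\<^sup>2)\<close>.
\<close>

lemma word_avg_exp_le:
  fixes f :: "nat list \<Rightarrow> real"
  assumes "N > 0" "diff_bdd n c f"
  shows "word_avg N n (\<lambda>l. exp (f l)) \<le> exp (real n * c\<^sup>2) * exp (word_avg N n f)"
  using assms(2)
proof (induction n arbitrary: f)
  case (Suc n)
  let ?m = "\<lambda>b. word_avg N n (\<lambda>l. f (b # l))"
  have "word_avg N (Suc n) (\<lambda>l. exp (f l)) \<le> avg N (\<lambda>b. exp (real n * c\<^sup>2) * exp (?m b))"
    by (simp, intro avg_mono Suc.IH diff_bdd_Cons Suc.prems)
  also have "\<dots> = exp (real n * c\<^sup>2) * avg N (\<lambda>b. exp (?m b))"
    by (rule avg_mult)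
  also have "\<dots> \<le> exp (real n * c\<^sup>2) * (exp (c\<^sup>2) * exp (avg N ?m))"
    by (intro mult_left_mono avg_exp_le assms abs_avg_diff_le diff_bdd_head Suc.prems) auto
  finally show ?case by (simp add: exp_add[symmetric] algebra_simps)
qed simp

text \<open>
  By the law of total variance, each letter contributes at most \<open>c\<^sup>2\<close>.
\<close>

lemma word_avg_variance_le:
  fixes f :: "nat list \<Rightarrow> real"
  assumes "N > 0" "diff_bdd n c f"
  shows "word_avg N n (\<lambda>l. (f l - word_avg N n f)\<^sup>2) \<le> real n * c\<^sup>2"
  using assms(2)
proof (induction n arbitrary: f)
  case (Suc n)
  let ?m = "\<lambda>b. word_avg N n (\<lambda>l. f (b # l))"
  let ?M = "avg N ?m"
  have "word_avg N (Suc n) (\<lambda>l. (f l - word_avg N (Suc n) f)\<^sup>2)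
      = avg N (\<lambda>b. word_avg N n (\<lambda>l. (f (b # l) - ?m b)\<^sup>2) + (?m b - ?M)\<^sup>2)"
  proof (simp, rule avg_cong)
    fix b
    have "word_avg N n (\<lambda>l. (f (b # l) - ?M)\<^sup>2)
      = word_avg N n (\<lambda>l. (f (b # l) - ?m b)\<^sup>2 + (2 * (?m b - ?M)) * (f (b # l) - ?m b) + (?m b - ?M)\<^sup>2)"
      by (rule word_avg_cong) (simp add: power2_eq_square algebra_simps)
    also have "\<dots> = word_avg N n (\<lambda>l. (f (b # l) - ?m b)\<^sup>2) + (?m b - ?M)\<^sup>2"
      using assms(1) by (simp add: word_avg_add word_avg_mult word_avg_diff word_avg_const)
    finally show "word_avg N n (\<lambda>l. (f (b # l) - ?M)\<^sup>2)
      = word_avg N n (\<lambda>l. (f (b # l) - ?m b)\<^sup>2) + (?m b - ?M)\<^sup>2" .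
  qed
  also have "\<dots> \<le> avg N (\<lambda>b. real n * c\<^sup>2 + c\<^sup>2)"
  proof (intro avg_mono add_mono Suc.IH diff_bdd_Cons Suc.prems)
    fix b
    have "\<bar>?m b - ?M\<bar> \<le> c"
      by (intro abs_avg_diff_le diff_bdd_head assms Suc.prems)
    then show "(?m b - ?M)\<^sup>2 \<le> c\<^sup>2" by (rule sq_le_sq_if_abs_le)
  qed
  also have "\<dots> = real (Suc n) * c\<^sup>2" using assms(1) by (simp add: avg_const algebra_simps)
  finally show ?case .
qed simp

section \<open>The projection onto sums of functions of one letter\<close>

text \<open>
  The conditional mean given that letter \<open>i\<close> is \<open>y\<close>, centred: the first-order term in the Hoeffding
  decomposition of \<open>f\<close>.
\<close>

definition proj :: "nat \<Rightarrow> nat \<Rightarrow> (nat list \<Rightarrow> real) \<Rightarrow> nat \<Rightarrow> nat \<Rightarrow> real" where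
  "proj N n f i y = word_avg N n (\<lambda>l. f (l[i := y])) - word_avg N n f"

lemma word_avg_update_avg:
  "i < n \<Longrightarrow> avg N (\<lambda>y. word_avg N n (\<lambda>l. f (l[i := y]))) = word_avg N n f"
proof (cases "N = 0")
  case True
  then show "i < n \<Longrightarrow> ?thesis" by (cases n) (auto simp: avg_def)
next
  case False
  then have N: "N > 0" by simp
  show "i < n \<Longrightarrow> ?thesis"
  proof (induction n arbitrary: f i)
    case (Suc n)
    show ?case
    proof (cases i)
      case 0
      then show ?thesis using N by (simp add: avg_const)
    next
      case (Suc j)
      then have "avg N (\<lambda>y. word_avg N (Suc n) (\<lambda>l. f (l[i := y])))
        = avg N (\<lambda>b. avg N (\<lambda>y. word_avg N n (\<lambda>l. f (b # l[j := y]))))"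
        \<comment> \<open>words of length 1 serve as the average over the first letter\<close>
        using avg_word_avg_swap[of N 1 "\<lambda>y bl. word_avg N n (\<lambda>l. f (hd bl # l[j := y]))"] by simp
      also have "\<dots> = word_avg N (Suc n) f"
        using Suc Suc.prems Suc.IH[of j "\<lambda>l. f (_ # l)"] by simp
      finally show ?thesis .
    qed
  qed simp
qed

lemma avg_proj: "N > 0 \<Longrightarrow> i < n \<Longrightarrow> avg N (proj N n f i) = 0"
  unfolding proj_def by (simp add: avg_diff avg_const word_avg_update_avg)

text \<open>
  What the first-order terms miss is controlled by the interaction of pairs of letters. The
  induction splits off the first letter \<open>b\<close>. Let \<open>h\<close> be the average of \<open>f\<close> over it. The remainder of \<open>f\<close>
  is the remainder of \<open>h\<close> plus \<open>u b - E (u b)\<close> with \<open>u b l = f (b # l) - h l\<close>. The second part averages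
  to zero over \<open>b\<close>, so the two parts are orthogonal. Each \<open>u b\<close> is an average of differences of \<open>f\<close> in
  its first letter, hence its own differences are mixed differences of \<open>f\<close>, and its variance is at most
  \<open>n c\<^sup>2\<close>.
\<close>

lemma word_avg_remainder_sq_le:
  fixes f :: "nat list \<Rightarrow> real"
  assumes "N > 0" "mixed_diff_bdd n c f"
  shows "word_avg N n (\<lambda>l. (f l - word_avg N n f - (\<Sum>i<n. proj N n f i (l ! i)))\<^sup>2) \<le> (real n)\<^sup>2 * c\<^sup>2"
  using assms(2)
proof (induction n arbitrary: f)
  case (Suc n)
  define h where "h = (\<lambda>l. avg N (\<lambda>b. f (b # l)))"
  define m where "m = (\<lambda>b. word_avg N n (\<lambda>l. f (b # l)))"
  define R where "R = (\<lambda>l. h l - word_avg N n h - (\<Sum>i<n. proj N n h i (l ! i)))"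
  define u where "u = (\<lambda>b l. f (b # l) - h l)"
  have Eh: "word_avg N (Suc n) f = word_avg N n h"
    by (simp add: h_def avg_word_avg_swap)
  have Eu: "word_avg N n (u b) = m b - word_avg N n h" for b
    by (simp add: u_def m_def word_avg_diff)
  have R: "f (b # l) - word_avg N (Suc n) f - (\<Sum>i<Suc n. proj N (Suc n) f i ((b # l) ! i))
      = R l + (u b l - word_avg N n (u b))" for b l
  proof -
    have 0: "proj N (Suc n) f 0 b = m b - word_avg N n h"
      using assms(1) by (simp add: proj_def Eh[simplified] avg_const m_def)
    have S: "proj N (Suc n) f (Suc i) y = proj N n h i y" for i y
      by (simp add: proj_def Eh[simplified] h_def avg_word_avg_swap)
    show ?thesis
      unfolding sum.lessThan_Suc_shift nth_Cons_0 nth_Cons_Suc 0 S Eh Eu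
      by (simp add: R_def u_def)
  qed
  have "word_avg N (Suc n) (\<lambda>l. (f l - word_avg N (Suc n) f - (\<Sum>i<Suc n. proj N (Suc n) f i (l ! i)))\<^sup>2)
      = avg N (\<lambda>b. word_avg N n (\<lambda>l. (R l + (u b l - word_avg N n (u b)))\<^sup>2))"
    unfolding word_avg.simps(2)[of N n "\<lambda>l. (f l - word_avg N (Suc n) f - (\<Sum>i<Suc n. proj N (Suc n) f i (l ! i)))\<^sup>2"] R ..
  also have "\<dots> = word_avg N n (\<lambda>l. avg N (\<lambda>b. (R l)\<^sup>2 + (2 * R l) * (u b l - word_avg N n (u b)) + (u b l - word_avg N n (u b))\<^sup>2))"
    unfolding avg_word_avg_swap[symmetric]
    by (intro avg_cong word_avg_cong) (simp add: power2_eq_square algebra_simps)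
  also have "\<dots> = word_avg N n (\<lambda>l. (R l)\<^sup>2 + avg N (\<lambda>b. (u b l - word_avg N n (u b))\<^sup>2))"
  proof (rule word_avg_cong)
    fix l
    have "avg N (\<lambda>b. u b l - word_avg N n (u b)) = 0"
      using assms(1) unfolding Eu
      by (simp add: avg_diff avg_const u_def h_def m_def avg_word_avg_swap)
    then show "avg N (\<lambda>b. (R l)\<^sup>2 + (2 * R l) * (u b l - word_avg N n (u b)) + (u b l - word_avg N n (u b))\<^sup>2)
       = (R l)\<^sup>2 + avg N (\<lambda>b. (u b l - word_avg N n (u b))\<^sup>2)"
      unfolding avg_add avg_mult using assms(1) by (simp add: avg_const)
  qed
  also have "\<dots> = word_avg N n (\<lambda>l. (R l)\<^sup>2) + avg N (\<lambda>b. word_avg N n (\<lambda>l. (u b l - word_avg N n (u b))\<^sup>2))"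
    by (simp add: word_avg_add avg_word_avg_swap)
  also have "\<dots> \<le> (real n)\<^sup>2 * c\<^sup>2 + avg N (\<lambda>b. real n * c\<^sup>2)"
  proof (intro add_mono avg_mono word_avg_variance_le assms)
    show "word_avg N n (\<lambda>l. (R l)\<^sup>2) \<le> (real n)\<^sup>2 * c\<^sup>2"
      unfolding R_def
    proof (rule Suc.IH, unfold mixed_diff_bdd_def, intro allI impI)
      fix l :: "nat list" and i j a b assume *: "length l = n" "i < n" "j < n" "i \<noteq> j"
      have "\<bar>0 - avg N (\<lambda>x. - (f (x # l) - f (x # l[i := a]) - f (x # l[j := b]) + f (x # l[i := a, j := b])))\<bar> \<le> c"
      proof (rule abs_avg_diff_le[OF assms(1)])
        fix x
        show "\<bar>0 - - (f (x # l) - f (x # l[i := a]) - f (x # l[j := b]) + f (x # l[i := a, j := b]))\<bar> \<le> c"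
          using Suc.prems[unfolded mixed_diff_bdd_def, rule_format, of "x # l" "Suc i" "Suc j" a b] * by simp
      qed
      then show "\<bar>h l - h (l[i := a]) - h (l[j := b]) + h (l[i := a, j := b])\<bar> \<le> c"
        by (simp add: h_def avg_diff avg_add avg_def sum_negf)
    qed
    fix b
    show "diff_bdd n c (u b)" unfolding diff_bdd_def
    proof (intro allI impI)
      fix l :: "nat list" and i a assume *: "length l = n" "i < n"
      have "\<bar>(f (b # l) - f (b # l[i := a])) - avg N (\<lambda>x. f (x # l) - f (x # l[i := a]))\<bar> \<le> c"
      proof (rule abs_avg_diff_le[OF assms(1)])
        fix x
        show "\<bar>(f (b # l) - f (b # l[i := a])) - (f (x # l) - f (x # l[i := a]))\<bar> \<le> c"
          using Suc.prems[unfolded mixed_diff_bdd_def, rule_format, of "b # l" "Suc i" 0 a x] * by simp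
      qed
      then show "\<bar>u b l - u b (l[i := a])\<bar> \<le> c"
        by (simp add: u_def h_def avg_diff algebra_simps)
    qed
  qed
  also have "\<dots> = ((real n)\<^sup>2 + real n) * c\<^sup>2"
    using assms(1) by (simp add: avg_const algebra_simps)
  also have "\<dots> \<le> (real (Suc n))\<^sup>2 * c\<^sup>2"
    by (intro mult_right_mono) (auto simp: power2_eq_square algebra_simps)
  finally show ?case .
qed simp

section \<open>Order isomorphic words\<close>

definition order_iso :: "nat list \<Rightarrow> nat list \<Rightarrow> bool" where
  "order_iso \<sigma> w \<longleftrightarrow> length w = length \<sigma> \<and>
     (\<forall>i<length \<sigma>. \<forall>j<length \<sigma>. \<sigma> ! i < \<sigma> ! j \<longleftrightarrow> w ! i < w ! j)"

text \<open>
  The word with set of letters \<open>S\<close> whose letters are arranged in the order of the permutation \<open>\<sigma>\<close>. The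
  entries of \<open>\<sigma>\<close> start at 1 and list positions at 0, hence the subtraction.
\<close>

definition realize :: "nat set \<Rightarrow> nat list \<Rightarrow> nat list" where
  "realize S \<sigma> = map (\<lambda>r. sorted_list_of_set S ! (r - 1)) \<sigma>"

lemma perms_iff: "\<sigma> \<in> perms k \<longleftrightarrow> set \<sigma> = {1..k} \<and> distinct \<sigma>"
  by (auto simp: perms_def permutations_of_set_def)

lemma perms_length: "\<sigma> \<in> perms k \<Longrightarrow> length \<sigma> = k"
  using distinct_card[of \<sigma>] by (auto simp: perms_iff)

lemma finite_perms [simp]: "finite (perms n)"
  by (simp add: perms_def)

lemma card_perms: "card (perms n) = fact n"
  by (simp add: perms_def)

lemma perms_nth: "\<sigma> \<in> perms k \<Longrightarrow> i < k \<Longrightarrow> 1 \<le> \<sigma> ! i \<and> \<sigma> ! i \<le> k"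
  using nth_mem[of i \<sigma>] by (auto simp: perms_iff perms_length)

lemma nth_sorted_list_of_set_less_iff:
  fixes S :: "nat set"
  assumes "i < card S" "j < card S"
  shows "sorted_list_of_set S ! i < sorted_list_of_set S ! j \<longleftrightarrow> i < j"
proof -
  have "sorted_wrt (<) (sorted_list_of_set S)" by simp
  then show ?thesis
    using assms by (metis sorted_wrt_nth_less length_sorted_list_of_set linorder_neqE_nat order_less_asym less_irrefl)
qed

lemma nth_sorted_list_of_set_pred_less_iff:
  fixes S :: "nat set"
  assumes "r \<in> {1..card S}" "s \<in> {1..card S}"
  shows "sorted_list_of_set S ! (r - 1) < sorted_list_of_set S ! (s - 1) \<longleftrightarrow> r < s"
proof -
  have "r - 1 < card S" "s - 1 < card S" using assms by auto
  then show ?thesis using assms by (simp only: nth_sorted_list_of_set_less_iff) auto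
qed

lemma nth_sorted_list_of_set_rank:
  fixes S :: "nat set"
  assumes "finite S" "y \<in> S"
  shows "sorted_list_of_set S ! card {x\<in>S. x < y} = y"
proof -
  let ?xs = "sorted_list_of_set S"
  obtain i where i: "i < card S" "?xs ! i = y"
    using assms by (metis in_set_conv_nth length_sorted_list_of_set set_sorted_list_of_set)
  have "{x\<in>S. x < y} = (\<lambda>j. ?xs ! j) ` {..<i}"
  proof (intro equalityI subsetI)
    fix x assume "x \<in> {x\<in>S. x < y}"
    then obtain j where "j < card S" "?xs ! j = x" "x < y"
      using assms(1) by (metis (mono_tags, lifting) in_set_conv_nth length_sorted_list_of_set set_sorted_list_of_set mem_Collect_eq)
    then show "x \<in> (\<lambda>j. ?xs ! j) ` {..<i}"
      using i nth_sorted_list_of_set_less_iff[of j S i] by auto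
  next
    fix x assume "x \<in> (\<lambda>j. ?xs ! j) ` {..<i}"
    then obtain j where "j < i" "x = ?xs ! j" by auto
    then show "x \<in> {x\<in>S. x < y}"
      using i nth_sorted_list_of_set_less_iff[of j S i] assms(1)
        nth_mem[of j ?xs] by auto
  qed
  moreover have "inj_on (\<lambda>j. ?xs ! j) {..<i}"
    using i by (auto simp: inj_on_def nth_eq_iff_index_eq)
  ultimately have "card {x\<in>S. x < y} = i" by (simp add: card_image)
  then show ?thesis using i by simp
qed

lemma realize_nth_less_iff:
  assumes "\<sigma> \<in> perms k" "card S = k" "i < k" "j < k"
  shows "realize S \<sigma> ! i < realize S \<sigma> ! j \<longleftrightarrow> \<sigma> ! i < \<sigma> ! j"
  using assms perms_nth[OF assms(1), of i] perms_nth[OF assms(1), of j] perms_length[OF assms(1)]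
    nth_sorted_list_of_set_pred_less_iff[of "\<sigma> ! i" S "\<sigma> ! j"]
  unfolding realize_def by simp

lemma order_iso_realize: "\<sigma> \<in> perms k \<Longrightarrow> card S = k \<Longrightarrow> order_iso \<sigma> (realize S \<sigma>)"
  by (auto simp: order_iso_def realize_nth_less_iff perms_length) (simp add: realize_def perms_length)

lemma set_realize:
  assumes "\<sigma> \<in> perms k" "card S = k" "finite S"
  shows "set (realize S \<sigma>) = S"
proof -
  have "set (realize S \<sigma>) = (\<lambda>r. sorted_list_of_set S ! (r - 1)) ` {1..k}"
    using assms(1) by (simp add: realize_def perms_iff)
  also have "\<dots> = (\<lambda>r. sorted_list_of_set S ! r) ` {..<k}"
  proof -
    have "{..<k} = (\<lambda>r. r - 1) ` {1..k}" by (auto simp: image_iff intro!: bexI[of _ "Suc _"])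
    then show ?thesis by (simp add: image_image)
  qed
  also have "\<dots> = set (sorted_list_of_set S)"
    using assms(2) by (simp add: lessThan_atLeast0 nth_image)
  finally show ?thesis using assms by simp
qed

lemma order_iso_distinct:
  assumes "order_iso \<sigma> w" "distinct \<sigma>"
  shows "distinct w"
  unfolding distinct_conv_nth
proof (intro allI impI)
  fix i j assume "i < length w" "j < length w" "i \<noteq> j"
  moreover from this have "\<sigma> ! i \<noteq> \<sigma> ! j"
    using assms by (simp add: order_iso_def nth_eq_iff_index_eq)
  ultimately have "\<sigma> ! i < \<sigma> ! j \<or> \<sigma> ! j < \<sigma> ! i" by linarith
  then show "w ! i \<noteq> w ! j"
    using assms(1) \<open>i < length w\<close> \<open>j < length w\<close> unfolding order_iso_def by auto
qed

text \<open>
  A word is determined by its set of letters and its order: an entry of \<open>\<sigma>\<close> is one more than the number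
  of smaller entries of \<open>\<sigma>\<close>, which equals the number of smaller letters of \<open>w\<close>.
\<close>

lemma order_iso_imp_realize:
  assumes \<sigma>: "\<sigma> \<in> perms k" and w: "order_iso \<sigma> w"
  shows "card (set w) = k" "w = realize (set w) \<sigma>"
proof -
  have len: "length w = k" "length \<sigma> = k"
    using \<sigma> w by (auto simp: order_iso_def perms_length)
  have dw: "distinct w" using order_iso_distinct[OF w] \<sigma> by (simp add: perms_iff)
  show "card (set w) = k" using dw len distinct_card by metis
  show "w = realize (set w) \<sigma>"
  proof (rule nth_equalityI)
    fix i assume i: "i < length w"
    have "{x \<in> set w. x < w ! i} = (\<lambda>j. w ! j) ` {j. j < k \<and> w ! j < w ! i}"
      using len by (auto simp: in_set_conv_nth image_iff)
    then have "card {x \<in> set w. x < w ! i} = card {j. j < k \<and> w ! j < w ! i}"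
      using dw len by (simp add: card_image inj_on_def nth_eq_iff_index_eq)
    also have "{j. j < k \<and> w ! j < w ! i} = {j. j < k \<and> \<sigma> ! j < \<sigma> ! i}"
      using w i len unfolding order_iso_def by auto
    also have "card \<dots> = card ((\<lambda>j. \<sigma> ! j) ` {j. j < k \<and> \<sigma> ! j < \<sigma> ! i})"
      using \<sigma> len by (subst card_image) (auto simp: inj_on_def nth_eq_iff_index_eq perms_iff)
    also have "(\<lambda>j. \<sigma> ! j) ` {j. j < k \<and> \<sigma> ! j < \<sigma> ! i} = {x \<in> set \<sigma>. x < \<sigma> ! i}"
      using len by (auto simp: in_set_conv_nth image_iff)
    also have "\<dots> = {1..<\<sigma> ! i}"
      using \<sigma> perms_nth[OF \<sigma>, of i] i len by (auto simp: perms_iff)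
    finally have "card {x \<in> set w. x < w ! i} = \<sigma> ! i - 1" by simp
    then have "sorted_list_of_set (set w) ! (\<sigma> ! i - 1) = w ! i"
      using nth_sorted_list_of_set_rank[of "set w" "w ! i"] i by simp
    then show "w ! i = realize (set w) \<sigma> ! i" using i len by (simp add: realize_def)
  qed (simp add: realize_def len)
qed

lemma order_iso_perms_eq:
  assumes "\<rho> \<in> perms k" "\<rho>' \<in> perms k" "order_iso \<rho> \<rho>'"
  shows "\<rho> = \<rho>'"
proof -
  have "order_iso \<rho> \<rho>" by (simp add: order_iso_def)
  then have "\<rho> = realize (set \<rho>) \<rho>" by (rule order_iso_imp_realize(2)[OF assms(1)])
  moreover have "\<rho>' = realize (set \<rho>') \<rho>" by (rule order_iso_imp_realize(2)[OF assms(1,3)])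
  ultimately show ?thesis using assms by (simp add: perms_iff)
qed

text \<open>
  The permutation is obtained by replacing each letter by its rank.
\<close>

lemma ex_order_iso:
  assumes "distinct w"
  shows "\<exists>\<pi>\<in>perms (length w). order_iso \<pi> w"
proof -
  define r where "r = (\<lambda>y. card {x\<in>set w. x \<le> y})"
  have mono: "r y < r y'" if "y < y'" "y' \<in> set w" for y y'
    unfolding r_def
  proof (rule psubset_card_mono)
    have "y' \<in> {x \<in> set w. x \<le> y'} - {x \<in> set w. x \<le> y}" using that by auto
    then show "{x \<in> set w. x \<le> y} \<subset> {x \<in> set w. x \<le> y'}" using that by fastforce
  qed simp
  have iff: "r y < r y' \<longleftrightarrow> y < y'" if "y \<in> set w" "y' \<in> set w" for y y'
    using mono[of y y'] mono[of y' y] that by (metis linorder_neqE_nat less_irrefl order_less_asym)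
  have dist: "distinct (map r w)"
    using assms iff by (auto simp: distinct_map inj_on_def) (metis less_irrefl linorder_neqE_nat)
  have "set (map r w) = {1..length w}"
  proof (rule card_subset_eq)
    show "set (map r w) \<subseteq> {1..length w}"
    proof
      fix z assume "z \<in> set (map r w)"
      then obtain y where y: "y \<in> set w" "z = r y" by auto
      have "{x\<in>set w. x \<le> y} \<noteq> {}" using y by auto
      then have "1 \<le> r y" by (simp add: r_def Suc_le_eq card_gt_0_iff)
      moreover have "r y \<le> card (set w)" unfolding r_def by (rule card_mono) auto
      ultimately show "z \<in> {1..length w}" using y assms by (simp add: distinct_card)
    qed
    show "card (set (map r w)) = card {1..length w}"
      using distinct_card[OF dist] by simp
  qed simp
  then have "map r w \<in> perms (length w)" using dist by (simp add: perms_iff)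
  moreover have "order_iso (map r w) w" by (simp add: order_iso_def iff)
  ultimately show ?thesis by blast
qed

lemma red_eq_iff:
  assumes "distinct w" "\<sigma> \<in> perms (length w)"
  shows "red (map real w) = \<sigma> \<longleftrightarrow> order_iso \<sigma> w"
proof -
  have *: "(\<rho> \<in> perms (length (map real w)) \<and>
     (\<forall>i<length (map real w). \<forall>j<length (map real w). \<rho> ! i < \<rho> ! j \<longleftrightarrow> map real w ! i < map real w ! j))
     \<longleftrightarrow> \<rho> \<in> perms (length w) \<and> order_iso \<rho> w" for \<rho>
    using perms_length[of \<rho> "length w"] by (auto simp: order_iso_def)
  obtain \<pi> where \<pi>: "\<pi> \<in> perms (length w)" "order_iso \<pi> w" using ex_order_iso[OF assms(1)] by blast
  have uniq: "\<rho> = \<pi>" if "\<rho> \<in> perms (length w) \<and> order_iso \<rho> w" for \<rho>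
  proof (rule order_iso_perms_eq)
    show "order_iso \<rho> \<pi>" using that \<pi>(2) unfolding order_iso_def by simp
  qed (use that \<pi>(1) in blast)+
  have "red (map real w) = \<pi>"
    unfolding red_def * by (rule the_equality) (use \<pi> uniq in blast)+
  then show ?thesis using uniq[of \<sigma>] \<pi> assms(2) by blast
qed

section \<open>Counting occurrences\<close>

definition subsets :: "nat \<Rightarrow> nat \<Rightarrow> nat set set" where
  "subsets n k = {A. A \<subseteq> {..<n} \<and> card A = k}"

lemma finite_subsets [simp]: "finite (subsets n k)"
  unfolding subsets_def by (rule finite_subset[of _ "Pow {..<n}"]) auto

lemma card_subsets: "card (subsets n k) = n choose k"
  using n_subsets[of "{..<n}" k] by (simp add: subsets_def)

lemma subsetsD: "A \<in> subsets n k \<Longrightarrow> A \<subseteq> {..<n} \<and> card A = k \<and> finite A"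
  by (auto simp: subsets_def intro: finite_subset)

text \<open>
  Index tuples are replaced by index sets. The definition makes sense for all words; an occurrence
  in a word with repeated letters still has pairwise different letters, because the entries of a
  permutation are different.
\<close>

definition patcount :: "nat list \<Rightarrow> nat list \<Rightarrow> real" where
  "patcount \<sigma> l = (\<Sum>A\<in>subsets (length l) (length \<sigma>). of_bool (order_iso \<sigma> (nths l A)))"

lemma nths_eq_map_nth:
  assumes "A \<subseteq> {..<length l}"
  shows "nths l A = map ((!) l) (sorted_list_of_set A)"
proof -
  have "finite A" using assms finite_subset by blast
  have "nths l A = map ((!) l) (filter (\<lambda>i. i \<in> A) [0..<length l])"
  proof -
    have "zip l [0..<length l] = map (\<lambda>i. (l ! i, i)) [0..<length l]"
      by (rule nth_equalityI) auto
    then show ?thesis by (simp add: nths_def filter_map o_def)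
  qed
  also have "filter (\<lambda>i. i \<in> A) [0..<length l] = sorted_list_of_set A"
  proof -
    have "set (filter (\<lambda>i. i \<in> A) [0..<length l]) = A" using assms by auto
    moreover have "sorted (filter (\<lambda>i. i \<in> A) [0..<length l])"
      by (simp add: sorted_wrt_filter)
    ultimately show ?thesis
      using sorted_list_of_set.idem_if_sorted_distinct[of "filter (\<lambda>i. i \<in> A) [0..<length l]"]
      by simp
  qed
  finally show ?thesis .
qed

lemma occ_eq_patcount:
  assumes "\<pi> \<in> perms n" "\<sigma> \<in> perms k"
  shows "real (occ \<sigma> \<pi>) = patcount \<sigma> \<pi>"
proof -
  have len: "length \<pi> = n" "length \<sigma> = k" using assms by (auto simp: perms_length)
  let ?I = "{is. length is = length \<sigma> \<and> sorted_wrt (<) is \<and> set is \<subseteq> {..<length \<pi>} \<and>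
     red (map (\<lambda>i. real (\<pi> ! i)) is) = \<sigma>}"
  let ?J = "{A \<in> subsets (length \<pi>) (length \<sigma>). order_iso \<sigma> (nths \<pi> A)}"
  have red: "red (map (\<lambda>i. real (\<pi> ! i)) is) = \<sigma> \<longleftrightarrow> order_iso \<sigma> (nths \<pi> (set is))"
    if "length is = k" "sorted_wrt (<) is" "set is \<subseteq> {..<n}" for "is"
  proof -
    have "sorted_list_of_set (set is) = is"
      using that(2) by (simp add: sorted_list_of_set.idem_if_sorted_distinct strict_sorted_iff)
    then have n: "nths \<pi> (set is) = map ((!) \<pi>) is"
      using that(3) len by (simp add: nths_eq_map_nth)
    have "distinct (map ((!) \<pi>) is)"
      using that assms len by (auto simp: distinct_map strict_sorted_iff perms_iff intro!: inj_on_nth)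
    then have "red (map real (map ((!) \<pi>) is)) = \<sigma> \<longleftrightarrow> order_iso \<sigma> (map ((!) \<pi>) is)"
      by (rule red_eq_iff) (simp add: that assms)
    then show ?thesis by (simp add: n o_def)
  qed
  have "card ?I = card ?J"
  proof (rule bij_betw_same_card, rule bij_betwI[where f=set and g=sorted_list_of_set])
    show "set \<in> ?I \<rightarrow> ?J"
      using red len by (auto simp: subsets_def strict_sorted_iff distinct_card)
    show "sorted_list_of_set \<in> ?J \<rightarrow> ?I"
    proof
      fix A assume A: "A \<in> ?J"
      then have "A \<subseteq> {..<n}" "card A = k" "finite A" using len subsetsD by auto
      then show "sorted_list_of_set A \<in> ?I"
        using red[of "sorted_list_of_set A"] A len by auto
    qed
    show "sorted_list_of_set (set x) = x" if "x \<in> ?I" for x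
      using that by (simp add: sorted_list_of_set.idem_if_sorted_distinct strict_sorted_iff)
    show "set (sorted_list_of_set y) = y" if "y \<in> ?J" for y
      using that subsetsD by auto
  qed
  then show ?thesis
    unfolding occ_def patcount_def by (simp add: sum.If_cases Int_def of_bool_def)
qed

text \<open>
  Only the relative order of the letters matters.
\<close>

lemma patcount_realize:
  assumes "\<pi> \<in> perms n" "card S = n"
  shows "patcount \<sigma> (realize S \<pi>) = patcount \<sigma> \<pi>"
proof -
  have len: "length (realize S \<pi>) = length \<pi>" by (simp add: realize_def)
  have "order_iso \<sigma> (nths (realize S \<pi>) A) \<longleftrightarrow> order_iso \<sigma> (nths \<pi> A)" for A
  proof -
    have n: "nths (realize S \<pi>) A = map (\<lambda>r. sorted_list_of_set S ! (r - 1)) (nths \<pi> A)"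
      by (simp add: realize_def nths_map)
    have "(nths \<pi> A ! i) \<in> {1..n}" if "i < length (nths \<pi> A)" for i
      using that assms(1) by (metis in_set_nthsD nth_mem perms_iff)
    then have "map (\<lambda>r. sorted_list_of_set S ! (r - 1)) (nths \<pi> A) ! i
        < map (\<lambda>r. sorted_list_of_set S ! (r - 1)) (nths \<pi> A) ! j \<longleftrightarrow> nths \<pi> A ! i < nths \<pi> A ! j"
      if "i < length (nths \<pi> A)" "j < length (nths \<pi> A)" for i j
      using that assms(2) nth_sorted_list_of_set_pred_less_iff[of "nths \<pi> A ! i" S "nths \<pi> A ! j"]
      by simp
    then show ?thesis unfolding n order_iso_def by auto
  qed
  then show ?thesis by (simp add: patcount_def len)
qed

section \<open>Random words and random permutations\<close>

text \<open>
  A word without repetitions is the same as a set of letters together with a permutation.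
\<close>

lemma sum_distinct_words:
  fixes F :: "nat list \<Rightarrow> real"
  shows "(\<Sum>l\<in>{l\<in>words N n. distinct l}. F l) = (\<Sum>S\<in>subsets N n. \<Sum>\<pi>\<in>perms n. F (realize S \<pi>))"
proof -
  have "(\<Sum>S\<in>subsets N n. \<Sum>\<pi>\<in>perms n. F (realize S \<pi>)) = (\<Sum>p\<in>subsets N n \<times> perms n. F (realize (fst p) (snd p)))"
    by (simp add: sum.cartesian_product case_prod_unfold)
  also have "\<dots> = (\<Sum>l\<in>{l\<in>words N n. distinct l}. F l)"
  proof (rule sum.reindex_bij_betw)
    show "bij_betw (\<lambda>p. realize (fst p) (snd p)) (subsets N n \<times> perms n) {l \<in> words N n. distinct l}"
      unfolding bij_betw_def
    proof (intro conjI equalityI subsetI inj_onI)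
      fix p q assume p: "p \<in> subsets N n \<times> perms n" and q: "q \<in> subsets N n \<times> perms n"
        and eq: "realize (fst p) (snd p) = realize (fst q) (snd q)"
      have 1: "fst p = fst q"
        using set_realize[of "snd p" n "fst p"] set_realize[of "snd q" n "fst q"] p q subsetsD eq by auto
      have "order_iso (snd p) (realize (fst p) (snd p))" "order_iso (snd q) (realize (fst p) (snd p))"
        using p q subsetsD eq order_iso_realize by (metis mem_Sigma_iff prod.collapse)+
      then have "order_iso (snd p) (snd q)" unfolding order_iso_def by simp
      then have "snd p = snd q" using p q by (intro order_iso_perms_eq) auto
      then show "p = q" using 1 by (simp add: prod_eq_iff)
    next
      fix l assume "l \<in> (\<lambda>p. realize (fst p) (snd p)) ` (subsets N n \<times> perms n)"
      then obtain S \<pi> where *: "S \<in> subsets N n" "\<pi> \<in> perms n" "l = realize S \<pi>" by auto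
      have "distinct l"
        using order_iso_distinct[OF order_iso_realize[of \<pi> n S]] * subsetsD by (auto simp: perms_iff)
      moreover have "length l = n" using * by (simp add: realize_def perms_length)
      moreover have "set l \<subseteq> {..<N}" using * subsetsD set_realize by metis
      ultimately show "l \<in> {l \<in> words N n. distinct l}" by (simp add: words_def)
    next
      fix l assume l: "l \<in> {l \<in> words N n. distinct l}"
      then obtain \<pi> where \<pi>: "\<pi> \<in> perms n" "order_iso \<pi> l"
        using ex_order_iso[of l] by (auto simp: words_def)
      have "set l \<in> subsets N n" using l order_iso_imp_realize(1)[OF \<pi>] by (auto simp: subsets_def words_def)
      moreover have "l = realize (set l) \<pi>" by (rule order_iso_imp_realize(2)[OF \<pi>])
      ultimately show "l \<in> (\<lambda>p. realize (fst p) (snd p)) ` (subsets N n \<times> perms n)"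
        using \<pi> by (metis (no_types, lifting) SigmaI fst_conv image_eqI snd_conv)
    qed
  qed
  finally show ?thesis by simp
qed

text \<open>
  The union bound over pairs of letters: a new letter repeats one of the \<open>n\<close> others with probability at
  most \<open>n / N\<close>.
\<close>

lemma word_avg_not_distinct_le:
  assumes "N > 0"
  shows "word_avg N n (\<lambda>l. of_bool (\<not> distinct l) :: real) \<le> (real n)\<^sup>2 / real N"
proof (induction n)
  case (Suc n)
  have "word_avg N (Suc n) (\<lambda>l. of_bool (\<not> distinct l) :: real)
     \<le> word_avg N (Suc n) (\<lambda>l. of_bool (hd l \<in> set (tl l)) + of_bool (\<not> distinct (tl l)))"
    by (rule word_avg_mono) (auto simp: words_def length_Suc_conv)
  also have "\<dots> = word_avg N n (\<lambda>l. avg N (\<lambda>b. of_bool (b \<in> set l))) + word_avg N n (\<lambda>l. of_bool (\<not> distinct l) :: real)"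
    using assms by (simp add: avg_word_avg_swap word_avg_add avg_add avg_const)
  also have "\<dots> \<le> word_avg N n (\<lambda>l. real n / real N) + (real n)\<^sup>2 / real N"
  proof (intro add_mono word_avg_mono Suc.IH)
    fix l assume l: "l \<in> words N n"
    have "card {b. b < N \<and> b \<in> set l} \<le> card (set l)" by (rule card_mono) auto
    also have "\<dots> \<le> n" using l card_length[of l] by (simp add: words_def)
    finally show "avg N (\<lambda>b. of_bool (b \<in> set l)) \<le> real n / real N"
      using assms by (simp add: avg_def sum.If_cases Int_def of_bool_def field_simps)
  qed
  also have "\<dots> \<le> (real (Suc n))\<^sup>2 / real N"
    using assms by (simp add: word_avg_const field_simps power2_eq_square)
  finally show ?case .
qed simp

lemma expectation_unif_perm:
  "measure_pmf.expectation (unif_perm n) F = (\<Sum>\<pi>\<in>perms n. F \<pi>) / fact n" for F :: "_ \<Rightarrow> real"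
proof -
  have "perms n \<noteq> {}" using card_perms[of n] by (metis card.empty fact_nonzero)
  then show ?thesis
    unfolding unif_perm_def by (subst integral_pmf_of_set) (auto simp: card_perms)
qed

text \<open>
  Conditioned on having no repetition, a random word is order isomorphic to a uniformly random
  permutation; the exceptional words have probability at most \<open>n\<^sup>2 / N\<close>, and on them both terms are at
  most \<open>K\<close>.
\<close>

lemma expectation_unif_perm_approx:
  fixes F :: "nat list \<Rightarrow> real"
  assumes N: "N > 0"
    and inv: "\<And>S \<pi>. card S = n \<Longrightarrow> \<pi> \<in> perms n \<Longrightarrow> F (realize S \<pi>) = F \<pi>"
    and bd: "\<And>l. length l = n \<Longrightarrow> \<bar>F l\<bar> \<le> K"
  shows "\<bar>measure_pmf.expectation (unif_perm n) F - word_avg N n F\<bar> \<le> 2 * K * (real n)\<^sup>2 / real N"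
proof -
  define e where "e = measure_pmf.expectation (unif_perm n) F"
  define p where "p = word_avg N n (\<lambda>l. of_bool (\<not> distinct l) :: real)"
  have e: "(\<Sum>\<pi>\<in>perms n. F \<pi>) = fact n * e" by (simp add: e_def expectation_unif_perm)
  have K: "K \<ge> 0" using bd[of "replicate n 0"] by simp
  have "\<bar>\<Sum>\<pi>\<in>perms n. F \<pi>\<bar> \<le> (\<Sum>\<pi>\<in>perms n. K)"
    by (rule order.trans[OF sum_abs], rule sum_mono) (simp add: bd perms_length)
  then have eK: "\<bar>e\<bar> \<le> K"
    using e by (simp add: card_perms abs_mult)
  have dist: "word_avg N n (\<lambda>l. of_bool (distinct l) * H l) = (\<Sum>S\<in>subsets N n. \<Sum>\<pi>\<in>perms n. H (realize S \<pi>)) / real (N ^ n)"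
    for H :: "nat list \<Rightarrow> real"
  proof -
    have "(\<Sum>l\<in>words N n. of_bool (distinct l) * H l) = (\<Sum>l\<in>{l\<in>words N n. distinct l}. H l)"
      by (rule sum.mono_neutral_cong_right) auto
    then show ?thesis unfolding word_avg_eq_sum sum_distinct_words[symmetric]
      by (simp add: divide_inverse mult.commute)
  qed
  have "word_avg N n (\<lambda>l. of_bool (distinct l) * F l) = word_avg N n (\<lambda>l. of_bool (distinct l) * e)"
    unfolding dist using inv by (simp add: subsets_def e card_perms mult.assoc)
  then have "word_avg N n F - e = word_avg N n (\<lambda>l. of_bool (\<not> distinct l) * (F l - e))"
    using N word_avg_diff[of N n F "\<lambda>l. e"]
      word_avg_diff[of N n "\<lambda>l. F l - e" "\<lambda>l. of_bool (distinct l) * F l - of_bool (distinct l) * e"]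
    by (simp add: word_avg_const word_avg_diff of_bool_not_iff algebra_simps)
  also have "\<bar>\<dots>\<bar> \<le> word_avg N n (\<lambda>l. (2 * K) * of_bool (\<not> distinct l))"
  proof -
    have "norm (word_avg N n (\<lambda>l. of_bool (\<not> distinct l) * (F l - e)))
       \<le> word_avg N n (\<lambda>l. norm (of_bool (\<not> distinct l) * (F l - e)))" by (rule norm_word_avg_le)
    also have "\<dots> \<le> word_avg N n (\<lambda>l. (2 * K) * of_bool (\<not> distinct l))"
    proof (rule word_avg_mono)
      fix l assume "l \<in> words N n"
      then have "\<bar>F l\<bar> \<le> K" by (simp add: bd words_def)
      then show "norm (of_bool (\<not> distinct l) * (F l - e)) \<le> (2 * K) * of_bool (\<not> distinct l)"
        using eK by (auto simp: of_bool_def)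
    qed
    finally show ?thesis by simp
  qed
  also have "\<dots> \<le> 2 * K * ((real n)\<^sup>2 / real N)"
    unfolding word_avg_mult by (intro mult_left_mono word_avg_not_distinct_le N) (use K in auto)
  finally show ?thesis by (simp add: e_def abs_minus_commute)
qed

section \<open>Differences of the pattern count\<close>

lemma binomial_le_power: "real (m choose r) \<le> real m ^ r"
proof (cases "r \<le> m")
  case True
  then have "real (m choose r) \<le> real (m ^ r)" using binomial_le_pow[of r m] of_nat_le_iff by blast
  then show ?thesis by simp
qed (simp add: binomial_eq_0)

text \<open>
  Stated with a product in place of a quotient, so that it also covers sets \<open>B\<close> with more than \<open>k\<close>
  elements. It is used for sets of one and of two positions.
\<close>

lemma card_subsets_superset_le:
  assumes "finite B"
  shows "real (card {A \<in> subsets n k. B \<subseteq> A}) * real n ^ card B \<le> real n ^ k"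
proof (cases "card B \<le> k")
  case True
  have "card {A \<in> subsets n k. B \<subseteq> A} \<le> card (subsets n (k - card B))"
  proof (rule card_inj_on_le[where f="\<lambda>A. A - B"])
    show "inj_on (\<lambda>A. A - B) {A \<in> subsets n k. B \<subseteq> A}" by (auto simp: inj_on_def)
    show "(\<lambda>A. A - B) ` {A \<in> subsets n k. B \<subseteq> A} \<subseteq> subsets n (k - card B)"
      using assms by (auto simp: subsets_def card_Diff_subset)
  qed simp
  then have "real (card {A \<in> subsets n k. B \<subseteq> A}) \<le> real n ^ (k - card B)"
    using binomial_le_power[of n "k - card B"] by (simp add: card_subsets)
  then have "real (card {A \<in> subsets n k. B \<subseteq> A}) * real n ^ card B \<le> real n ^ (k - card B) * real n ^ card B"
    by (rule mult_right_mono) simp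
  then show ?thesis using True by (simp add: power_add[symmetric])
next
  case False
  have "{A \<in> subsets n k. B \<subseteq> A} = {}"
    using False subsetsD card_mono by (metis (mono_tags, lifting) empty_Collect_eq)
  then show ?thesis by (simp only: card.empty) simp
qed

lemma nths_list_update_notin:
  assumes "i \<notin> A"
  shows "nths (l[i := b]) A = nths l A"
  using assms
proof (induction l arbitrary: i A)
  case (Cons x l)
  then show ?case by (cases i) (auto simp: nths_Cons)
qed simp

lemma nths_list_update_in:
  assumes "i \<in> A" "i < length l"
  shows "nths (l[i := b]) A = (nths l A)[card (A \<inter> {..<i}) := b]"
  using assms
proof (induction l arbitrary: i A)
  case (Cons x l)
  show ?case
  proof (cases i)
    case 0
    then show ?thesis using Cons by (simp add: nths_Cons)
  next
    case (Suc j)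
    have "A \<inter> {..<Suc j} = (if 0 \<in> A then {0} else {}) \<union> Suc ` ({j. Suc j \<in> A} \<inter> {..<j})"
      by (auto simp: image_iff less_Suc_eq_0_disj)
    then have "card (A \<inter> {..<Suc j}) = (if 0 \<in> A then 1 else 0) + card ({j. Suc j \<in> A} \<inter> {..<j})"
      by (auto simp: card_image)
    then show ?thesis using Suc Cons.IH[of j "{j. Suc j \<in> A}"] Cons.prems by (simp add: nths_Cons)
  qed
qed simp

lemma sum_abs_le_card:
  fixes f :: "'b \<Rightarrow> real"
  assumes "finite X" "\<And>A. A \<in> X \<Longrightarrow> \<not> P A \<Longrightarrow> f A = 0" "\<And>A. A \<in> X \<Longrightarrow> \<bar>f A\<bar> \<le> c"
  shows "\<bar>\<Sum>A\<in>X. f A\<bar> \<le> c * real (card {A\<in>X. P A})"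
proof -
  have "(\<Sum>A\<in>X. f A) = (\<Sum>A\<in>{A\<in>X. P A}. f A)"
    by (rule sum.mono_neutral_right) (use assms in auto)
  also have "\<bar>\<dots>\<bar> \<le> (\<Sum>A\<in>{A\<in>X. P A}. c)"
    by (rule order.trans[OF sum_abs], rule sum_mono) (use assms in auto)
  finally show ?thesis by (simp add: mult.commute)
qed

text \<open>
  Only index sets that contain the changed position matter.
\<close>

lemma diff_bdd_patcount:
  assumes "n > 0" "length \<sigma> = k"
  shows "diff_bdd n (real n ^ k / real n) (patcount \<sigma>)"
  unfolding diff_bdd_def
proof (intro allI impI)
  fix l :: "nat list" and i b assume l: "length l = n" "i < n"
  have "\<bar>patcount \<sigma> l - patcount \<sigma> (l[i := b])\<bar>
     \<le> 1 * real (card {A \<in> subsets n k. {i} \<subseteq> A})"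
    unfolding patcount_def length_list_update l(1) assms(2) sum_subtractf[symmetric]
    by (rule sum_abs_le_card) (auto simp: nths_list_update_notin)
  also have "\<dots> \<le> real n ^ k / real n"
    using card_subsets_superset_le[of "{i}" n k] assms(1) by (simp add: field_simps)
  finally show "\<bar>patcount \<sigma> l - patcount \<sigma> (l[i := b])\<bar> \<le> real n ^ k / real n" .
qed

text \<open>
  If the index set misses one of the two positions, the four terms cancel in pairs.
\<close>

lemma mixed_diff_bdd_patcount:
  assumes "n > 0" "length \<sigma> = k"
  shows "mixed_diff_bdd n (2 * real n ^ k / (real n)\<^sup>2) (patcount \<sigma>)"
  unfolding mixed_diff_bdd_def
proof (intro allI impI)
  fix l :: "nat list" and i j a b assume l: "length l = n" "i < n" "j < n" "i \<noteq> j"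
  have "\<bar>patcount \<sigma> l - patcount \<sigma> (l[i := a]) - patcount \<sigma> (l[j := b]) + patcount \<sigma> (l[i := a, j := b])\<bar>
     \<le> 2 * real (card {A \<in> subsets n k. {i, j} \<subseteq> A})"
    unfolding patcount_def length_list_update l(1) assms(2) sum_subtractf[symmetric] sum.distrib[symmetric]
  proof (rule sum_abs_le_card)
    fix A assume "\<not> {i, j} \<subseteq> A"
    then have "i \<notin> A \<or> j \<notin> A" by auto
    then show "of_bool (order_iso \<sigma> (nths l A)) - of_bool (order_iso \<sigma> (nths (l[i := a]) A)) -
         of_bool (order_iso \<sigma> (nths (l[j := b]) A)) + of_bool (order_iso \<sigma> (nths (l[i := a, j := b]) A)) = (0::real)"
    proof
      assume "i \<notin> A"
      then show ?thesis
        by (subst list_update_swap[OF l(4)]) (simp add: nths_list_update_notin)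
    qed (simp add: nths_list_update_notin)
  qed (auto simp: of_bool_def)
  also have "\<dots> \<le> 2 * real n ^ k / (real n)\<^sup>2"
    using card_subsets_superset_le[of "{i, j}" n k] assms(1) l(4) by (simp add: field_simps power2_eq_square)
  finally show "\<bar>patcount \<sigma> l - patcount \<sigma> (l[i := a]) - patcount \<sigma> (l[j := b]) + patcount \<sigma> (l[i := a, j := b])\<bar>
     \<le> 2 * real n ^ k / (real n)\<^sup>2" .
qed

section \<open>The projection of the pattern count\<close>

text \<open>
  The subword at given positions is again a uniformly random word.
\<close>

lemma word_avg_nths:
  "N > 0 \<Longrightarrow> word_avg N n (\<lambda>l. h (nths l A)) = word_avg N (card (A \<inter> {..<n})) h"
proof (induction n arbitrary: h A)
  case (Suc n)
  have "A \<inter> {..<Suc n} = (if 0 \<in> A then {0} else {}) \<union> Suc ` ({j. Suc j \<in> A} \<inter> {..<n})"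
    by (auto simp: image_iff less_Suc_eq_0_disj)
  then have c: "card (A \<inter> {..<Suc n}) = (if 0 \<in> A then 1 else 0) + card ({j. Suc j \<in> A} \<inter> {..<n})"
    by (auto simp: card_image)
  show ?case
  proof (cases "0 \<in> A")
    case True
    then show ?thesis
      using Suc.IH[OF Suc.prems, of "\<lambda>l. h (_ # l)" "{j. Suc j \<in> A}"] by (simp add: c nths_Cons)
  next
    case False
    then show ?thesis
      using Suc.IH[OF Suc.prems, of h "{j. Suc j \<in> A}"] Suc.prems by (simp add: c nths_Cons avg_const)
  qed
qed simp

lemma word_avg_nths_subset:
  "N > 0 \<Longrightarrow> A \<in> subsets n k \<Longrightarrow> word_avg N n (\<lambda>l. h (nths l A)) = word_avg N k h"
  using subsetsD[of A n k] by (simp add: word_avg_nths Int_absorb2)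

lemma word_avg_nths_update:
  assumes "N > 0" "A \<in> subsets n k" "i \<in> A" 
  shows "word_avg N n (\<lambda>l. h (nths (l[i := y]) A)) = word_avg N k (\<lambda>m. h (m[card (A \<inter> {..<i}) := y]))"
proof -
  have "i < n" using subsetsD[OF assms(2)] assms(3) by auto
  then have "word_avg N n (\<lambda>l. h (nths (l[i := y]) A)) = word_avg N n (\<lambda>l. h ((nths l A)[card (A \<inter> {..<i}) := y]))"
    by (intro word_avg_cong) (simp add: nths_list_update_in assms(3) words_length)
  then show ?thesis
    using word_avg_nths_subset[OF assms(1,2), of "\<lambda>m. h (m[card (A \<inter> {..<i}) := y])"] by simp
qed

text \<open>
  Such a set consists of \<open>i\<close>, of \<open>j\<close> elements below \<open>i\<close> and of \<open>k - 1 - j\<close> elements above \<open>i\<close>.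
\<close>

lemma card_subsets_rank:
  assumes "i < n" "j < k"
  shows "card {A \<in> subsets n k. i \<in> A \<and> card (A \<inter> {..<i}) = j} = (i choose j) * (n - 1 - i choose (k - 1 - j))"
proof -
  let ?X = "{B. B \<subseteq> {..<i} \<and> card B = j}" and ?Y = "{B. B \<subseteq> {i<..<n} \<and> card B = k - 1 - j}"
  have "bij_betw (\<lambda>A. (A \<inter> {..<i}, A \<inter> {i<..<n})) {A \<in> subsets n k. i \<in> A \<and> card (A \<inter> {..<i}) = j} (?X \<times> ?Y)"
  proof (rule bij_betwI[where g="\<lambda>(B, C). insert i (B \<union> C)"])
    show "(\<lambda>A. (A \<inter> {..<i}, A \<inter> {i<..<n})) \<in> {A \<in> subsets n k. i \<in> A \<and> card (A \<inter> {..<i}) = j} \<rightarrow> ?X \<times> ?Y"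
    proof
      fix A assume A: "A \<in> {A \<in> subsets n k. i \<in> A \<and> card (A \<inter> {..<i}) = j}"
      then have fin: "finite A" "A \<subseteq> {..<n}" "card A = k" using subsetsD by auto
      have "A = insert i ((A \<inter> {..<i}) \<union> (A \<inter> {i<..<n}))" using A fin by auto
      then have "k = card (insert i ((A \<inter> {..<i}) \<union> (A \<inter> {i<..<n})))" using fin by simp
      also have "\<dots> = Suc (card (A \<inter> {..<i}) + card (A \<inter> {i<..<n}))"
        using fin by (subst card_insert_disjoint) (auto intro!: card_Un_disjoint)
      finally show "(A \<inter> {..<i}, A \<inter> {i<..<n}) \<in> ?X \<times> ?Y" using A by auto
    qed
    show "(\<lambda>(B, C). insert i (B \<union> C)) \<in> ?X \<times> ?Y \<rightarrow> {A \<in> subsets n k. i \<in> A \<and> card (A \<inter> {..<i}) = j}"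
    proof
      fix p assume "p \<in> ?X \<times> ?Y"
      then obtain B C where p: "p = (B, C)" "B \<subseteq> {..<i}" "card B = j" "C \<subseteq> {i<..<n}" "card C = k - 1 - j" by auto
      then have fin: "finite B" "finite C" using finite_subset by blast+
      have "card (insert i (B \<union> C)) = Suc (card (B \<union> C))"
        using p fin by (intro card_insert_disjoint) auto
      also have "card (B \<union> C) = card B + card C"
        using p fin by (intro card_Un_disjoint) fastforce+
      finally have "card (insert i (B \<union> C)) = k" using p assms by simp
      moreover have "insert i (B \<union> C) \<inter> {..<i} = B" using p(2,4) by fastforce
      moreover have "insert i (B \<union> C) \<subseteq> {..<n}" using p(2,4) assms(1) by fastforce
      ultimately show "(case p of (B, C) \<Rightarrow> insert i (B \<union> C)) \<in> {A \<in> subsets n k. i \<in> A \<and> card (A \<inter> {..<i}) = j}"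
        using p(1,3) by (simp add: subsets_def)
    qed
  qed (auto simp: subsets_def)
  then have "card {A \<in> subsets n k. i \<in> A \<and> card (A \<inter> {..<i}) = j} = card (?X \<times> ?Y)"
    by (rule bij_betw_same_card)
  also have "\<dots> = (i choose j) * (n - 1 - i choose (k - 1 - j))"
    by (simp add: card_cartesian_product n_subsets)
  finally show ?thesis .
qed

lemma bij_betw_realize:
  assumes "\<sigma> \<in> perms k"
  shows "bij_betw (\<lambda>S. realize S \<sigma>) (subsets N k) {m \<in> words N k. order_iso \<sigma> m}"
proof (rule bij_betwI[where g=set])
  show "(\<lambda>S. realize S \<sigma>) \<in> subsets N k \<rightarrow> {m \<in> words N k. order_iso \<sigma> m}"
    using assms by (auto simp: words_def order_iso_realize set_realize subsetsD)
      (auto simp: subsets_def realize_def perms_length set_realize)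
  show "set \<in> {m \<in> words N k. order_iso \<sigma> m} \<rightarrow> subsets N k"
    using order_iso_imp_realize(1)[OF assms] by (auto simp: words_def subsets_def)
qed (use assms set_realize subsetsD order_iso_imp_realize(2)[OF assms] in auto)

lemma word_avg_order_iso:
  assumes "\<sigma> \<in> perms k"
  shows "word_avg N k (\<lambda>m. of_bool (order_iso \<sigma> m)) = real (N choose k) / real N ^ k"
proof -
  have "(\<Sum>m\<in>words N k. of_bool (order_iso \<sigma> m)) = real (card {m \<in> words N k. order_iso \<sigma> m})"
    by (simp add: of_bool_def sum.If_cases Int_def)
  also have "\<dots> = real (N choose k)"
    using bij_betw_same_card[OF bij_betw_realize[OF assms]] by (simp add: card_subsets[symmetric])
  finally show ?thesis by (simp add: word_avg_eq_sum divide_inverse mult.commute)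
qed

text \<open>
  The probability that a random word with letter \<open>y\<close> in position \<open>j\<close> has the pattern \<open>\<sigma>\<close>. Such a word is
  determined by its set of letters, in which \<open>y\<close> must have exactly \<open>\<sigma> ! j - 1\<close> elements below it.
\<close>

lemma word_avg_order_iso_update:
  assumes \<sigma>: "\<sigma> \<in> perms k" and "j < k" "y < N"
  shows "word_avg N k (\<lambda>m. of_bool (order_iso \<sigma> (m[j := y])))
    = real (y choose (\<sigma> ! j - 1)) * real (N - 1 - y choose (k - \<sigma> ! j)) / real N ^ (k - 1)"
proof -
  have s: "1 \<le> \<sigma> ! j" "\<sigma> ! j \<le> k" using perms_nth[OF \<sigma> \<open>j < k\<close>] by auto
  have N: "N > 0" using assms by simp
  \<comment> \<open>Fixing the letter costs a factor \<open>N\<close>: resample letter \<open>j\<close> of a random word.\<close>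
  have "word_avg N k (\<lambda>m. of_bool (m ! j = y \<and> order_iso \<sigma> m) :: real)
     = avg N (\<lambda>z. word_avg N k (\<lambda>m. of_bool (m[j := z] ! j = y \<and> order_iso \<sigma> (m[j := z]))))"
    by (rule word_avg_update_avg[OF \<open>j < k\<close>, symmetric])
  also have "\<dots> = avg N (\<lambda>z. of_bool (z = y) * word_avg N k (\<lambda>m. of_bool (order_iso \<sigma> (m[j := y]))))"
    unfolding word_avg_mult[symmetric]
    by (intro avg_cong word_avg_cong) (use \<open>j < k\<close> in \<open>auto simp: words_length\<close>)
  also have "\<dots> = word_avg N k (\<lambda>m. of_bool (order_iso \<sigma> (m[j := y]))) / real N"
    using \<open>y < N\<close> by (simp add: avg_def sum_distrib_right[symmetric] divide_inverse mult.commute)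
  finally have 1: "word_avg N k (\<lambda>m. of_bool (order_iso \<sigma> (m[j := y])))
     = real N * word_avg N k (\<lambda>m. of_bool (m ! j = y \<and> order_iso \<sigma> m) :: real)"
    using N by simp
  have "(\<Sum>m\<in>words N k. of_bool (m ! j = y \<and> order_iso \<sigma> m) :: real)
     = (\<Sum>m\<in>{m \<in> words N k. order_iso \<sigma> m}. of_bool (m ! j = y))"
    by (rule sum.mono_neutral_cong_right) auto
  also have "\<dots> = (\<Sum>S\<in>subsets N k. of_bool (realize S \<sigma> ! j = y))"
    by (rule sum.reindex_bij_betw[OF bij_betw_realize[OF \<sigma>], symmetric])
  also have "\<dots> = (\<Sum>S\<in>subsets N k. of_bool (y \<in> S \<and> card (S \<inter> {..<y}) = \<sigma> ! j - 1))"
  proof (rule sum.cong[OF refl])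
    fix S assume S: "S \<in> subsets N k"
    have *: "S \<inter> {..<y} = {x\<in>S. x < y}" by auto
    have e: "realize S \<sigma> ! j = sorted_list_of_set S ! (\<sigma> ! j - 1)"
      using \<open>j < k\<close> \<sigma> by (simp add: realize_def perms_length)
    have "realize S \<sigma> ! j = y \<longleftrightarrow> y \<in> S \<and> card (S \<inter> {..<y}) = \<sigma> ! j - 1"
    proof
      assume y: "realize S \<sigma> ! j = y"
      then have yS: "y \<in> S" using e s subsetsD[OF S] nth_mem[of "\<sigma> ! j - 1" "sorted_list_of_set S"] by auto
      have "card {x\<in>S. x < y} < card S" using yS subsetsD[OF S] by (intro psubset_card_mono) auto
      moreover have "sorted_list_of_set S ! card {x\<in>S. x < y} = sorted_list_of_set S ! (\<sigma> ! j - 1)"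
        using nth_sorted_list_of_set_rank[of S y] yS subsetsD[OF S] e y by simp
      ultimately show "y \<in> S \<and> card (S \<inter> {..<y}) = \<sigma> ! j - 1"
        using yS s subsetsD[OF S] unfolding * by (subst (asm) nth_eq_iff_index_eq) auto
    next
      assume "y \<in> S \<and> card (S \<inter> {..<y}) = \<sigma> ! j - 1"
      then show "realize S \<sigma> ! j = y"
        using nth_sorted_list_of_set_rank[of S y] subsetsD[OF S] e * by simp
    qed
    then show "of_bool (realize S \<sigma> ! j = y) = of_bool (y \<in> S \<and> card (S \<inter> {..<y}) = \<sigma> ! j - 1)" by simp
  qed
  also have "\<dots> = real (card {S \<in> subsets N k. y \<in> S \<and> card (S \<inter> {..<y}) = \<sigma> ! j - 1})"
    by (simp add: of_bool_def sum.If_cases Int_def)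
  also have "\<dots> = real (y choose (\<sigma> ! j - 1)) * real (N - 1 - y choose (k - \<sigma> ! j))"
    using card_subsets_rank[OF \<open>y < N\<close>, of "\<sigma> ! j - 1" k] s by simp
  finally have 2: "(\<Sum>m\<in>words N k. of_bool (m ! j = y \<and> order_iso \<sigma> m) :: real)
     = real (y choose (\<sigma> ! j - 1)) * real (N - 1 - y choose (k - \<sigma> ! j))" .
  obtain k' where "k = Suc k'" using \<open>j < k\<close> by (cases k) auto
  then show ?thesis unfolding 1 unfolding word_avg_eq_sum 2 using N by (simp add: field_simps)
qed

lemma word_avg_patcount:
  assumes "N > 0" "\<sigma> \<in> perms k"
  shows "word_avg N n (patcount \<sigma>) = real (n choose k) * (real (N choose k) / real N ^ k)"
proof -
  have "word_avg N n (patcount \<sigma>) = word_avg N n (\<lambda>l. \<Sum>A\<in>subsets n k. of_bool (order_iso \<sigma> (nths l A)))"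
    by (rule word_avg_cong) (use assms(2) in \<open>simp add: patcount_def words_length perms_length\<close>)
  also have "\<dots> = (\<Sum>A\<in>subsets n k. real (N choose k) / real N ^ k)"
    unfolding word_avg_sum
    by (rule sum.cong[OF refl])
       (use word_avg_nths_subset[OF assms(1), of _ n k "\<lambda>m. of_bool (order_iso \<sigma> m) :: real"] word_avg_order_iso[OF assms(2), of N] in simp)
  finally show ?thesis by (simp add: card_subsets)
qed

text \<open>
  Only index sets containing \<open>i\<close> contribute. They are grouped by the number \<open>j\<close> of their elements
  below \<open>i\<close>, which is the position that letter \<open>i\<close> takes in the subword.
\<close>

lemma proj_patcount:
  assumes \<sigma>: "\<sigma> \<in> perms k" and "i < n" "y < N"
  shows "proj N n (patcount \<sigma>) i y
    = (\<Sum>j<k. real (i choose j) * real (n - 1 - i choose (k - 1 - j)) *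
         (real (y choose (\<sigma> ! j - 1)) * real (N - 1 - y choose (k - \<sigma> ! j)) / real N ^ (k - 1)
          - real (N choose k) / real N ^ k))"
proof -
  have N: "N > 0" using assms by simp
  let ?q = "real (N choose k) / real N ^ k"
  let ?p = "\<lambda>j. real (y choose (\<sigma> ! j - 1)) * real (N - 1 - y choose (k - \<sigma> ! j)) / real N ^ (k - 1)"
  let ?r = "\<lambda>A. card (A \<inter> {..<i})"
  let ?X = "{A \<in> subsets n k. i \<in> A}"
  have rank: "?r A < k" if "A \<in> ?X" for A
    using that subsetsD[of A n k] by (auto intro!: psubset_card_mono)
  have "word_avg N n (\<lambda>l. patcount \<sigma> (l[i := y])) = word_avg N n (\<lambda>l. \<Sum>A\<in>subsets n k. of_bool (order_iso \<sigma> (nths (l[i := y]) A)))"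
    by (rule word_avg_cong) (use \<sigma> in \<open>simp add: patcount_def words_length perms_length\<close>)
  also have "\<dots> = (\<Sum>A\<in>subsets n k. ?q + of_bool (i \<in> A) * (?p (?r A) - ?q))"
    unfolding word_avg_sum
  proof (rule sum.cong[OF refl])
    fix A assume A: "A \<in> subsets n k"
    show "word_avg N n (\<lambda>l. of_bool (order_iso \<sigma> (nths (l[i := y]) A))) = ?q + of_bool (i \<in> A) * (?p (?r A) - ?q)"
    proof (cases "i \<in> A")
      case True
      then show ?thesis
        using word_avg_nths_update[OF N A True, of "\<lambda>m. of_bool (order_iso \<sigma> m) :: real" y]
          word_avg_order_iso_update[OF \<sigma> rank[of A] \<open>y < N\<close>] A by simp
    next
      case False
      then show ?thesis
        using word_avg_nths_subset[OF N A, of "\<lambda>m. of_bool (order_iso \<sigma> m) :: real"] word_avg_order_iso[OF \<sigma>, of N]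
        by (simp add: nths_list_update_notin)
    qed
  qed
  also have "\<dots> = real (n choose k) * ?q + (\<Sum>A\<in>subsets n k. of_bool (i \<in> A) * (?p (?r A) - ?q))"
    by (simp add: sum.distrib card_subsets)
  also have "(\<Sum>A\<in>subsets n k. of_bool (i \<in> A) * (?p (?r A) - ?q)) = (\<Sum>A\<in>?X. ?p (?r A) - ?q)"
    by (rule sum.mono_neutral_cong_right) auto
  also have "\<dots> = (\<Sum>j<k. \<Sum>A\<in>{A\<in>?X. ?r A = j}. ?p (?r A) - ?q)"
    by (rule sum.group[symmetric]) (use rank in auto)
  also have "\<dots> = (\<Sum>j<k. real (i choose j) * real (n - 1 - i choose (k - 1 - j)) * (?p j - ?q))"
  proof (rule sum.cong[OF refl])
    fix j assume "j \<in> {..<k}"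
    then have "real (card {A \<in> subsets n k. i \<in> A \<and> ?r A = j}) = real (i choose j) * real (n - 1 - i choose (k - 1 - j))"
      using card_subsets_rank[OF \<open>i < n\<close>, of j k] by simp
    moreover have "(\<Sum>A\<in>{A\<in>?X. ?r A = j}. ?p (?r A) - ?q) = real (card {A \<in> subsets n k. i \<in> A \<and> ?r A = j}) * (?p j - ?q)"
      by (simp add: conj_assoc)
    ultimately show "(\<Sum>A\<in>{A\<in>?X. ?r A = j}. ?p (?r A) - ?q) = real (i choose j) * real (n - 1 - i choose (k - 1 - j)) * (?p j - ?q)"
      by simp
  qed
  finally show ?thesis by (simp add: proj_def word_avg_patcount[OF N \<sigma>])
qed

section \<open>Asymptotics of the projection\<close>

lemma abs_mult_diff_le:
  fixes a b a' b' :: real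
  assumes "\<bar>a\<bar> \<le> 1" "\<bar>b'\<bar> \<le> 1"
  shows "\<bar>a * b - a' * b'\<bar> \<le> \<bar>a - a'\<bar> + \<bar>b - b'\<bar>"
proof -
  have "a * b - a' * b' = a * (b - b') + b' * (a - a')" by (simp add: algebra_simps)
  then have "\<bar>a * b - a' * b'\<bar> \<le> \<bar>a\<bar> * \<bar>b - b'\<bar> + \<bar>b'\<bar> * \<bar>a - a'\<bar>"
    using abs_triangle_ineq[of "a * (b - b')" "b' * (a - a')"] by (simp add: abs_mult)
  also have "\<dots> \<le> 1 * \<bar>b - b'\<bar> + 1 * \<bar>a - a'\<bar>"
    by (intro add_mono mult_right_mono assms) auto
  finally show ?thesis by simp
qed

lemma abs_diff_diff_le: "\<bar>p - q - (p' - q')\<bar> \<le> \<bar>p - p'\<bar> + \<bar>q - q'\<bar>" for p q :: real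
  by linarith

lemma error_terms_le:
  fixes c u v :: real
  assumes "c \<ge> 0" "u \<ge> 0"
  shows "3 * c / u + (3 * c / v + c / v) \<le> 4 * c * (1 / u + 1 / v)"
proof -
  have "4 * c * (1 / u + 1 / v) = 3 * c / u + (3 * c / v + c / v) + c / u"
    by (simp add: ring_distribs add_divide_distrib[symmetric])
  moreover have "0 \<le> c / u" using assms by simp
  ultimately show ?thesis by linarith
qed

lemma binomial_le_power_mono: "m \<le> n \<Longrightarrow> real (m choose r) \<le> real n ^ r"
  by (rule order.trans[OF binomial_le_power power_mono]) auto

lemma abs_div_fact_le: "\<bar>z / fact b\<bar> \<le> \<bar>z\<bar>" for z :: real
  using divide_left_mono[OF fact_ge_1[of b, where ?'a=real], of "\<bar>z\<bar>"] by simp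

lemma binomial_div_power_approx:
  assumes "m \<le> n" "j \<le> n" "n > 0"
  shows "\<bar>real (m choose j) / real n ^ j - (real m / real n) ^ j / fact j\<bar> \<le> (real j)\<^sup>2 / real n"
proof -
  let ?a = "\<lambda>t. (real m - real t) / real n"
  have C: "real (m choose j) = (\<Prod>t<j. real m - real t) / fact j"
    by (simp add: binomial_gbinomial gbinomial_prod_rev lessThan_atLeast0)
  have "real (m choose j) / real n ^ j - (real m / real n) ^ j / fact j
     = ((\<Prod>t<j. ?a t) - (\<Prod>t<j. real m / real n)) / fact j"
    unfolding C by (simp add: prod_dividef diff_divide_distrib[of _ _ "fact j"])
  also have "\<bar>\<dots>\<bar> \<le> \<bar>(\<Prod>t<j. ?a t) - (\<Prod>t<j. real m / real n)\<bar>"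
    by (rule abs_div_fact_le)
  also have "\<dots> \<le> (\<Sum>t<j. norm (?a t - real m / real n))"
    unfolding real_norm_def[symmetric]
    by (rule norm_prod_diff) (use assms in \<open>auto simp: field_simps abs_le_iff\<close>)
  also have "\<dots> \<le> (\<Sum>t<j. real j / real n)"
    by (rule sum_mono) (use assms in \<open>auto simp: diff_divide_distrib divide_right_mono\<close>)
  also have "\<dots> = (real j)\<^sup>2 / real n" by (simp add: power2_eq_square)
  finally show ?thesis .
qed

lemma g_over_fact:
  assumes "j < k"
  shows "g k (j + 1) x / fact (k - 1) = x ^ j / fact j * ((1 - x) ^ (k - 1 - j) / fact (k - 1 - j))"
proof -
  have "real (k - 1 choose j) = fact (k - 1) / (fact j * fact (k - 1 - j))"
    using assms by (intro binomial_fact) simp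
  then show ?thesis by (simp add: g_def)
qed

lemma sum_g: "k > 0 \<Longrightarrow> (\<Sum>j<k. g k (j + 1) x) = 1"
proof -
  assume "k > 0"
  then obtain k' where k: "k = Suc k'" by (cases k) auto
  have "(x + (1 - x)) ^ k' = (\<Sum>j\<le>k'. of_nat (k' choose j) * x ^ j * (1 - x) ^ (k' - j))"
    by (rule binomial_ring)
  then show ?thesis by (simp add: k g_def lessThan_Suc_atMost)
qed

lemma power_div_fact_bounds:
  "0 \<le> x \<Longrightarrow> x \<le> 1 \<Longrightarrow> 0 \<le> x ^ j / fact j \<and> x ^ j / fact j \<le> (1::real)"
  using power_le_one[of x j] fact_ge_1[of j, where ?'a=real]
  by (smt (verit) divide_le_eq_1 divide_nonneg_nonneg zero_le_power)

lemma g_over_fact_bounds: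
  assumes "j < k" "0 \<le> x" "x \<le> 1"
  shows "0 \<le> g k (j + 1) x / fact (k - 1)" "g k (j + 1) x / fact (k - 1) \<le> 1"
  unfolding g_over_fact[OF assms(1)]
  using power_div_fact_bounds[of x j] power_div_fact_bounds[of "1 - x" "k - 1 - j"] assms(2,3)
  by (intro mult_nonneg_nonneg mult_le_one; simp only: diff_ge_0_iff_ge; linarith)+

text \<open>
  The proportion of \<open>k\<close>-sets in which \<open>i\<close> has rank \<open>j\<close> is a discrete version of the Bernstein polynomial.
  The same estimate is applied to positions in the word and to letters in the alphabet.
\<close>

lemma rank_count_approx:
  assumes "i < n" "j < k" "k \<le> n"
  shows "\<bar>real (i choose j) * real (n - 1 - i choose (k - 1 - j)) / real n ^ (k - 1)
     - g k (j + 1) (real i / real n) / fact (k - 1)\<bar> \<le> 3 * (real k)\<^sup>2 / real n"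
proof -
  define b where "b = k - 1 - j"
  have n: "n > 0" using assms by simp
  have b: "b < k" "j + b = k - 1" "b \<le> n" using assms by (auto simp: b_def)
  define x where "x = real i / real n"
  define x' where "x' = real (n - 1 - i) / real n"
  have x: "0 \<le> x" "x \<le> 1" "0 \<le> x'" "x' \<le> 1" "\<bar>x' - (1 - x)\<bar> = 1 / real n"
    using assms by (auto simp: x_def x'_def field_simps of_nat_diff)
  let ?a = "real (i choose j) / real n ^ j" and ?a' = "x ^ j / fact j"
  let ?b = "real (n - 1 - i choose b) / real n ^ b" and ?b' = "(1 - x) ^ b / fact b"
  have a: "\<bar>?a - ?a'\<bar> \<le> (real j)\<^sup>2 / real n"
    unfolding x_def by (rule binomial_div_power_approx) (use assms in auto)
  have bb: "\<bar>?b - x' ^ b / fact b\<bar> \<le> (real b)\<^sup>2 / real n"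
    unfolding x'_def by (rule binomial_div_power_approx) (use assms b in auto)
  have "\<bar>x' ^ b / fact b - ?b'\<bar> \<le> \<bar>x' ^ b - (1 - x) ^ b\<bar>"
    unfolding diff_divide_distrib[symmetric] by (rule abs_div_fact_le)
  also have "\<dots> \<le> real b * \<bar>x' - (1 - x)\<bar>"
    unfolding real_norm_def[symmetric] by (rule norm_power_diff) (use x in auto)
  also have "\<dots> \<le> real b / real n" using x by simp
  finally have b'': "\<bar>x' ^ b / fact b - ?b'\<bar> \<le> real b / real n" .
  have "real (i choose j) \<le> real n ^ j"
    by (rule binomial_le_power_mono) (use assms in simp)
  then have a1: "\<bar>?a\<bar> \<le> 1" using n by (simp add: field_simps)
  have b1: "\<bar>?b'\<bar> \<le> 1" using power_div_fact_bounds[of "1 - x" b] x by auto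
  have "\<bar>?a * ?b - ?a' * ?b'\<bar> \<le> \<bar>?a - ?a'\<bar> + \<bar>?b - ?b'\<bar>"
    by (rule abs_mult_diff_le[OF a1 b1])
  also have "\<dots> \<le> (real j)\<^sup>2 / real n + ((real b)\<^sup>2 / real n + real b / real n)"
    using a bb b'' by linarith
  also have "\<dots> \<le> (real k)\<^sup>2 / real n + ((real k)\<^sup>2 / real n + (real k)\<^sup>2 / real n)"
  proof (intro add_mono divide_right_mono power_mono)
    have "real b * 1 \<le> real k * real k" using b by (intro mult_mono) auto
    then show "real b \<le> (real k)\<^sup>2" by (simp add: power2_eq_square)
  qed (use assms b in auto)
  also have "\<dots> = 3 * (real k)\<^sup>2 / real n" by (simp add: field_simps)
  also have "?a * ?b = real (i choose j) * real (n - 1 - i choose (k - 1 - j)) / real n ^ (k - 1)"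
    unfolding b(2)[symmetric] by (simp add: b_def power_add)
  also have "?a' * ?b' = g k (j + 1) (real i / real n) / fact (k - 1)"
    unfolding g_over_fact[OF assms(2)] by (simp add: b_def x_def)
  finally show ?thesis .
qed

text \<open>
  The Bernstein polynomials in \<open>x\<close> sum to 1. Hence the constant \<open>1 / k\<close> can be distributed over the
  summands, where it becomes the unconditional probability \<open>1 / k!\<close> of the pattern.
\<close>

lemma G_eq_sum:
  assumes "\<sigma> \<in> perms k" "k > 0"
  shows "G \<sigma> x y = (\<Sum>j<k. g k (j + 1) x / fact (k - 1) * (g k (\<sigma> ! j) y / fact (k - 1) - 1 / fact k))"
proof -
  have "(\<Sum>i=1..k. g k i x * g k (\<sigma> ! (i - 1)) y) = (\<Sum>j<k. g k (j + 1) x * g k (\<sigma> ! j) y)"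
    by (rule sum.reindex_bij_witness[where i=Suc and j="\<lambda>i. i - 1"]) auto
  then have "G \<sigma> x y = 1 / (fact (k - 1))\<^sup>2 * ((\<Sum>j<k. g k (j + 1) x * g k (\<sigma> ! j) y) - 1 / real k)"
    using assms by (simp add: G_def perms_length)
  also have "\<dots> = 1 / (fact (k - 1))\<^sup>2 * ((\<Sum>j<k. g k (j + 1) x * g k (\<sigma> ! j) y) - 1 / real k * (\<Sum>j<k. g k (j + 1) x))"
    using assms by (simp only: sum_g mult_1_right)
  also have "\<dots> = (\<Sum>j<k. 1 / (fact (k - 1))\<^sup>2 * (g k (j + 1) x * g k (\<sigma> ! j) y - 1 / real k * g k (j + 1) x))"
    by (simp only: sum_distrib_left sum_subtractf right_diff_distrib)
  also have "\<dots> = (\<Sum>j<k. g k (j + 1) x / fact (k - 1) * (g k (\<sigma> ! j) y / fact (k - 1) - 1 / fact k))"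
  proof (rule sum.cong[OF refl])
    fix j
    have "fact k = real k * (fact (k - 1) :: real)" using assms(2) by (simp add: fact_reduce)
    then show "1 / (fact (k - 1))\<^sup>2 * (g k (j + 1) x * g k (\<sigma> ! j) y - 1 / real k * g k (j + 1) x)
       = g k (j + 1) x / fact (k - 1) * (g k (\<sigma> ! j) y / fact (k - 1) - 1 / fact k)"
      using assms(2) by (simp add: field_simps power2_eq_square)
  qed
  finally show ?thesis .
qed

lemma proj_patcount_approx:
  assumes \<sigma>: "\<sigma> \<in> perms k" and k: "k > 0" "k \<le> n" "k \<le> N" and "i < n" "y < N"
  shows "\<bar>proj N n (patcount \<sigma>) i y / real n ^ (k - 1) - G \<sigma> (real i / real n) (real y / real N)\<bar>
    \<le> 4 * real k ^ 3 * (1 / real n + 1 / real N)"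
proof -
  let ?x = "real i / real n" and ?y = "real y / real N"
  let ?a = "\<lambda>j. real (i choose j) * real (n - 1 - i choose (k - 1 - j)) / real n ^ (k - 1)"
  let ?b = "\<lambda>j. real (y choose (\<sigma> ! j - 1)) * real (N - 1 - y choose (k - \<sigma> ! j)) / real N ^ (k - 1)
          - real (N choose k) / real N ^ k"
  let ?a' = "\<lambda>j. g k (j + 1) ?x / fact (k - 1)"
  let ?b' = "\<lambda>j. g k (\<sigma> ! j) ?y / fact (k - 1) - 1 / fact k"
  have n: "n > 0" "N > 0" using assms by auto
  have xy: "0 \<le> ?x" "?x \<le> 1" "0 \<le> ?y" "?y \<le> 1" using assms n by (auto simp: field_simps)
  have eq: "proj N n (patcount \<sigma>) i y / real n ^ (k - 1) - G \<sigma> ?x ?y = (\<Sum>j<k. ?a j * ?b j - ?a' j * ?b' j)"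
    unfolding proj_patcount[OF \<sigma> \<open>i < n\<close> \<open>y < N\<close>] G_eq_sum[OF \<sigma> k(1)] sum_divide_distrib sum_subtractf[symmetric]
    by (rule sum.cong) simp_all
  have le: "\<bar>\<Sum>j<k. ?a j * ?b j - ?a' j * ?b' j\<bar> \<le> (\<Sum>j<k. 4 * (real k)\<^sup>2 * (1 / real n + 1 / real N))"
  proof (rule order.trans[OF sum_abs], rule sum_mono)
    fix j assume "j \<in> {..<k}"
    then have j: "j < k" by simp
    have s: "\<sigma> ! j - 1 < k" "\<sigma> ! j - 1 + 1 = \<sigma> ! j" "k - 1 - (\<sigma> ! j - 1) = k - \<sigma> ! j"
      using perms_nth[OF \<sigma> j] by auto
    have a: "\<bar>?a j - ?a' j\<bar> \<le> 3 * (real k)\<^sup>2 / real n"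
      by (rule rank_count_approx[OF \<open>i < n\<close> j k(2)])
    have b1: "\<bar>real (y choose (\<sigma> ! j - 1)) * real (N - 1 - y choose (k - \<sigma> ! j)) / real N ^ (k - 1)
        - g k (\<sigma> ! j) ?y / fact (k - 1)\<bar> \<le> 3 * (real k)\<^sup>2 / real N"
      using rank_count_approx[OF \<open>y < N\<close> s(1) k(3)] unfolding s by simp
    have b2: "\<bar>real (N choose k) / real N ^ k - 1 / fact k\<bar> \<le> (real k)\<^sup>2 / real N"
      using binomial_div_power_approx[of N N k] k n by simp
    have "real (i choose j) * real (n - 1 - i choose (k - 1 - j)) \<le> real n ^ j * real n ^ (k - 1 - j)"
    proof (rule mult_mono)
      show "real (i choose j) \<le> real n ^ j"
        by (rule binomial_le_power_mono) (use \<open>i < n\<close> in simp)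
      show "real (n - 1 - i choose (k - 1 - j)) \<le> real n ^ (k - 1 - j)"
        by (rule binomial_le_power_mono) simp
    qed auto
    also have "\<dots> = real n ^ (k - 1)" using j by (simp add: power_add[symmetric])
    finally have a1: "\<bar>?a j\<bar> \<le> 1" using n by (simp add: field_simps)
    have "0 \<le> g k (\<sigma> ! j) ?y / fact (k - 1)" "g k (\<sigma> ! j) ?y / fact (k - 1) \<le> 1"
      using g_over_fact_bounds[OF s(1) xy(3,4)] unfolding s by auto
    moreover have "0 \<le> 1 / (fact k :: real)" "1 / (fact k :: real) \<le> 1"
      using fact_ge_1[of k, where ?'a=real] by auto
    ultimately have b'1: "\<bar>?b' j\<bar> \<le> 1" by linarith
    show "\<bar>?a j * ?b j - ?a' j * ?b' j\<bar> \<le> 4 * (real k)\<^sup>2 * (1 / real n + 1 / real N)"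
      by (rule order.trans[OF abs_mult_diff_le[OF a1 b'1] order.trans[OF
          add_mono[OF a order.trans[OF abs_diff_diff_le add_mono[OF b1 b2]]] error_terms_le]]) auto
  qed
  have "(\<Sum>j<k. 4 * (real k)\<^sup>2 * (1 / real n + 1 / real N)) = 4 * real k ^ 3 * (1 / real n + 1 / real N)"
    by (simp add: power2_eq_square power3_eq_cube)
  then show ?thesis unfolding eq by (rule order.trans[OF le eq_refl])
qed

section \<open>Mean and exponential moments\<close>

text \<open>
  For fixed \<open>n\<close> repetitions disappear as the alphabet grows, so limits of identities and inequalities
  for words hold exactly for permutations.
\<close>

lemma expectation_unif_perm_limit:
  fixes F :: "nat list \<Rightarrow> real"
  assumes inv: "\<And>S \<pi>. card S = n \<Longrightarrow> \<pi> \<in> perms n \<Longrightarrow> F (realize S \<pi>) = F \<pi>"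
    and bd: "\<And>l. length l = n \<Longrightarrow> \<bar>F l\<bar> \<le> K"
  shows "(\<lambda>N. word_avg N n F) \<longlonglongrightarrow> measure_pmf.expectation (unif_perm n) F"
proof (rule LIM_zero_cancel, rule Lim_null_comparison)
  show "\<forall>\<^sub>F N in sequentially. norm (word_avg N n F - measure_pmf.expectation (unif_perm n) F)
      \<le> 2 * K * (real n)\<^sup>2 / real N"
    using eventually_gt_at_top[of 0]
  proof eventually_elim
    case (elim N)
    show ?case
      using expectation_unif_perm_approx[OF elim inv bd] by (simp add: abs_minus_commute) 
  qed
  show "(\<lambda>N. 2 * K * (real n)\<^sup>2 / real N) \<longlonglongrightarrow> 0" by (rule lim_const_over_n)
qed

lemma patcount_bounds: "0 \<le> patcount \<sigma> l" "patcount \<sigma> l \<le> real (length l) ^ length \<sigma>"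
proof -
  have "patcount \<sigma> l \<le> (\<Sum>A\<in>subsets (length l) (length \<sigma>). 1)"
    unfolding patcount_def by (rule sum_mono) simp
  also have "\<dots> = real (length l choose length \<sigma>)" by (simp add: card_subsets)
  also have "\<dots> \<le> real (length l) ^ length \<sigma>" by (rule binomial_le_power)
  finally show "patcount \<sigma> l \<le> real (length l) ^ length \<sigma>" .
qed (auto simp: patcount_def intro: sum_nonneg)

lemma expectation_unif_perm_cong:
  fixes F :: "nat list \<Rightarrow> real"
  assumes "\<And>\<pi>. \<pi> \<in> perms n \<Longrightarrow> F \<pi> = H \<pi>"
  shows "measure_pmf.expectation (unif_perm n) F = measure_pmf.expectation (unif_perm n) H"
  using assms by (simp add: expectation_unif_perm cong: sum.cong)

lemma mean_occ_eq:
  assumes \<sigma>: "\<sigma> \<in> perms k"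
  shows "mean_occ \<sigma> n = 1 / fact k * real (n choose k)"
proof -
  have "(\<lambda>N. word_avg N n (patcount \<sigma>)) \<longlonglongrightarrow> measure_pmf.expectation (unif_perm n) (patcount \<sigma>)"
    by (rule expectation_unif_perm_limit[where K="real n ^ k"])
       (use patcount_bounds[of \<sigma>] \<sigma> in \<open>auto simp: patcount_realize perms_length abs_of_nonneg\<close>)
  also have "measure_pmf.expectation (unif_perm n) (patcount \<sigma>) = mean_occ \<sigma> n"
    unfolding mean_occ_def by (rule expectation_unif_perm_cong) (simp add: occ_eq_patcount[OF _ \<sigma>])
  finally have 1: "(\<lambda>N. word_avg N n (patcount \<sigma>)) \<longlonglongrightarrow> mean_occ \<sigma> n" .
  have "(\<lambda>N. real (N choose k) / real N ^ k) \<longlonglongrightarrow> 1 / fact k"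
  proof (rule LIM_zero_cancel, rule Lim_null_comparison)
    show "\<forall>\<^sub>F N in sequentially. norm (real (N choose k) / real N ^ k - 1 / fact k) \<le> (real k)\<^sup>2 / real N"
      using eventually_gt_at_top[of k]
    proof eventually_elim
      case (elim N)
      then show ?case using binomial_div_power_approx[of N N k] by simp
    qed
    show "(\<lambda>N. (real k)\<^sup>2 / real N) \<longlonglongrightarrow> 0" by (rule lim_const_over_n)
  qed
  then have "(\<lambda>N. real (n choose k) * (real (N choose k) / real N ^ k)) \<longlonglongrightarrow> real (n choose k) * (1 / fact k)"
    by (rule tendsto_mult_left)
  moreover have "\<forall>\<^sub>F N in sequentially. word_avg N n (patcount \<sigma>) = real (n choose k) * (real (N choose k) / real N ^ k)"
    using eventually_gt_at_top[of 0] by eventually_elim (rule word_avg_patcount[OF _ \<sigma>])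
  ultimately have "(\<lambda>N. word_avg N n (patcount \<sigma>)) \<longlonglongrightarrow> real (n choose k) * (1 / fact k)"
    by (simp add: filterlim_cong[OF refl refl])
  from LIMSEQ_unique[OF 1 this] show ?thesis by simp
qed

lemma powr_minus_half: "n > 0 \<Longrightarrow> real n powr (real k - 1 / 2) = real n ^ k / sqrt (real n)"
  by (simp add: powr_diff powr_half_sqrt powr_realpow)

text \<open>
  The pattern count has differences at most \<open>n\<^bsup>k-1\<^esup>\<close>, so its normalization by \<open>n\<^bsup>k-1/2\<^esup>\<close> has
  differences at most \<open>n\<^bsup>-1/2\<^esup>\<close>, and the \<open>n\<close> letters together contribute \<open>t\<^sup>2\<close> to the exponent in the
  bounded differences inequality.
\<close>

lemma normalized_occ_exp_le:
  assumes \<sigma>: "\<sigma> \<in> perms k"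
  shows "measure_pmf.expectation (unif_perm n) (\<lambda>\<pi>. exp (t * normalized_occ \<sigma> n \<pi>)) \<le> exp (t\<^sup>2)"
proof (cases "n = 0")
  case True
  then show ?thesis by (simp add: normalized_occ_def)
next
  case False
  then have n: "n > 0" by simp
  let ?E = "measure_pmf.expectation (unif_perm n)"
  define s where "s = t / real n powr (real k - 1 / 2)"
  define f where "f = (\<lambda>l. s * patcount \<sigma> l)"
  have fb: "\<bar>f l\<bar> \<le> \<bar>s\<bar> * real n ^ k" if "length l = n" for l
    unfolding f_def abs_mult using patcount_bounds[of \<sigma> l] \<sigma> that
    by (intro mult_left_mono) (auto simp: perms_length)
  have inv: "f (realize S \<pi>) = f \<pi>" if "card S = n" "\<pi> \<in> perms n" for S \<pi>
    using that by (simp add: f_def patcount_realize)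
  have "(\<lambda>N. word_avg N n (\<lambda>l. exp (f l))) \<longlonglongrightarrow> ?E (\<lambda>l. exp (f l))"
    by (rule expectation_unif_perm_limit[where K="exp (\<bar>s\<bar> * real n ^ k)"])
       (use fb inv in \<open>fastforce simp: abs_le_iff\<close>)+
  moreover have "(\<lambda>N. word_avg N n f) \<longlonglongrightarrow> ?E f"
    by (rule expectation_unif_perm_limit[where K="\<bar>s\<bar> * real n ^ k"]) (use fb inv in auto)
  then have "(\<lambda>N. exp (t\<^sup>2) * exp (word_avg N n f)) \<longlonglongrightarrow> exp (t\<^sup>2) * exp (?E f)"
    by (intro tendsto_intros)
  moreover have "word_avg N n (\<lambda>l. exp (f l)) \<le> exp (t\<^sup>2) * exp (word_avg N n f)" if "N > 0" for N
  proof -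
    define c where "c = \<bar>s\<bar> * (real n ^ k / real n)"
    have "diff_bdd n c f"
      unfolding diff_bdd_def f_def c_def right_diff_distrib[symmetric] abs_mult
      by (intro allI impI mult_left_mono diff_bddD[OF diff_bdd_patcount[OF n perms_length[OF \<sigma>]]]) auto
    then have "word_avg N n (\<lambda>l. exp (f l)) \<le> exp (real n * c\<^sup>2) * exp (word_avg N n f)"
      by (rule word_avg_exp_le[OF that])
    moreover have "real n * c\<^sup>2 = t\<^sup>2"
    proof -
      have "(real n powr (real k - 1 / 2))\<^sup>2 = (real n ^ k)\<^sup>2 / real n"
        using n by (simp add: powr_minus_half power_divide)
      then show ?thesis using n
        by (simp add: c_def s_def power_mult_distrib power_divide field_simps power2_eq_square)
    qed
    ultimately show ?thesis by simp
  qed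
  then have "\<exists>N0. \<forall>N\<ge>N0. word_avg N n (\<lambda>l. exp (f l)) \<le> exp (t\<^sup>2) * exp (word_avg N n f)"
    by (auto intro!: exI[of _ 1])
  ultimately have "?E (\<lambda>l. exp (f l)) \<le> exp (t\<^sup>2) * exp (?E f)"
    by (rule LIMSEQ_le)
  then have le: "?E (\<lambda>l. exp (f l)) * exp (- ?E f) \<le> exp (t\<^sup>2)"
    by (simp add: exp_minus field_simps)
  have Ef: "?E f = s * mean_occ \<sigma> n"
    unfolding mean_occ_def f_def
    by (simp add: expectation_unif_perm sum_distrib_left[symmetric] occ_eq_patcount[OF _ \<sigma>] cong: sum.cong)
  have "?E (\<lambda>\<pi>. exp (t * normalized_occ \<sigma> n \<pi>)) = ?E (\<lambda>l. exp (f l) * exp (- ?E f))"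
    unfolding Ef by (intro expectation_unif_perm_cong)
       (simp add: normalized_occ_def f_def s_def occ_eq_patcount[OF _ \<sigma>] perms_length[OF \<sigma>] 
         exp_add[symmetric] diff_divide_distrib right_diff_distrib)
  also have "\<dots> = ?E (\<lambda>l. exp (f l)) * exp (- ?E f)" by simp
  finally show ?thesis using le by simp
qed

section \<open>Riemann sums\<close>

text \<open>
  The mean value theorem for an antiderivative expresses the integral exactly as an average of values of
  \<open>\<phi>\<close>, one from each cell; uniform continuity compares them with the values at the left end points.
\<close>

lemma riemann_sum_limit:
  fixes \<phi> :: "real \<Rightarrow> real"
  assumes cont: "continuous_on {0..1} \<phi>"
  shows "(\<lambda>n. avg n (\<lambda>i. \<phi> (real i / real n))) \<longlonglongrightarrow> (LBINT x:{0..1}. \<phi> x)"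
proof -
  obtain F where F: "\<And>x. x \<in> {0..1} \<Longrightarrow> (F has_vector_derivative \<phi> x) (at x within {0..1})"
    using antiderivative_continuous[OF cont] by blast
  have "(\<phi> has_integral (F 1 - F 0)) {0..1}"
    by (rule fundamental_theorem_of_calculus) (use F in auto)
  moreover have "set_integrable lborel {0..1} \<phi>"
    by (rule borel_integrable_atLeastAtMost'[OF cont])
  ultimately have I: "(LBINT x:{0..1}. \<phi> x) = F 1 - F 0"
    by (simp add: set_borel_integral_eq_integral(2) integral_unique)
  show ?thesis unfolding I
  proof (rule LIMSEQ_I)
    fix e :: real assume "e > 0"
    have "uniformly_continuous_on {0..1} \<phi>"
      using cont by (rule compact_uniformly_continuous) simp
    then obtain d where d: "d > 0" "\<And>x y. x \<in> {0..1} \<Longrightarrow> y \<in> {0..1} \<Longrightarrow> dist y x < d \<Longrightarrow> dist (\<phi> y) (\<phi> x) < e / 2"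
      using \<open>e > 0\<close> unfolding uniformly_continuous_on_def by (metis half_gt_zero)
    obtain n0 :: nat where n0: "n0 > 0" "1 / real n0 < d"
      using d(1) by (metis nat_approx_posE zero_less_Suc)
    show "\<exists>n0. \<forall>n\<ge>n0. norm (avg n (\<lambda>i. \<phi> (real i / real n)) - (F 1 - F 0)) < e"
    proof (intro exI allI impI)
      fix n assume "n \<ge> n0"
      then have n: "n > 0" "1 / real n < d"
        using n0 frac_le[of 1 1 "real n0" "real n"] by auto
      let ?x = "\<lambda>i. real i / real n"
      have cell: "\<bar>\<phi> (?x i) - real n * (F (?x (Suc i)) - F (?x i))\<bar> \<le> e / 2" if "i < n" for i
      proof -
        have sub: "{?x i..?x (Suc i)} \<subseteq> {0..1}" using that by (auto simp: field_simps)
        have lt: "?x i \<le> ?x (Suc i)" using n by (simp add: divide_right_mono)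
        have "\<exists>t\<in>{?x i..?x (Suc i)}. F (?x (Suc i)) - F (?x i) = (?x (Suc i) - ?x i) *\<^sub>R \<phi> t"
        proof (rule mvt_very_simple[OF lt])
          fix t assume "?x i \<le> t" "t \<le> ?x (Suc i)"
          then have "t \<in> {0..1}" by (intro subsetD[OF sub]) simp
          then have "(F has_vector_derivative \<phi> t) (at t within {?x i..?x (Suc i)})"
            by (intro has_vector_derivative_within_subset[OF F sub])
          then show "(F has_derivative (\<lambda>h. h *\<^sub>R \<phi> t)) (at t within {?x i..?x (Suc i)})"
            by (simp add: has_vector_derivative_def)
        qed
        then obtain t where t: "t \<in> {?x i..?x (Suc i)}" "F (?x (Suc i)) - F (?x i) = (?x (Suc i) - ?x i) * \<phi> t"
          by auto
        have w: "?x (Suc i) - ?x i = 1 / real n" by (simp add: diff_divide_distrib[symmetric])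
        then have "dist (?x i) t < d" using t(1) n by (auto simp: dist_real_def)
        then have "dist (\<phi> (?x i)) (\<phi> t) < e / 2"
          using t(1) lt by (intro d(2) subsetD[OF sub]) auto
        moreover have "real n * (F (?x (Suc i)) - F (?x i)) = \<phi> t" unfolding t(2) w using n by simp
        ultimately show ?thesis by (simp add: dist_real_def)
      qed
      have "(\<Sum>i<n. F (?x (Suc i)) - F (?x i)) = F (?x n) - F (?x 0)"
        by (rule sum_lessThan_telescope)
      then have "F 1 - F 0 = avg n (\<lambda>i. real n * (F (?x (Suc i)) - F (?x i)))"
        using n unfolding avg_def sum_distrib_left[symmetric] by simp
      then have "avg n (\<lambda>i. \<phi> (?x i)) - (F 1 - F 0) = avg n (\<lambda>i. \<phi> (?x i) - real n * (F (?x (Suc i)) - F (?x i)))"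
        by (simp only: avg_diff)
      also have "norm \<dots> \<le> avg n (\<lambda>i. norm (\<phi> (?x i) - real n * (F (?x (Suc i)) - F (?x i))))"
        by (rule norm_avg_le)
      also have "\<dots> \<le> avg n (\<lambda>i. e / 2)"
        by (rule avg_mono) (use cell in simp)
      also have "\<dots> < e" using n \<open>e > 0\<close> by (simp add: avg_const)
      finally show "norm (avg n (\<lambda>i. \<phi> (?x i)) - (F 1 - F 0)) < e" .
    qed
  qed
qed

lemma continuous_g: "continuous_on S (\<lambda>x. g k i x)"
  unfolding g_def by (intro continuous_intros)

lemma avg_avg_mult: "avg n (\<lambda>i. avg m (\<lambda>j. p i * q j)) = avg n p * avg m q" for p q :: "nat \<Rightarrow> real"
  unfolding avg_mult using avg_mult[of n "avg m q" p] by (simp add: mult.commute)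

lemma set_integral_sum_lborel:
  fixes f :: "'b \<Rightarrow> real \<Rightarrow> real"
  assumes "\<And>a. a \<in> A \<Longrightarrow> set_integrable lborel S (f a)"
  shows "(LBINT x:S. \<Sum>a\<in>A. f a x) = (\<Sum>a\<in>A. LBINT x:S. f a x)"
  using assms unfolding set_lebesgue_integral_def set_integrable_def
  by (simp add: sum_distrib_left Bochner_Integration.integral_sum)

text \<open>
  A product of two functions \<open>G\<close> is a finite sum of terms \<open>p(x) q(y)\<close>, so that one-dimensional Riemann
  sums suffice.
\<close>

lemma Sigma_cov_limit:
  assumes \<sigma>: "\<sigma> \<in> perms k" "k > 0" and \<tau>: "\<tau> \<in> perms m" "m > 0"
    and N: "filterlim N at_top sequentially"
  shows "(\<lambda>n. avg n (\<lambda>i. avg (N n) (\<lambda>y. G \<sigma> (real i / real n) (real y / real (N n)) *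
           G \<tau> (real i / real n) (real y / real (N n))))) \<longlonglongrightarrow> Sigma_cov \<sigma> \<tau>"
proof -
  define p where "p = (\<lambda>a x. g k (fst a + 1) x / fact (k - 1) * (g m (snd a + 1) x / fact (m - 1)))"
  define q where "q = (\<lambda>a y. (g k (\<sigma> ! fst a) y / fact (k - 1) - 1 / fact k) *
    (g m (\<tau> ! snd a) y / fact (m - 1) - 1 / fact m))"
  define A where "A = {..<k} \<times> {..<m}"
  have GG: "G \<sigma> x y * G \<tau> x y = (\<Sum>a\<in>A. p a x * q a y)" for x y
    unfolding G_eq_sum[OF \<sigma>] G_eq_sum[OF \<tau>] sum_product A_def sum.cartesian_product
    by (rule sum.cong) (auto simp: p_def q_def)
  have cp: "continuous_on {0..1} (p a)" and cq: "continuous_on {0..1} (q a)" for a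
    unfolding p_def q_def by (intro continuous_intros continuous_g; simp)+
  have ip: "set_integrable lborel {0..1} (p a)" and iq: "set_integrable lborel {0..1} (q a)" for a
    by (rule borel_integrable_atLeastAtMost'[OF cp], rule borel_integrable_atLeastAtMost'[OF cq])
  have "Sigma_cov \<sigma> \<tau> = (LBINT y:{0..1}. (LBINT x:{0..1}. \<Sum>a\<in>A. q a y * p a x))"
    by (simp add: Sigma_cov_def GG mult.commute)
  also have "\<dots> = (LBINT y:{0..1}. (\<Sum>a\<in>A. (LBINT x:{0..1}. p a x) * q a y))"
    using ip by (subst set_integral_sum_lborel) (auto simp: A_def mult.commute)
  also have "\<dots> = (\<Sum>a\<in>A. (LBINT x:{0..1}. p a x) * (LBINT y:{0..1}. q a y))"
    using iq by (subst set_integral_sum_lborel) (auto simp: A_def)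
  finally have S: "Sigma_cov \<sigma> \<tau> = (\<Sum>a\<in>A. (LBINT x:{0..1}. p a x) * (LBINT y:{0..1}. q a y))" .
  show ?thesis
    unfolding S GG avg_sum avg_avg_mult
  proof (intro tendsto_sum tendsto_mult)
    fix a
    show "(\<lambda>n. avg n (\<lambda>i. p a (real i / real n))) \<longlonglongrightarrow> (LBINT x:{0..1}. p a x)"
      by (rule riemann_sum_limit[OF cp])
    show "(\<lambda>n. avg (N n) (\<lambda>y. q a (real y / real (N n)))) \<longlonglongrightarrow> (LBINT y:{0..1}. q a y)"
      using filterlim_compose[OF riemann_sum_limit[OF cq] N] .
  qed
qed

section \<open>A central limit theorem for independent letters\<close>

lemma exp_minus_approx: "0 \<le> u \<Longrightarrow> \<bar>1 - u - exp (- u)\<bar> \<le> u\<^sup>2" for u :: real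
  using exp_ge_add_one_self[of "- u"] exp_minus_le[of u] by simp

lemma cmod_iexp: "cmod (iexp x) = 1"
  by (simp add: norm_exp_i_times)

text \<open>
  The expansion to second order, with mean zero and variance \<open>s\<close>: the error is cubic in the size of the
  variable, and \<open>1 - s / 2\<close> agrees with \<open>exp (- s / 2)\<close> to first order in \<open>s \<le> M\<^sup>2\<close>.
\<close>

lemma avg_iexp_approx:
  assumes N: "N > 0" and mean: "avg N f = 0" and bd: "\<And>y. y < N \<Longrightarrow> \<bar>f y\<bar> \<le> M"
  shows "cmod (avg N (\<lambda>y. iexp (f y)) - exp (- avg N (\<lambda>y. (f y)\<^sup>2) / 2)) \<le> M ^ 3 + M ^ 4"
proof -
  define s where "s = avg N (\<lambda>y. (f y)\<^sup>2)"
  have M: "M \<ge> 0" using bd[of 0] N by linarith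
  have s: "0 \<le> s" "s \<le> M\<^sup>2"
  proof -
    have "avg N (\<lambda>y. 0) \<le> s" unfolding s_def by (rule avg_mono) simp
    then show "0 \<le> s" using N by (simp add: avg_const)
    have "s \<le> avg N (\<lambda>y. M\<^sup>2)" unfolding s_def by (rule avg_mono) (use bd in \<open>auto intro: sq_le_sq_if_abs_le\<close>)
    then show "s \<le> M\<^sup>2" using N by (simp add: avg_const)
  qed
  have of_real_avg: "complex_of_real (avg N h) = avg N (\<lambda>y. complex_of_real (h y))" for h
    by (simp add: avg_def scaleR_conv_of_real)
  have "avg N (\<lambda>y. 1 + \<i> * complex_of_real (f y) - complex_of_real ((f y)\<^sup>2) / 2)
     = 1 + \<i> * complex_of_real (avg N f) - complex_of_real s / 2"
    using N avg_mult[of N "1/2" "\<lambda>y. complex_of_real ((f y)\<^sup>2)"]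
    by (simp add: avg_add avg_diff avg_const avg_mult of_real_avg s_def)
  also have "\<dots> = complex_of_real (1 - s / 2)" using mean by simp
  finally have "avg N (\<lambda>y. iexp (f y)) - complex_of_real (1 - s / 2)
     = avg N (\<lambda>y. iexp (f y) - (1 + \<i> * complex_of_real (f y) - complex_of_real ((f y)\<^sup>2) / 2))"
    by (simp add: avg_diff)
  also have "cmod \<dots> \<le> avg N (\<lambda>y. cmod (iexp (f y) - (1 + \<i> * complex_of_real (f y) - complex_of_real ((f y)\<^sup>2) / 2)))"
    by (rule norm_avg_le)
  also have "\<dots> \<le> avg N (\<lambda>y. M ^ 3)"
  proof (rule avg_mono)
    fix y assume "y < N"
    have "cmod (iexp (f y) - (1 + \<i> * complex_of_real (f y) - complex_of_real ((f y)\<^sup>2) / 2)) \<le> \<bar>f y\<bar> ^ 3 / 6"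
    proof -
      have T: "(\<Sum>k\<le>2. (\<i> * complex_of_real (f y)) ^ k / fact k)
         = 1 + \<i> * complex_of_real (f y) - complex_of_real ((f y)\<^sup>2) / 2"
        by (simp add: numeral_2_eq_2 ac_simps)
      have "Suc 2 = 3" "fact 3 = (6 :: real)" by (simp_all add: fact_numeral)
      then show ?thesis using iexp_approx1[of "f y" 2] by (simp only: T)
    qed
    also have "\<dots> \<le> \<bar>f y\<bar> ^ 3" by simp
    also have "\<dots> \<le> M ^ 3" by (rule power_mono) (use bd \<open>y < N\<close> in auto)
    finally show "cmod (iexp (f y) - (1 + \<i> * complex_of_real (f y) - complex_of_real ((f y)\<^sup>2) / 2)) \<le> M ^ 3" .
  qed
  also have "\<dots> = M ^ 3" using N by (simp add: avg_const)
  finally have 1: "cmod (avg N (\<lambda>y. iexp (f y)) - complex_of_real (1 - s / 2)) \<le> M ^ 3" .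
  have "cmod (complex_of_real (1 - s / 2) - exp (- s / 2)) = \<bar>1 - s / 2 - exp (- (s / 2))\<bar>"
    by (simp only: of_real_diff[symmetric] norm_of_real minus_divide_left)
  also have "\<dots> \<le> (s / 2)\<^sup>2" by (rule exp_minus_approx) (use s in simp)
  also have "\<dots> \<le> (M\<^sup>2)\<^sup>2" using s by (intro power_mono) auto
  finally have 2: "cmod (complex_of_real (1 - s / 2) - exp (- s / 2)) \<le> M ^ 4"
    by (simp add: power_mult[symmetric])
  show ?thesis
    using norm_triangle_mono[OF 1 2] by (simp add: s_def)
qed

text \<open>
  By independence the characteristic function is a product over the letters, and products of numbers in
  the unit disc differ by at most the sum of the differences of their factors. With \<open>M\<close> of order
  \<open>n\<^bsup>-1/2\<^esup>\<close> the bound tends to 0.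
\<close>

lemma word_avg_iexp_sum_approx:
  assumes N: "N > 0" and mean: "\<And>i. i < n \<Longrightarrow> avg N (\<xi> i) = 0"
    and bd: "\<And>i y. i < n \<Longrightarrow> y < N \<Longrightarrow> \<bar>\<xi> i y\<bar> \<le> M"
  shows "cmod (word_avg N n (\<lambda>l. iexp (\<Sum>i<n. \<xi> i (l ! i))) - exp (- (\<Sum>i<n. avg N (\<lambda>y. (\<xi> i y)\<^sup>2)) / 2))
     \<le> real n * (M ^ 3 + M ^ 4)"
proof -
  let ?s = "\<lambda>i. avg N (\<lambda>y. (\<xi> i y)\<^sup>2)"
  have "word_avg N n (\<lambda>l. iexp (\<Sum>i<n. \<xi> i (l ! i))) = word_avg N n (\<lambda>l. \<Prod>i<n. iexp (\<xi> i (l ! i)))"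
    by (simp add: exp_sum sum_distrib_left)
  also have "\<dots> = (\<Prod>i<n. avg N (\<lambda>y. iexp (\<xi> i y)))"
    by (rule word_avg_prod[of N n "\<lambda>i y. iexp (\<xi> i y)"])
  finally have 1: "word_avg N n (\<lambda>l. iexp (\<Sum>i<n. \<xi> i (l ! i))) = (\<Prod>i<n. avg N (\<lambda>y. iexp (\<xi> i y)))" .
  have "exp (- (\<Sum>i<n. ?s i) / 2) = (\<Prod>i<n. exp (- ?s i / 2))"
    by (simp add: exp_sum[symmetric] sum_divide_distrib sum_negf)
  then have 2: "complex_of_real (exp (- (\<Sum>i<n. ?s i) / 2)) = (\<Prod>i<n. complex_of_real (exp (- ?s i / 2)))"
    by (simp only: of_real_prod)
  have "cmod ((\<Prod>i<n. avg N (\<lambda>y. iexp (\<xi> i y))) - (\<Prod>i<n. complex_of_real (exp (- ?s i / 2))))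
     \<le> (\<Sum>i<n. cmod (avg N (\<lambda>y. iexp (\<xi> i y)) - complex_of_real (exp (- ?s i / 2))))"
  proof (rule norm_prod_diff)
    fix i assume "i \<in> {..<n}"
    have "cmod (avg N (\<lambda>y. iexp (\<xi> i y))) \<le> avg N (\<lambda>y. cmod (iexp (\<xi> i y)))" by (rule norm_avg_le)
    then show "cmod (avg N (\<lambda>y. iexp (\<xi> i y))) \<le> 1" using N by (simp only: cmod_iexp avg_const)
    have "0 \<le> ?s i" by (auto simp: avg_def intro!: mult_nonneg_nonneg sum_nonneg)
    then show "cmod (complex_of_real (exp (- ?s i / 2))) \<le> 1" by simp
  qed
  also have "\<dots> \<le> (\<Sum>i<n. M ^ 3 + M ^ 4)"
    by (rule sum_mono) (use avg_iexp_approx[OF N mean bd] in auto)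
  finally show ?thesis unfolding 1 2 by simp
qed

section \<open>Linear combinations of pattern counts\<close>

lemma patterns_iff: "\<sigma> \<in> patterns \<longleftrightarrow> \<sigma> \<in> perms (length \<sigma>) \<and> length \<sigma> > 0"
proof
  assume "\<sigma> \<in> patterns"
  then obtain k where "k \<ge> 1" "\<sigma> \<in> perms k" by (auto simp: patterns_def)
  moreover from this(2) have "length \<sigma> = k" by (rule perms_length)
  ultimately show "\<sigma> \<in> perms (length \<sigma>) \<and> length \<sigma> > 0" by simp
qed (auto simp: patterns_def Suc_le_eq)

text \<open>
  A linear combination of normalized pattern counts, not yet centred, as a function on words. The
  parameter \<open>n\<close> only enters the normalization.
\<close>

definition lin_stat :: "'i set \<Rightarrow> ('i \<Rightarrow> nat list) \<Rightarrow> ('i \<Rightarrow> real) \<Rightarrow> nat \<Rightarrow> nat list \<Rightarrow> real" where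
  "lin_stat I \<sigma>s c n l = (\<Sum>a\<in>I. c a * (patcount (\<sigma>s a) l / real n powr (real (length (\<sigma>s a)) - 1 / 2)))"

definition lin_G :: "'i set \<Rightarrow> ('i \<Rightarrow> nat list) \<Rightarrow> ('i \<Rightarrow> real) \<Rightarrow> real \<Rightarrow> real \<Rightarrow> real" where
  "lin_G I \<sigma>s c x y = (\<Sum>a\<in>I. c a * G (\<sigma>s a) x y)"

lemma abs_lin_stat_sum_le:
  fixes z :: "'i \<Rightarrow> real"
  assumes "\<And>a. a \<in> I \<Longrightarrow> \<bar>z a\<bar> \<le> r a"
  shows "\<bar>\<Sum>a\<in>I. c a * z a\<bar> \<le> (\<Sum>a\<in>I. \<bar>c a\<bar> * r a)"
  by (rule order.trans[OF sum_abs], rule sum_mono) (auto simp: abs_mult intro!: mult_left_mono assms)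

lemma abs_lin_stat_le:
  assumes "n > 0" "length l = n"
  shows "\<bar>lin_stat I \<sigma>s c n l\<bar> \<le> (\<Sum>a\<in>I. \<bar>c a\<bar>) * sqrt (real n)"
proof -
  have "\<bar>lin_stat I \<sigma>s c n l\<bar> \<le> (\<Sum>a\<in>I. \<bar>c a\<bar> * sqrt (real n))"
    unfolding lin_stat_def
  proof (rule abs_lin_stat_sum_le)
    fix a
    have "patcount (\<sigma>s a) l / real n powr (real (length (\<sigma>s a)) - 1 / 2)
       \<le> real n ^ length (\<sigma>s a) / real n powr (real (length (\<sigma>s a)) - 1 / 2)"
      using patcount_bounds(2)[of "\<sigma>s a" l] assms by (intro divide_right_mono) auto
    also have "\<dots> = sqrt (real n)" using assms by (simp add: powr_minus_half)
    finally show "\<bar>patcount (\<sigma>s a) l / real n powr (real (length (\<sigma>s a)) - 1 / 2)\<bar> \<le> sqrt (real n)"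
      using patcount_bounds(1)[of "\<sigma>s a" l] by simp
  qed
  then show ?thesis by (simp add: sum_distrib_right)
qed

lemma lin_stat_realize: "card S = n \<Longrightarrow> \<pi> \<in> perms n \<Longrightarrow> lin_stat I \<sigma>s c m (realize S \<pi>) = lin_stat I \<sigma>s c m \<pi>"
  by (simp add: lin_stat_def patcount_realize)

text \<open>
  Of order \<open>n\<^bsup>-3/2\<^esup>\<close>, so the mean square of the Hoeffding remainder is of order \<open>1 / n\<close>.
\<close>

lemma mixed_diff_bdd_lin_stat:
  assumes "n > 0"
  shows "mixed_diff_bdd n ((\<Sum>a\<in>I. 2 * \<bar>c a\<bar>) * sqrt (real n) / (real n)\<^sup>2) (lin_stat I \<sigma>s c n)"
  unfolding mixed_diff_bdd_def
proof (intro allI impI)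
  fix l :: "nat list" and i j x y assume *: "length l = n" "i < n" "j < n" "i \<noteq> j"
  let ?d = "\<lambda>f. f l - f (l[i := x]) - f (l[j := y]) + f (l[i := x, j := y])"
  let ?r = "\<lambda>a. real n powr (real (length (\<sigma>s a)) - 1 / 2)"
  have "?d (lin_stat I \<sigma>s c n) = (\<Sum>a\<in>I. c a * (?d (patcount (\<sigma>s a)) / ?r a))"
    unfolding lin_stat_def sum_subtractf[symmetric] sum.distrib[symmetric]
    by (rule sum.cong) (simp_all add: diff_divide_distrib add_divide_distrib right_diff_distrib distrib_left)
  also have "\<bar>\<dots>\<bar> \<le> (\<Sum>a\<in>I. \<bar>c a\<bar> * (2 * sqrt (real n) / (real n)\<^sup>2))"
  proof (rule abs_lin_stat_sum_le)
    fix a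
    have "\<bar>?d (patcount (\<sigma>s a))\<bar> \<le> 2 * real n ^ length (\<sigma>s a) / (real n)\<^sup>2"
      using mixed_diff_bdd_patcount[OF assms refl, of "\<sigma>s a"] * unfolding mixed_diff_bdd_def by blast
    then have "\<bar>?d (patcount (\<sigma>s a))\<bar> / ?r a \<le> 2 * real n ^ length (\<sigma>s a) / (real n)\<^sup>2 / ?r a"
      by (rule divide_right_mono) simp
    also have "\<dots> = 2 * sqrt (real n) / (real n)\<^sup>2" using assms by (simp add: powr_minus_half)
    finally show "\<bar>?d (patcount (\<sigma>s a)) / ?r a\<bar> \<le> 2 * sqrt (real n) / (real n)\<^sup>2" by simp
  qed
  also have "\<dots> = (\<Sum>a\<in>I. 2 * \<bar>c a\<bar>) * sqrt (real n) / (real n)\<^sup>2"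
    unfolding sum_distrib_right[symmetric] sum_distrib_left[symmetric] by simp
  finally show "\<bar>?d (lin_stat I \<sigma>s c n)\<bar> \<le> (\<Sum>a\<in>I. 2 * \<bar>c a\<bar>) * sqrt (real n) / (real n)\<^sup>2" .
qed

lemma proj_lin_stat:
  "proj N n (lin_stat I \<sigma>s c m) i y
   = (\<Sum>a\<in>I. c a * (proj N n (patcount (\<sigma>s a)) i y / real m powr (real (length (\<sigma>s a)) - 1 / 2)))"
proof -
  have "word_avg N n (\<lambda>l. c a * (h l / r)) = c a * (word_avg N n h / r)" for a h and r :: real
    using word_avg_mult[of N n "c a / r" h] by simp
  then show ?thesis
    unfolding proj_def lin_stat_def word_avg_sum sum_subtractf[symmetric]
    by (intro sum.cong) (simp_all add: diff_divide_distrib right_diff_distrib)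
qed

lemma proj_lin_stat_approx:
  assumes \<sigma>s: "\<And>a. a \<in> I \<Longrightarrow> \<sigma>s a \<in> patterns" and len: "\<And>a. a \<in> I \<Longrightarrow> length (\<sigma>s a) \<le> n"
    and "n \<le> N" "i < n" "y < N"
  shows "\<bar>sqrt (real n) * proj N n (lin_stat I \<sigma>s c n) i y - lin_G I \<sigma>s c (real i / real n) (real y / real N)\<bar>
    \<le> (\<Sum>a\<in>I. \<bar>c a\<bar> * (8 * real (length (\<sigma>s a)) ^ 3)) / real n"
proof -
  let ?k = "\<lambda>a. length (\<sigma>s a)"
  let ?P = "\<lambda>a. proj N n (patcount (\<sigma>s a)) i y / real n ^ (?k a - 1)"
  have n: "n > 0" using assms by simp
  have P: "sqrt (real n) * (proj N n (patcount (\<sigma>s a)) i y / real n powr (real (?k a) - 1 / 2)) = ?P a"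
    if "a \<in> I" for a
  proof -
    have "?k a > 0" using \<sigma>s[OF that] by (simp add: patterns_iff)
    then obtain k' where "?k a = Suc k'" by (cases "?k a") auto
    then show ?thesis using n unfolding powr_minus_half[OF n] by (simp add: field_simps)
  qed
  have "sqrt (real n) * proj N n (lin_stat I \<sigma>s c n) i y - lin_G I \<sigma>s c (real i / real n) (real y / real N)
    = (\<Sum>a\<in>I. c a * (?P a - G (\<sigma>s a) (real i / real n) (real y / real N)))"
    unfolding proj_lin_stat lin_G_def sum_distrib_left sum_subtractf[symmetric]
    by (intro sum.cong refl, subst mult.left_commute) (simp only: P right_diff_distrib)
  also have "\<bar>\<dots>\<bar> \<le> (\<Sum>a\<in>I. \<bar>c a\<bar> * (8 * real (?k a) ^ 3 / real n))"
  proof (rule abs_lin_stat_sum_le)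
    fix a assume a: "a \<in> I"
    have "\<bar>?P a - G (\<sigma>s a) (real i / real n) (real y / real N)\<bar> \<le> 4 * real (?k a) ^ 3 * (1 / real n + 1 / real N)"
      using \<sigma>s[OF a] len[OF a] assms by (intro proj_patcount_approx) (auto simp: patterns_iff)
    also have "\<dots> \<le> 4 * real (?k a) ^ 3 * (1 / real n + 1 / real n)"
      using n \<open>n \<le> N\<close> by (intro mult_left_mono add_mono) (auto intro!: frac_le)
    finally show "\<bar>?P a - G (\<sigma>s a) (real i / real n) (real y / real N)\<bar> \<le> 8 * real (?k a) ^ 3 / real n" by simp
  qed
  finally show ?thesis by (simp add: sum_divide_distrib)
qed

lemma abs_G_le:
  assumes "\<sigma> \<in> patterns" "0 \<le> x" "x \<le> 1" "0 \<le> y" "y \<le> 1"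
  shows "\<bar>G \<sigma> x y\<bar> \<le> real (length \<sigma>)"
proof -
  let ?k = "length \<sigma>"
  have \<sigma>: "\<sigma> \<in> perms ?k" "?k > 0" using assms by (auto simp: patterns_iff)
  have "\<bar>g ?k (j + 1) x / fact (?k - 1) * (g ?k (\<sigma> ! j) y / fact (?k - 1) - 1 / fact ?k)\<bar> \<le> 1" if j: "j < ?k" for j
  proof -
    have s: "\<sigma> ! j - 1 < ?k" "\<sigma> ! j - 1 + 1 = \<sigma> ! j" using perms_nth[OF \<sigma>(1) j] by auto
    have 1: "0 \<le> g ?k (j + 1) x / fact (?k - 1)" "g ?k (j + 1) x / fact (?k - 1) \<le> 1"
      using g_over_fact_bounds[OF j assms(2,3)] by auto
    have 2: "0 \<le> g ?k (\<sigma> ! j) y / fact (?k - 1)" "g ?k (\<sigma> ! j) y / fact (?k - 1) \<le> 1"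
      using g_over_fact_bounds[OF s(1) assms(4,5)] unfolding s by auto
    have 3: "0 \<le> 1 / (fact ?k :: real)" "1 / (fact ?k :: real) \<le> 1"
      using fact_ge_1[of ?k, where ?'a=real] by auto
    have "\<bar>g ?k (\<sigma> ! j) y / fact (?k - 1) - 1 / fact ?k\<bar> \<le> 1" using 2 3 by linarith
    moreover have "\<bar>g ?k (j + 1) x / fact (?k - 1)\<bar> \<le> 1" using 1 by linarith
    ultimately show ?thesis unfolding abs_mult by (intro mult_le_one abs_ge_zero)
  qed
  then have "(\<Sum>j<?k. \<bar>g ?k (j + 1) x / fact (?k - 1) * (g ?k (\<sigma> ! j) y / fact (?k - 1) - 1 / fact ?k)\<bar>) \<le> (\<Sum>j<?k. 1)"
    by (intro sum_mono) auto
  then show ?thesis unfolding G_eq_sum[OF \<sigma>] by (intro order.trans[OF sum_abs]) simp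
qed

definition lin_var :: "'i set \<Rightarrow> ('i \<Rightarrow> nat list) \<Rightarrow> ('i \<Rightarrow> real) \<Rightarrow> real" where
  "lin_var I \<sigma>s c = (\<Sum>a\<in>I. \<Sum>b\<in>I. c a * c b * Sigma_cov (\<sigma>s a) (\<sigma>s b))"

lemma filterlim_cube: "filterlim (\<lambda>n::nat. n ^ 3) at_top sequentially"
proof (rule filterlim_at_top_mono[OF filterlim_ident], intro always_eventually allI)
  show "n \<le> n ^ 3" for n :: nat by (cases "n = 0") (auto intro: self_le_power)
qed

lemma abs_avg_le:
  fixes f :: "nat \<Rightarrow> real"
  assumes "c \<ge> 0" "\<And>b. b < N \<Longrightarrow> \<bar>f b\<bar> \<le> c"
  shows "\<bar>avg N f\<bar> \<le> c"
proof (cases "N = 0")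
  case False
  have "norm (avg N f) \<le> avg N (\<lambda>b. norm (f b))" by (rule norm_avg_le)
  also have "\<dots> \<le> avg N (\<lambda>b. c)" by (rule avg_mono) (use assms in simp)
  finally show ?thesis using False by (simp add: avg_const)
qed (use assms in \<open>simp add: avg_def\<close>)

lemma lin_G_sq_limit:
  assumes I: "finite I" and \<sigma>s: "\<And>a. a \<in> I \<Longrightarrow> \<sigma>s a \<in> patterns"
  shows "(\<lambda>n. avg n (\<lambda>i. avg (n ^ 3) (\<lambda>y. (lin_G I \<sigma>s c (real i / real n) (real y / real (n ^ 3)))\<^sup>2)))
     \<longlonglongrightarrow> lin_var I \<sigma>s c"
proof -
  have sq: "(lin_G I \<sigma>s c x y)\<^sup>2 = (\<Sum>a\<in>I. \<Sum>b\<in>I. c a * c b * (G (\<sigma>s a) x y * G (\<sigma>s b) x y))" for x y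
    unfolding lin_G_def power2_eq_square sum_product by (intro sum.cong) (simp_all add: ac_simps)
  show ?thesis
    unfolding sq avg_sum avg_mult lin_var_def
    by (intro tendsto_sum tendsto_mult_left Sigma_cov_limit filterlim_cube) (use \<sigma>s in \<open>auto simp: patterns_iff\<close>)
qed

text \<open>
  Multiplied by \<open>\<surd>n\<close>, the projections are uniformly close to \<open>lin_G\<close> at the points
  of a grid, so the sum of their variances is close to a two-dimensional Riemann sum of its square.
\<close>

lemma variance_lin_stat_limit:
  assumes I: "finite I" and \<sigma>s: "\<And>a. a \<in> I \<Longrightarrow> \<sigma>s a \<in> patterns"
  shows "(\<lambda>n. \<Sum>i<n. avg (n ^ 3) (\<lambda>y. (proj (n ^ 3) n (lin_stat I \<sigma>s c n) i y)\<^sup>2)) \<longlonglongrightarrow> lin_var I \<sigma>s c"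
proof -
  define D where "D = (\<Sum>a\<in>I. \<bar>c a\<bar> * (8 * real (length (\<sigma>s a)) ^ 3))"
  define B where "B = (\<Sum>a\<in>I. \<bar>c a\<bar> * real (length (\<sigma>s a)))"
  have D: "D \<ge> 0" and B: "B \<ge> 0" unfolding D_def B_def by (auto intro!: sum_nonneg)
  obtain m where m: "\<And>a. a \<in> I \<Longrightarrow> length (\<sigma>s a) \<le> m"
    using finite_nat_set_iff_bounded_le[of "(\<lambda>a. length (\<sigma>s a)) ` I"] I by auto
  let ?H = "\<lambda>n i y. lin_G I \<sigma>s c (real i / real n) (real y / real (n ^ 3))"
  let ?p = "\<lambda>n i y. proj (n ^ 3) n (lin_stat I \<sigma>s c n) i y"
  have "(\<lambda>n. (\<Sum>i<n. avg (n ^ 3) (\<lambda>y. (?p n i y)\<^sup>2)) - avg n (\<lambda>i. avg (n ^ 3) (\<lambda>y. (?H n i y)\<^sup>2))) \<longlonglongrightarrow> 0"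
  proof (rule Lim_null_comparison)
    show "(\<lambda>n. (D * (2 * B + D)) / real n) \<longlonglongrightarrow> 0" by (rule lim_const_over_n)
    show "\<forall>\<^sub>F n in sequentially. norm ((\<Sum>i<n. avg (n ^ 3) (\<lambda>y. (?p n i y)\<^sup>2)) - avg n (\<lambda>i. avg (n ^ 3) (\<lambda>y. (?H n i y)\<^sup>2)))
       \<le> (D * (2 * B + D)) / real n"
      using eventually_gt_at_top[of m]
    proof eventually_elim
      case (elim n)
      then have n: "n > 0" by simp
      have len: "length (\<sigma>s a) \<le> n" if "a \<in> I" for a using m[OF that] elim by linarith
      have nN: "n \<le> n ^ 3" by (rule self_le_power) (use n in auto)
      have "(\<Sum>i<n. avg (n ^ 3) (\<lambda>y. (?p n i y)\<^sup>2)) = avg n (\<lambda>i. real n * avg (n ^ 3) (\<lambda>y. (?p n i y)\<^sup>2))"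
        unfolding avg_mult using n by (simp add: avg_def[of n])
      also have "\<dots> = avg n (\<lambda>i. avg (n ^ 3) (\<lambda>y. (sqrt (real n) * ?p n i y)\<^sup>2))"
        unfolding avg_mult[symmetric] by (simp add: power_mult_distrib)
      finally have "(\<Sum>i<n. avg (n ^ 3) (\<lambda>y. (?p n i y)\<^sup>2)) - avg n (\<lambda>i. avg (n ^ 3) (\<lambda>y. (?H n i y)\<^sup>2))
         = avg n (\<lambda>i. avg (n ^ 3) (\<lambda>y. (sqrt (real n) * ?p n i y)\<^sup>2 - (?H n i y)\<^sup>2))"
        by (simp add: avg_diff)
      also have "norm \<dots> \<le> D * (2 * B + D) / real n"
        unfolding real_norm_def
      proof (intro abs_avg_le)
        fix i y assume iy: "i < n" "y < n ^ 3"
        let ?u = "sqrt (real n) * ?p n i y"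
        have xy: "0 \<le> real i / real n" "real i / real n \<le> 1" "0 \<le> real y / real (n ^ 3)" "real y / real (n ^ 3) \<le> 1"
          using iy by (auto simp: field_simps simp del: of_nat_power)
        have close: "\<bar>?u - ?H n i y\<bar> \<le> D / real n"
          unfolding D_def by (rule proj_lin_stat_approx[OF \<sigma>s len nN iy])
        have H: "\<bar>?H n i y\<bar> \<le> B"
          unfolding lin_G_def B_def by (intro abs_lin_stat_sum_le abs_G_le \<sigma>s xy)
        have "D / real n \<le> D" using D n by (simp add: field_simps mult_le_cancel_left1)
        then have sum: "\<bar>?u + ?H n i y\<bar> \<le> 2 * B + D" using close H by linarith
        have "\<bar>?u\<^sup>2 - (?H n i y)\<^sup>2\<bar> = \<bar>?u - ?H n i y\<bar> * \<bar>?u + ?H n i y\<bar>"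
          by (simp add: abs_mult[symmetric] power2_eq_square algebra_simps)
        also have "\<dots> \<le> D / real n * (2 * B + D)"
          using close sum D by (intro mult_mono) auto
        finally show "\<bar>?u\<^sup>2 - (?H n i y)\<^sup>2\<bar> \<le> D * (2 * B + D) / real n" by simp
      qed (use D B in auto)
      finally show ?case .
    qed
  qed
  from tendsto_add[OF this lin_G_sq_limit[of I \<sigma>s c, OF I \<sigma>s]] show ?thesis by simp
qed

section \<open>The limit of the characteristic functions\<close>

lemma abs_cos_diff_le: "\<bar>cos x - cos y\<bar> \<le> \<bar>x - y\<bar>" for x y :: real
proof -
  have "\<bar>cos x - cos y\<bar> = 2 * (\<bar>sin ((x + y) / 2)\<bar> * \<bar>sin ((y - x) / 2)\<bar>)"
    by (simp add: cos_diff_cos abs_mult)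
  also have "\<dots> \<le> 2 * (1 * \<bar>(y - x) / 2\<bar>)"
    by (intro mult_left_mono mult_mono abs_sin_x_le_abs_x) auto
  finally show ?thesis by simp
qed

lemma abs_word_avg_diff_cos_le:
  fixes f h :: "nat list \<Rightarrow> real"
  shows "\<bar>word_avg N n (\<lambda>l. cos (f l)) - word_avg N n (\<lambda>l. cos (h l))\<bar> \<le> word_avg N n (\<lambda>l. \<bar>f l - h l\<bar>)"
proof -
  have "norm (word_avg N n (\<lambda>l. cos (f l) - cos (h l))) \<le> word_avg N n (\<lambda>l. norm (cos (f l) - cos (h l)))"
    by (rule norm_word_avg_le)
  also have "\<dots> \<le> word_avg N n (\<lambda>l. \<bar>f l - h l\<bar>)"
    by (rule word_avg_mono) (simp add: abs_cos_diff_le)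
  finally show ?thesis by (simp add: word_avg_diff)
qed

lemma word_avg_cos_iexp:
  "word_avg N n (\<lambda>l. cos (f l + b)) = Re (iexp b * word_avg N n (\<lambda>l. iexp (f l)))"
proof -
  have "Re (word_avg N n h) = word_avg N n (\<lambda>l. Re (h l))" for h
    by (simp add: word_avg_eq_sum)
  moreover have "Re (iexp b * iexp (f l)) = cos (f l + b)" for l
    by (simp add: exp_add[symmetric] distrib_left[symmetric] of_real_add[symmetric] Re_exp add.commute del: of_real_add)
  ultimately show ?thesis by (simp add: word_avg_mult[symmetric])
qed

lemma abs_le_weighted_square:
  fixes r s :: real
  assumes "s > 0"
  shows "\<bar>r\<bar> \<le> s / 2 * r\<^sup>2 + 1 / (2 * s)"
proof -
  have "(s * \<bar>r\<bar> - 1)\<^sup>2 / (2 * s) = s / 2 * r\<^sup>2 + 1 / (2 * s) - \<bar>r\<bar>"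
    using assms by (simp add: power2_diff power_mult_distrib) (simp add: field_simps power2_eq_square)
  moreover have "0 \<le> (s * \<bar>r\<bar> - 1)\<^sup>2 / (2 * s)" using assms by simp
  ultimately show ?thesis by linarith
qed

lemma lim_const_over_sqrt: "(\<lambda>n. c / sqrt (real n)) \<longlonglongrightarrow> 0"
  by (intro tendsto_divide_0[OF tendsto_const] filterlim_at_top_imp_at_infinity
      filterlim_compose[OF sqrt_at_top filterlim_real_sequentially])

text \<open>
  The phase \<open>b\<close> lets one real statement cover the real and the imaginary part of the characteristic
  function. The alphabet has \<open>n\<^sup>3\<close> letters: then repetitions have probability at most \<open>1 / n\<close>, and since
  the statistic itself is of order at most \<open>\<surd>n\<close>, replacing its mean over permutations by its mean
  over words costs \<open>\<surd>n / n\<close>. The four errors in \<open>err\<close> come from the passage to words, from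
  this change of centring, from the Hoeffding remainder, and from the factorized characteristic
  function of the projection.
\<close>

theorem expectation_cos_limit:
  assumes I: "finite I" and \<sigma>s: "\<And>a. a \<in> I \<Longrightarrow> \<sigma>s a \<in> patterns"
  shows "(\<lambda>n. measure_pmf.expectation (unif_perm n) (\<lambda>\<pi>. cos ((\<Sum>a\<in>I. c a * normalized_occ (\<sigma>s a) n \<pi>) + b)))
     \<longlonglongrightarrow> exp (- lin_var I \<sigma>s c / 2) * cos b"
proof -
  define D where "D = (\<Sum>a\<in>I. \<bar>c a\<bar> * (8 * real (length (\<sigma>s a)) ^ 3))"
  define B where "B = (\<Sum>a\<in>I. \<bar>c a\<bar> * real (length (\<sigma>s a)))"
  define C where "C = (\<Sum>a\<in>I. \<bar>c a\<bar>)"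
  have pos: "D \<ge> 0" "B \<ge> 0" "C \<ge> 0" unfolding D_def B_def C_def by (auto intro!: sum_nonneg)
  obtain m where m: "\<And>a. a \<in> I \<Longrightarrow> length (\<sigma>s a) \<le> m"
    using finite_nat_set_iff_bounded_le[of "(\<lambda>a. length (\<sigma>s a)) ` I"] I by auto
  define V where "V = (\<lambda>n. \<Sum>i<n. avg (n ^ 3) (\<lambda>y. (proj (n ^ 3) n (lin_stat I \<sigma>s c n) i y)\<^sup>2))"
  let ?E = "\<lambda>n. measure_pmf.expectation (unif_perm n)"
  let ?L = "\<lambda>n. ?E n (\<lambda>\<pi>. cos ((\<Sum>a\<in>I. c a * normalized_occ (\<sigma>s a) n \<pi>) + b))"
  define err where "err = (\<lambda>n. 2 / real n + 2 * C / sqrt (real n) + (4 * C\<^sup>2 + 1) / (2 * sqrt (real n))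
      + ((B + D) ^ 3 / sqrt (real n) + (B + D) ^ 4 / real n))"
  have bound: "\<bar>?L n - exp (- V n / 2) * cos b\<bar> \<le> err n" if "n > m" for n
  proof -
    define N where "N = n ^ 3"
    define f where "f = lin_stat I \<sigma>s c n"
    define \<xi> where "\<xi> = proj N n f"
    define \<mu> where "\<mu> = ?E n f"
    have n: "n > 0" using that by simp
    have len: "length (\<sigma>s a) \<le> n" if "a \<in> I" for a using m[OF that] \<open>n > m\<close> by linarith
    have N: "N > 0" using n by (simp add: N_def)
    have nN: "n \<le> N" unfolding N_def by (rule self_le_power) (use n in auto)
    have sn: "sqrt (real n) > 0" "sqrt (real n) * sqrt (real n) = real n" using n by auto
    have 0: "?L n = ?E n (\<lambda>\<pi>. cos (f \<pi> - \<mu> + b))"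
    proof (rule expectation_unif_perm_cong)
      fix \<pi> assume \<pi>: "\<pi> \<in> perms n"
      have "?E n f = (\<Sum>a\<in>I. c a * (mean_occ (\<sigma>s a) n / real n powr (real (length (\<sigma>s a)) - 1 / 2)))"
      proof -
        have mo: "mean_occ (\<sigma>s a) n = ?E n (patcount (\<sigma>s a))" if "a \<in> I" for a
          unfolding mean_occ_def
          by (rule expectation_unif_perm_cong) (rule occ_eq_patcount, use \<sigma>s[OF that] in \<open>auto simp: patterns_iff\<close>)
        have "?E n f = (\<Sum>a\<in>I. c a * (?E n (patcount (\<sigma>s a)) / real n powr (real (length (\<sigma>s a)) - 1 / 2)))"
          unfolding f_def lin_stat_def expectation_unif_perm
          by (subst sum.swap) (simp add: sum_distrib_left sum_divide_distrib mult.commute divide_divide_eq_left)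
        then show ?thesis using mo by simp
      qed
      moreover have "real (occ (\<sigma>s a) \<pi>) = patcount (\<sigma>s a) \<pi>" if "a \<in> I" for a
        using occ_eq_patcount[OF \<pi>] \<sigma>s[OF that] by (auto simp: patterns_iff)
      ultimately have "(\<Sum>a\<in>I. c a * normalized_occ (\<sigma>s a) n \<pi>) = f \<pi> - \<mu>"
        by (simp add: \<mu>_def f_def lin_stat_def normalized_occ_def sum_subtractf[symmetric] right_diff_distrib diff_divide_distrib)
      then show "cos ((\<Sum>a\<in>I. c a * normalized_occ (\<sigma>s a) n \<pi>) + b) = cos (f \<pi> - \<mu> + b)" by simp
    qed
    have 1: "\<bar>?E n (\<lambda>\<pi>. cos (f \<pi> - \<mu> + b)) - word_avg N n (\<lambda>l. cos (f l - \<mu> + b))\<bar> \<le> 2 / real n"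
    proof -
      have "\<bar>?E n (\<lambda>\<pi>. cos (f \<pi> - \<mu> + b)) - word_avg N n (\<lambda>l. cos (f l - \<mu> + b))\<bar> \<le> 2 * 1 * (real n)\<^sup>2 / real N"
        by (rule expectation_unif_perm_approx[OF N]) (auto simp: f_def lin_stat_realize)
      also have "\<dots> = 2 / real n" using n by (simp add: N_def power2_eq_square power3_eq_cube)
      finally show ?thesis .
    qed
    have \<mu>: "\<bar>\<mu> - word_avg N n f\<bar> \<le> 2 * C / sqrt (real n)"
    proof -
      have "\<bar>\<mu> - word_avg N n f\<bar> \<le> 2 * (C * sqrt (real n)) * (real n)\<^sup>2 / real N"
        unfolding \<mu>_def C_def f_def
        by (rule expectation_unif_perm_approx[OF N]) (use n in \<open>auto simp: lin_stat_realize intro!: abs_lin_stat_le\<close>)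
      also have "\<dots> = 2 * C * (sqrt (real n) / real n)" using n by (simp add: N_def power2_eq_square power3_eq_cube)
      also have "\<dots> = 2 * C / sqrt (real n)" by (simp add: sqrt_divide_self_eq inverse_eq_divide)
      finally show ?thesis .
    qed
    have 2: "\<bar>word_avg N n (\<lambda>l. cos (f l - \<mu> + b)) - word_avg N n (\<lambda>l. cos (f l - word_avg N n f + b))\<bar> \<le> 2 * C / sqrt (real n)"
      using abs_word_avg_diff_cos_le[of N n "\<lambda>l. f l - \<mu> + b" "\<lambda>l. f l - word_avg N n f + b"] \<mu> N
      by (simp add: word_avg_const)
    have 3: "\<bar>word_avg N n (\<lambda>l. cos (f l - word_avg N n f + b)) - word_avg N n (\<lambda>l. cos ((\<Sum>i<n. \<xi> i (l ! i)) + b))\<bar>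
        \<le> (4 * C\<^sup>2 + 1) / (2 * sqrt (real n))"
    proof -
      let ?R = "\<lambda>l. f l - word_avg N n f - (\<Sum>i<n. \<xi> i (l ! i))"
      have "(\<Sum>a\<in>I. 2 * \<bar>c a\<bar>) = 2 * C" by (simp add: C_def sum_distrib_left)
      then have "word_avg N n (\<lambda>l. (?R l)\<^sup>2) \<le> (real n)\<^sup>2 * (2 * C * sqrt (real n) / (real n)\<^sup>2)\<^sup>2"
        using word_avg_remainder_sq_le[OF N mixed_diff_bdd_lin_stat[OF n, of c I \<sigma>s]] by (simp add: f_def \<xi>_def)
      also have "\<dots> = 4 * C\<^sup>2 / real n"
        using n by (simp add: power_mult_distrib power_divide) (simp add: field_simps power2_eq_square power4_eq_xxxx)
      finally have R2: "word_avg N n (\<lambda>l. (?R l)\<^sup>2) \<le> 4 * C\<^sup>2 / real n" .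
      have "word_avg N n (\<lambda>l. \<bar>?R l\<bar>) \<le> word_avg N n (\<lambda>l. sqrt (real n) / 2 * (?R l)\<^sup>2 + 1 / (2 * sqrt (real n)))"
      proof (rule word_avg_mono)
        show "\<bar>?R l\<bar> \<le> sqrt (real n) / 2 * (?R l)\<^sup>2 + 1 / (2 * sqrt (real n))" for l
          by (rule abs_le_weighted_square[OF sn(1)])
      qed
      also have "\<dots> = sqrt (real n) / 2 * word_avg N n (\<lambda>l. (?R l)\<^sup>2) + 1 / (2 * sqrt (real n))"
        unfolding word_avg_add word_avg_mult using N by (simp add: word_avg_const)
      also have "\<dots> \<le> sqrt (real n) / 2 * (4 * C\<^sup>2 / real n) + 1 / (2 * sqrt (real n))"
        using R2 by (intro add_mono mult_left_mono) auto
      also have "\<dots> = (4 * C\<^sup>2 + 1) / (2 * sqrt (real n))"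
      proof -
        have "sqrt (real n) / real n = 1 / sqrt (real n)" by (simp add: sqrt_divide_self_eq inverse_eq_divide)
        then have "sqrt (real n) / 2 * (4 * C\<^sup>2 / real n) = 4 * C\<^sup>2 / (2 * sqrt (real n))"
          by (metis (no_types, lifting) times_divide_eq_right times_divide_eq_left mult.commute mult_1 divide_divide_eq_left)
        then show ?thesis by (simp add: add_divide_distrib)
      qed
      finally show ?thesis
        using abs_word_avg_diff_cos_le[of N n "\<lambda>l. f l - word_avg N n f + b" "\<lambda>l. (\<Sum>i<n. \<xi> i (l ! i)) + b"]
        by (simp add: algebra_simps)
    qed
    have 4: "\<bar>word_avg N n (\<lambda>l. cos ((\<Sum>i<n. \<xi> i (l ! i)) + b)) - exp (- V n / 2) * cos b\<bar>
       \<le> (B + D) ^ 3 / sqrt (real n) + (B + D) ^ 4 / real n"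
    proof -
      define M where "M = (B + D) / sqrt (real n)"
      have small: "\<bar>\<xi> i y\<bar> \<le> M" if iy: "i < n" "y < N" for i y
      proof -
        have xy: "0 \<le> real i / real n" "real i / real n \<le> 1" "0 \<le> real y / real N" "real y / real N \<le> 1"
          using iy by (auto simp: field_simps)
        have close: "\<bar>sqrt (real n) * \<xi> i y - lin_G I \<sigma>s c (real i / real n) (real y / real N)\<bar> \<le> D / real n"
          unfolding D_def \<xi>_def f_def by (rule proj_lin_stat_approx[OF \<sigma>s len nN iy])
        have H: "\<bar>lin_G I \<sigma>s c (real i / real n) (real y / real N)\<bar> \<le> B"
          unfolding lin_G_def B_def by (intro abs_lin_stat_sum_le abs_G_le \<sigma>s xy)
        have "D / real n \<le> D" using pos n by (simp add: field_simps mult_le_cancel_left1)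
        then have "\<bar>sqrt (real n) * \<xi> i y\<bar> \<le> B + D" using close H by linarith
        then have "sqrt (real n) * \<bar>\<xi> i y\<bar> \<le> B + D" by (simp add: abs_mult)
        then show ?thesis unfolding M_def using sn(1) by (simp add: pos_le_divide_eq mult.commute)
      qed
      have mean: "avg N (\<xi> i) = 0" if "i < n" for i unfolding \<xi>_def by (rule avg_proj[OF N that])
      have V: "V n = (\<Sum>i<n. avg N (\<lambda>y. (\<xi> i y)\<^sup>2))" by (simp add: V_def \<xi>_def N_def f_def)
      let ?z = "word_avg N n (\<lambda>l. iexp (\<Sum>i<n. \<xi> i (l ! i)))"
      have "exp (- V n / 2) * cos b = Re (iexp b * complex_of_real (exp (- V n / 2)))"
        by (simp add: Re_exp)
      then have "\<bar>word_avg N n (\<lambda>l. cos ((\<Sum>i<n. \<xi> i (l ! i)) + b)) - exp (- V n / 2) * cos b\<bar>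
         = \<bar>Re (iexp b * (?z - complex_of_real (exp (- V n / 2))))\<bar>"
        unfolding word_avg_cos_iexp by (simp only: right_diff_distrib minus_complex.sel)
      also have "\<dots> \<le> cmod (iexp b * (?z - complex_of_real (exp (- V n / 2))))" by (rule abs_Re_le_cmod)
      also have "\<dots> = cmod (?z - complex_of_real (exp (- V n / 2)))" by (simp only: norm_mult cmod_iexp mult_1)
      also have "\<dots> \<le> real n * (M ^ 3 + M ^ 4)"
        unfolding V by (rule word_avg_iexp_sum_approx[OF N mean small])
      also have "\<dots> = (B + D) ^ 3 / sqrt (real n) + (B + D) ^ 4 / real n"
      proof -
        have s3: "sqrt (real n) ^ 3 = real n * sqrt (real n)" "sqrt (real n) ^ 4 = real n * real n"
          using sn(2) by (simp_all add: numeral_eq_Suc)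
        show ?thesis unfolding M_def power_divide s3 using n by (simp add: distrib_left)
      qed
      finally show ?thesis .
    qed
    show ?thesis unfolding err_def 0 using 1 2 3 4 by linarith
  qed
  have "err \<longlonglongrightarrow> 0"
    unfolding err_def divide_divide_eq_left[symmetric]
    by (intro tendsto_add_zero lim_const_over_n lim_const_over_sqrt)
  have "(\<lambda>n. ?L n - exp (- V n / 2) * cos b) \<longlonglongrightarrow> 0"
  proof (rule Lim_null_comparison)
    show "\<forall>\<^sub>F n in sequentially. norm (?L n - exp (- V n / 2) * cos b) \<le> err n"
      using eventually_gt_at_top[of m] by eventually_elim (use bound in simp)
  qed fact
  moreover have "(\<lambda>n. exp (- V n / 2) * cos b) \<longlonglongrightarrow> exp (- lin_var I \<sigma>s c / 2) * cos b"
    using variance_lin_stat_limit[of I \<sigma>s c, OF I \<sigma>s] unfolding V_def by (intro tendsto_intros) auto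
  ultimately show ?thesis using tendsto_add by fastforce
qed

section \<open>Normal random variables\<close>

context prob_space
begin

lemma normal_rv_integrable:
  assumes "normal_rv M X"
  shows "integrable M X" "integrable M (\<lambda>\<omega>. (X \<omega>)\<^sup>2)"
proof -
  have X [measurable]: "X \<in> borel_measurable M" using assms by (simp add: normal_rv_def)
  have "integrable M X \<and> integrable M (\<lambda>\<omega>. (X \<omega>)\<^sup>2)"
  proof -
    consider (normal) \<mu> s where "s > 0" "distributed M lborel X (normal_density \<mu> s)"
      | (const) c where "AE \<omega> in M. X \<omega> = c"
      using assms unfolding normal_rv_def by blast
    then show ?thesis
    proof cases
      case normal
      have i: "integrable M (\<lambda>\<omega>. (X \<omega> - \<mu>) ^ k)" for k
        using distributed_integrable[OF normal(2), of "\<lambda>x. (x - \<mu>) ^ k"] integrable_normal_moment[OF normal(1), of \<mu> k]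
        by simp
      have 1: "integrable M X" using Bochner_Integration.integrable_add[OF i[of 1] integrable_const[of \<mu>]] by simp
      have "integrable M (\<lambda>\<omega>. (X \<omega> - \<mu>)\<^sup>2 + (2 * \<mu> * X \<omega> - \<mu>\<^sup>2))"
        using i[of 2] 1 by (intro Bochner_Integration.integrable_add Bochner_Integration.integrable_diff integrable_mult_right) auto
      moreover have "(\<lambda>\<omega>. (X \<omega> - \<mu>)\<^sup>2 + (2 * \<mu> * X \<omega> - \<mu>\<^sup>2)) = (\<lambda>\<omega>. (X \<omega>)\<^sup>2)"
        by (auto simp: power2_diff)
      ultimately show ?thesis using 1 by simp
    next
      case const
      have "integrable M X \<longleftrightarrow> integrable M (\<lambda>\<omega>. c)"
        by (rule integrable_cong_AE) (use const in auto)
      moreover have "integrable M (\<lambda>\<omega>. (X \<omega>)\<^sup>2) \<longleftrightarrow> integrable M (\<lambda>\<omega>. c\<^sup>2)"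
        by (rule integrable_cong_AE) (use const in auto)
      ultimately show ?thesis by simp
    qed
  qed
  then show "integrable M X" "integrable M (\<lambda>\<omega>. (X \<omega>)\<^sup>2)" by auto
qed

text \<open>
  The formula covers the degenerate case, in which the variable vanishes almost everywhere.
\<close>

lemma normal_rv_expectation_cos:
  assumes nX: "normal_rv M X" and mean: "expectation X = 0"
  shows "expectation (\<lambda>\<omega>. cos (X \<omega> + b)) = exp (- expectation (\<lambda>\<omega>. (X \<omega>)\<^sup>2) / 2) * cos b"
proof -
  have X [measurable]: "X \<in> borel_measurable M" using nX by (simp add: normal_rv_def)
  consider (normal) \<mu> s where "s > 0" "distributed M lborel X (normal_density \<mu> s)"
    | (const) c where "AE \<omega> in M. X \<omega> = c"
    using nX unfolding normal_rv_def by blast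
  then show ?thesis
  proof cases
    case const
    have "expectation X = expectation (\<lambda>\<omega>. c)"
      by (rule integral_cong_AE) (use const in auto)
    then have c: "c = 0" using mean by (simp add: prob_space)
    have "expectation (\<lambda>\<omega>. cos (X \<omega> + b)) = expectation (\<lambda>\<omega>. cos (c + b))"
      by (rule integral_cong_AE) (use const in auto)
    moreover have "expectation (\<lambda>\<omega>. (X \<omega>)\<^sup>2) = expectation (\<lambda>\<omega>. c\<^sup>2)"
      by (rule integral_cong_AE) (use const in auto)
    ultimately show ?thesis using c by (simp add: prob_space)
  next
    case normal
    have "\<mu> = 0" using normal_distributed_expectation[OF normal] mean by simp
    then have d: "distributed M lborel X (normal_density 0 s)" using normal by simp
    have v: "expectation (\<lambda>\<omega>. (X \<omega>)\<^sup>2) = s\<^sup>2"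
      using normal_distributed_variance[OF normal(1) d] mean by simp
    have "distributed M lborel (\<lambda>\<omega>. (X \<omega> - 0) / s) std_normal_density"
      using d normal_standard_normal_convert[OF normal(1), of X 0] by simp
    then have "distr M lborel (\<lambda>\<omega>. X \<omega> / s) = std_normal_distribution"
      by (simp add: distributed_def)
    then have "char std_normal_distribution s = (CLINT x|distr M lborel (\<lambda>\<omega>. X \<omega> / s). iexp (s * x))"
      by (simp add: char_def)
    also have "\<dots> = (CLINT \<omega>|M. iexp (s * (X \<omega> / s)))"
      by (rule integral_distr) auto
    finally have "(CLINT \<omega>|M. iexp (X \<omega>)) = exp (- (s\<^sup>2) / 2)"
      using normal(1) by (simp add: char_std_normal_distribution)
    then have e: "(CLINT \<omega>|M. iexp b * iexp (X \<omega>)) = iexp b * complex_of_real (exp (- (s\<^sup>2) / 2))"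
      by simp
    have "integrable M (\<lambda>\<omega>. iexp b * iexp (X \<omega>))"
      by (rule integrable_const_bound[where B=1]) (auto simp: norm_mult)
    then have "Re (CLINT \<omega>|M. iexp b * iexp (X \<omega>)) = expectation (\<lambda>\<omega>. Re (iexp b * iexp (X \<omega>)))"
      by (rule integral_Re[symmetric])
    also have "(\<lambda>\<omega>. Re (iexp b * iexp (X \<omega>))) = (\<lambda>\<omega>. cos (X \<omega> + b))"
      by (simp add: exp_add[symmetric] distrib_left[symmetric] of_real_add[symmetric] Re_exp add.commute del: of_real_add)
    finally show ?thesis unfolding e v by (simp add: Re_exp mult.commute)
  qed
qed

end

lemma char_distr_eq:
  assumes "prob_space P" and [measurable]: "X \<in> borel_measurable P"
  shows "char (distr P borel X) t
     = Complex (LINT \<omega>|P. cos (t * X \<omega> + 0)) (LINT \<omega>|P. cos (t * X \<omega> + (- (pi / 2))))"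
proof -
  interpret P: prob_space P by fact
  have "char (distr P borel X) t = (CLINT \<omega>|P. iexp (t * X \<omega>))"
    unfolding char_def by (rule integral_distr) auto
  moreover have "integrable P (\<lambda>\<omega>. iexp (t * X \<omega>))"
    by (rule P.integrable_const_bound[where B=1]) auto
  then have "Re (CLINT \<omega>|P. iexp (t * X \<omega>)) = (LINT \<omega>|P. Re (iexp (t * X \<omega>)))"
    "Im (CLINT \<omega>|P. iexp (t * X \<omega>)) = (LINT \<omega>|P. Im (iexp (t * X \<omega>)))"
    by (simp_all only: integral_Re integral_Im)
  ultimately show ?thesis
    by (intro complex_eqI) (simp_all add: Re_exp Im_exp cos_diff)
qed

section \<open>Convergence in distribution of random vectors\<close>

text \<open>
  Finite trigonometric sums. Products of them are again such sums, so polynomials in trigonometric sums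
  are trigonometric sums.
\<close>

inductive trig :: "('c::real_inner \<Rightarrow> real) \<Rightarrow> bool" where
  cos: "trig (\<lambda>x. c * cos (t \<bullet> x + b))"
| add: "trig f \<Longrightarrow> trig h \<Longrightarrow> trig (\<lambda>x. f x + h x)"

lemma trig_const: "trig (\<lambda>x. c)"
  using trig.cos[of c 0 0] by simp

lemma trig_sum: "finite I \<Longrightarrow> (\<And>i. i \<in> I \<Longrightarrow> trig (f i)) \<Longrightarrow> trig (\<lambda>x. \<Sum>i\<in>I. f i x)"
  by (induction I rule: finite_induct) (auto intro: trig_const trig.add)

lemma trig_mult:
  assumes "trig f" "trig h"
  shows "trig (\<lambda>x. f x * h x)"
  using assms(1)
proof induction
  case (cos c t b)
  show ?case
    using assms(2)
  proof induction
    case (cos d s a)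
    have "(\<lambda>x. c * cos (t \<bullet> x + b) * (d * cos (s \<bullet> x + a)))
      = (\<lambda>x. c * d / 2 * cos ((t - s) \<bullet> x + (b - a)) + c * d / 2 * cos ((t + s) \<bullet> x + (b + a)))"
    proof
      fix x
      have "cos (t \<bullet> x + b) * cos (s \<bullet> x + a) = (cos (t \<bullet> x + b - (s \<bullet> x + a)) + cos (t \<bullet> x + b + (s \<bullet> x + a))) / 2"
        by (rule cos_times_cos)
      also have "t \<bullet> x + b - (s \<bullet> x + a) = (t - s) \<bullet> x + (b - a)" by (simp add: inner_diff_left)
      also have "t \<bullet> x + b + (s \<bullet> x + a) = (t + s) \<bullet> x + (b + a)" by (simp add: inner_add_left)
      finally have *: "cos (t \<bullet> x + b) * cos (s \<bullet> x + a) = (cos ((t - s) \<bullet> x + (b - a)) + cos ((t + s) \<bullet> x + (b + a))) / 2" .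
      have "c * cos (t \<bullet> x + b) * (d * cos (s \<bullet> x + a)) = c * d * (cos (t \<bullet> x + b) * cos (s \<bullet> x + a))"
        by (simp only: ac_simps)
      also have "\<dots> = c * d / 2 * cos ((t - s) \<bullet> x + (b - a)) + c * d / 2 * cos ((t + s) \<bullet> x + (b + a))"
        unfolding * by (simp only: times_divide_eq_right times_divide_eq_left distrib_left add_divide_distrib)
      finally show "c * cos (t \<bullet> x + b) * (d * cos (s \<bullet> x + a))
         = c * d / 2 * cos ((t - s) \<bullet> x + (b - a)) + c * d / 2 * cos ((t + s) \<bullet> x + (b + a))" .
    qed
    then show ?case by (simp only: trig.intros)
  next
    case (add f h)
    then show ?case using trig.add by (simp only: distrib_left)
  qed
next
  case (add f1 f2)
  then show ?case using trig.add by (simp only: distrib_right)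
qed

definition sin_vec :: "real \<Rightarrow> real ^ 'm \<Rightarrow> real ^ 'm" where
  "sin_vec R x = (\<chi> j. sin (x $ j / R))"

text \<open>
  Each coordinate of \<open>sin_vec R x\<close> is a sine of a linear function of \<open>x\<close>, hence a cosine with phase
  \<open>- \<pi> / 2\<close>.
\<close>

lemma trig_polynomial_sin_vec:
  fixes Q :: "real ^ 'm::finite \<Rightarrow> real"
  assumes "real_polynomial_function Q"
  shows "trig (\<lambda>x. Q (sin_vec R x))"
  using assms
proof induction
  case (linear f)
  interpret f: bounded_linear f by fact
  have "f (sin_vec R x) = (\<Sum>j\<in>UNIV. f (axis j 1) * cos (axis j (1 / R) \<bullet> x + (- (pi / 2))))" for x
  proof -
    have "f (sin_vec R x) = f (\<Sum>j\<in>UNIV. sin_vec R x $ j *s axis j 1)" by (simp only: basis_expansion)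
    also have "\<dots> = (\<Sum>j\<in>UNIV. sin_vec R x $ j * f (axis j 1))"
      by (simp add: f.sum f.scaleR scalar_mult_eq_scaleR)
    also have "\<dots> = (\<Sum>j\<in>UNIV. f (axis j 1) * cos (axis j (1 / R) \<bullet> x + (- (pi / 2))))"
      by (rule sum.cong) (simp_all add: sin_vec_def inner_axis' cos_diff mult.commute)
    finally show ?thesis .
  qed
  then show ?case by (simp only: trig_sum trig.cos finite)
qed (auto intro: trig_const trig.add trig_mult)

lemma trig_bounded_continuous:
  assumes "trig f"
  shows "continuous_on UNIV f \<and> (\<exists>K. \<forall>x. \<bar>f x\<bar> \<le> K)"
  using assms
proof induction
  case (cos c t b)
  have "\<bar>c * cos (t \<bullet> x + b)\<bar> \<le> \<bar>c\<bar>" for x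
    unfolding abs_mult by (rule mult_left_le) auto
  then show ?case by (auto intro!: continuous_intros)
next
  case (add f h)
  then obtain K L where "\<And>x. \<bar>f x\<bar> \<le> K" "\<And>x. \<bar>h x\<bar> \<le> L" by blast
  then have "\<bar>f x + h x\<bar> \<le> K + L" for x
    by (meson abs_triangle_ineq add_mono order.trans)
  then show ?case using add by (auto intro!: continuous_intros)
qed

lemma integrable_bounded_continuous:
  fixes f :: "'c::{second_countable_topology, t2_space} \<Rightarrow> real"
  assumes "prob_space M" "X \<in> borel_measurable M" "continuous_on UNIV f" "\<And>x. \<bar>f x\<bar> \<le> K"
  shows "integrable M (\<lambda>\<omega>. f (X \<omega>))"
proof -
  interpret prob_space M by fact
  have [measurable]: "f \<in> borel_measurable borel" using assms(3) by (rule borel_measurable_continuous_onI)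
  note assms(2) [measurable]
  show ?thesis by (rule integrable_const_bound[where B=K]) (use assms(4) in auto)
qed

lemma trig_limit:
  fixes W :: "nat \<Rightarrow> 'a \<Rightarrow> real ^ 'm::finite" and Y :: "'b \<Rightarrow> real ^ 'm"
  assumes P: "\<And>n. prob_space (P n)" "\<And>n. W n \<in> borel_measurable (P n)"
    and N: "prob_space N" "Y \<in> borel_measurable N"
    and cos: "\<And>t b. (\<lambda>n. LINT \<omega>|P n. cos (t \<bullet> W n \<omega> + b)) \<longlonglongrightarrow> (LINT \<omega>|N. cos (t \<bullet> Y \<omega> + b))"
    and "trig f"
  shows "(\<lambda>n. LINT \<omega>|P n. f (W n \<omega>)) \<longlonglongrightarrow> (LINT \<omega>|N. f (Y \<omega>))"
  using \<open>trig f\<close>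
proof induction
  case (cos c t b)
  then show ?case using assms(5)[of t b] by (simp add: tendsto_mult_left)
next
  case (add f h)
  have i: "integrable (P n) (\<lambda>\<omega>. k (W n \<omega>))" "integrable N (\<lambda>\<omega>. k (Y \<omega>))" if "trig k" for k n
    using trig_bounded_continuous[OF that] integrable_bounded_continuous P N by blast+
  show ?case using add i by (simp add: tendsto_add)
qed

text \<open>
  The Cramer-Wold device. On \<open>norm x \<le> R\<close> all \<open>x\<^sub>j / R\<close> lie in \<open>[-1, 1]\<close>, which is inside the range
  \<open>[-\<pi>/2, \<pi>/2]\<close> where the arcsine inverts the sine. So \<open>f x = F (sin_vec R x)\<close> there with \<open>F\<close> continuous
  on the cube \<open>[-1, 1]\<^sup>m\<close> and bounded like \<open>f\<close>. A polynomial close to \<open>F\<close> on the cube gives a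
  trigonometric sum that is close to \<open>f\<close> for \<open>norm x \<le> R\<close> and bounded outside by the same constant, up
  to the approximation error; the bounded first moments make the outside part negligible.
\<close>

theorem converges_in_distribution_if_cos_limits:
  fixes W :: "nat \<Rightarrow> 'a \<Rightarrow> real ^ 'm::finite" and Y :: "'b \<Rightarrow> real ^ 'm"
  assumes P: "\<And>n. prob_space (P n)" "\<And>n. W n \<in> borel_measurable (P n)"
    and N: "prob_space N" "Y \<in> borel_measurable N"
    and cos: "\<And>t b. (\<lambda>n. LINT \<omega>|P n. cos (t \<bullet> W n \<omega> + b)) \<longlonglongrightarrow> (LINT \<omega>|N. cos (t \<bullet> Y \<omega> + b))"
    and norm_P: "\<And>n. integrable (P n) (\<lambda>\<omega>. norm (W n \<omega>))" "\<And>n. (LINT \<omega>|P n. norm (W n \<omega>)) \<le> C"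
    and norm_N: "integrable N (\<lambda>\<omega>. norm (Y \<omega>))" "(LINT \<omega>|N. norm (Y \<omega>)) \<le> C"
  shows "converges_in_distribution P W N Y"
  unfolding converges_in_distribution_def
proof (intro allI impI)
  fix f :: "real ^ 'm \<Rightarrow> real" assume f: "continuous_on UNIV f \<and> bounded (range f)"
  then obtain K where K: "K > 0" "\<And>x. \<bar>f x\<bar> \<le> K"
    unfolding bounded_pos by auto
  have "0 \<le> (LINT \<omega>|N. norm (Y \<omega>))" by (rule Bochner_Integration.integral_nonneg) simp
  then have C: "C \<ge> 0" using norm_N(2) by linarith
  show "(\<lambda>n. LINT \<omega>|P n. f (W n \<omega>)) \<longlonglongrightarrow> (LINT \<omega>|N. f (Y \<omega>))"
  proof (rule LIMSEQ_I)
    fix e :: real assume e: "e > 0"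
    \<comment> \<open>By Markov's inequality this radius leaves an outside contribution of at most \<open>2 K C / R < e / 5\<close>.\<close>
    define R where "R = 10 * K * (C + 1) / e"
    have R: "R > 0" using K C e by (simp add: R_def)
    define F where "F = (\<lambda>s. f (\<chi> j. R * arcsin (s $ j)))"
    let ?S = "cbox (\<chi> j. - 1) (\<chi> j. 1) :: (real ^ 'm) set"
    have FK: "\<bar>F s\<bar> \<le> K" for s using K(2) by (simp add: F_def)
    have S: "s \<in> ?S \<longleftrightarrow> (\<forall>j. - 1 \<le> s $ j \<and> s $ j \<le> 1)" for s
      by (simp add: mem_box_cart)
    have "continuous_on ?S F"
      unfolding F_def
    proof (rule continuous_on_compose2[of UNIV f])
      show "continuous_on ?S (\<lambda>s. \<chi> j. R * arcsin (s $ j))"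
        by (intro continuous_intros) (auto simp: S)
    qed (use f in auto)
    then obtain Q where Q: "real_polynomial_function Q" "\<And>s. s \<in> ?S \<Longrightarrow> \<bar>F s - Q s\<bar> < e / 10"
      using Stone_Weierstrass_real_polynomial_function[of ?S F "e / 10"] e by auto
    define T where "T = (\<lambda>x. Q (sin_vec R x))"
    have T: "trig T" unfolding T_def by (rule trig_polynomial_sin_vec[OF Q(1)])
    have close: "\<bar>f x - T x\<bar> \<le> e / 10 + 2 * K / R * norm x" for x
    proof -
      have "sin_vec R x \<in> ?S" by (simp add: S sin_vec_def)
      then have FT: "\<bar>F (sin_vec R x) - T x\<bar> < e / 10" using Q(2) by (simp add: T_def)
      show ?thesis
      proof (cases "norm x \<le> R")
        case True
        have "R * arcsin (sin (x $ j / R)) = x $ j" for j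
        proof -
          have "\<bar>x $ j\<bar> \<le> R" using component_le_norm_cart[of x j] True by linarith
          then have "\<bar>x $ j / R\<bar> \<le> 1" using R by (simp add: abs_divide)
          then have "- (pi / 2) \<le> x $ j / R" "x $ j / R \<le> pi / 2"
            using pi_gt3 by linarith+
          then show ?thesis using R by (simp add: arcsin_sin)
        qed
        then have "F (sin_vec R x) = f x" by (simp add: F_def sin_vec_def)
        moreover have "0 \<le> 2 * K / R * norm x" using K R by simp
        ultimately show ?thesis using FT by linarith
      next
        case False
        then have "2 * K * 1 \<le> 2 * K * (norm x / R)" using K R by (intro mult_left_mono) auto
        then have "2 * K \<le> 2 * K / R * norm x" by simp
        then show ?thesis using FT FK[of "sin_vec R x"] K(2)[of x] by linarith
      qed
    qed
    have approx: "\<bar>(LINT \<omega>|M. f (X \<omega>)) - (LINT \<omega>|M. T (X \<omega>))\<bar> \<le> 3 / 10 * e"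
      if M: "prob_space M" and X: "X \<in> borel_measurable M" and i: "integrable M (\<lambda>\<omega>. norm (X \<omega>))"
        and le: "(LINT \<omega>|M. norm (X \<omega>)) \<le> C" for M :: "'z measure" and X :: "'z \<Rightarrow> real ^ 'm"
    proof -
      interpret prob_space M by fact
      have if': "integrable M (\<lambda>\<omega>. f (X \<omega>))"
        by (rule integrable_bounded_continuous[OF M X _ K(2)]) (use f in simp)
      have iT: "integrable M (\<lambda>\<omega>. T (X \<omega>))"
        using trig_bounded_continuous[OF T] integrable_bounded_continuous[OF M X] by blast
      have "\<bar>(LINT \<omega>|M. f (X \<omega>)) - (LINT \<omega>|M. T (X \<omega>))\<bar> = \<bar>LINT \<omega>|M. f (X \<omega>) - T (X \<omega>)\<bar>"
        using if' iT by simp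
      also have "\<dots> \<le> (LINT \<omega>|M. \<bar>f (X \<omega>) - T (X \<omega>)\<bar>)" by (rule integral_abs_bound)
      also have "\<dots> \<le> (LINT \<omega>|M. e / 10 + 2 * K / R * norm (X \<omega>))"
        using if' iT i close by (intro integral_mono) auto
      also have "\<dots> = e / 10 + 2 * K / R * (LINT \<omega>|M. norm (X \<omega>))"
        using i by (simp add: prob_space)
      also have "\<dots> \<le> e / 10 + 2 * K / R * (C + 1)"
        using le K R by (intro add_left_mono mult_left_mono) auto
      also have "2 * K / R * (C + 1) = 2 / 10 * e"
      proof -
        have "2 * K * (C + 1) = 2 / 10 * e * R" using e by (simp add: R_def)
        then have "2 * K * (C + 1) / R = 2 / 10 * e" using R by (simp add: divide_eq_eq)
        then show ?thesis by simp
      qed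
      finally show ?thesis by simp
    qed
    have "(\<lambda>n. LINT \<omega>|P n. T (W n \<omega>)) \<longlonglongrightarrow> (LINT \<omega>|N. T (Y \<omega>))"
      by (rule trig_limit[OF P N cos T])
    then obtain n0 where n0: "\<And>n. n \<ge> n0 \<Longrightarrow> \<bar>(LINT \<omega>|P n. T (W n \<omega>)) - (LINT \<omega>|N. T (Y \<omega>))\<bar> < e / 10"
      using LIMSEQ_D[of _ _ "e / 10"] e by fastforce
    show "\<exists>n0. \<forall>n\<ge>n0. norm ((LINT \<omega>|P n. f (W n \<omega>)) - (LINT \<omega>|N. f (Y \<omega>))) < e"
    proof (intro exI allI impI)
      fix n assume "n \<ge> n0"
      then show "norm ((LINT \<omega>|P n. f (W n \<omega>)) - (LINT \<omega>|N. f (Y \<omega>))) < e"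
        using n0[of n] approx[OF P norm_P, of n] approx[OF N norm_N] e unfolding real_norm_def by linarith
    qed
  qed
qed

section \<open>Convergence of moments\<close>

lemma abs_clamp_diff_le:
  fixes z :: real
  assumes "K > 0"
  shows "\<bar>z - max (- K) (min K z)\<bar> \<le> z\<^sup>2 / K"
proof (cases "\<bar>z\<bar> \<le> K")
  case True
  then show ?thesis using assms by (auto simp: abs_le_iff max_def min_def)
next
  case False
  have "\<bar>z - max (- K) (min K z)\<bar> \<le> \<bar>z\<bar>" using assms by (auto simp: max_def min_def)
  also have "\<bar>z\<bar> * K \<le> \<bar>z\<bar> * \<bar>z\<bar>" using False by (intro mult_left_mono) auto
  then have "\<bar>z\<bar> \<le> z\<^sup>2 / K" using assms by (simp add: field_simps power2_eq_square)
  finally show ?thesis .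
qed

text \<open>
  Bounded second moments give uniform integrability: cutting \<open>f\<close> off at \<open>\<plusminus>K\<close> changes each mean by at
  most \<open>C / K\<close>, and the truncated function is bounded and continuous. That the limit variable satisfies
  the same bound follows by monotone convergence from the truncations of \<open>f\<^sup>2\<close>.
\<close>

lemma expectation_limit_if_bounded_squares:
  fixes W :: "nat \<Rightarrow> 'a \<Rightarrow> 'c::{second_countable_topology, t2_space}" and f :: "'c \<Rightarrow> real"
  assumes P: "\<And>n. prob_space (P n)" "\<And>n. W n \<in> borel_measurable (P n)"
    and N: "prob_space N" "Y \<in> borel_measurable N"
    and conv: "converges_in_distribution P W N Y"
    and f: "continuous_on UNIV f"
    and sq: "\<And>n. integrable (P n) (\<lambda>\<omega>. (f (W n \<omega>))\<^sup>2)" "\<And>n. (LINT \<omega>|P n. (f (W n \<omega>))\<^sup>2) \<le> C"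
  shows "integrable N (\<lambda>\<omega>. (f (Y \<omega>))\<^sup>2)" "integrable N (\<lambda>\<omega>. f (Y \<omega>))"
    "(\<lambda>n. LINT \<omega>|P n. f (W n \<omega>)) \<longlonglongrightarrow> (LINT \<omega>|N. f (Y \<omega>))"
proof -
  interpret N: prob_space N by fact
  interpret P: prob_space "P n" for n by fact
  have mf [measurable]: "f \<in> borel_measurable borel" using f by (rule borel_measurable_continuous_onI)
  note P(2) [measurable] N(2) [measurable]
  have trunc: "(LINT \<omega>|N. min (real m) ((f (Y \<omega>))\<^sup>2)) \<le> C" for m
  proof -
    have "continuous_on UNIV (\<lambda>x. min (real m) ((f x)\<^sup>2)) \<and> bounded (range (\<lambda>x. min (real m) ((f x)\<^sup>2)))"
      by (intro conjI continuous_intros f boundedI[where B="real m"]) auto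
    then have "(\<lambda>n. LINT \<omega>|P n. min (real m) ((f (W n \<omega>))\<^sup>2)) \<longlonglongrightarrow> (LINT \<omega>|N. min (real m) ((f (Y \<omega>))\<^sup>2))"
      using conv unfolding converges_in_distribution_def by blast
    moreover have "(LINT \<omega>|P n. min (real m) ((f (W n \<omega>))\<^sup>2)) \<le> C" for n
    proof -
      have "(LINT \<omega>|P n. min (real m) ((f (W n \<omega>))\<^sup>2)) \<le> (LINT \<omega>|P n. (f (W n \<omega>))\<^sup>2)"
        by (intro integral_mono P.integrable_const_bound[where B="real m"] sq) auto
      then show ?thesis using sq(2)[of n] by linarith
    qed
    ultimately show ?thesis by (intro LIMSEQ_le_const2) auto
  qed
  have itr: "integrable N (\<lambda>\<omega>. min (real m) ((f (Y \<omega>))\<^sup>2))" for m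
    by (rule N.integrable_const_bound[where B="real m"]) auto
  have "incseq (\<lambda>m. LINT \<omega>|N. min (real m) ((f (Y \<omega>))\<^sup>2))"
    by (intro incseq_SucI integral_mono itr) auto
  then obtain L where L: "(\<lambda>m. LINT \<omega>|N. min (real m) ((f (Y \<omega>))\<^sup>2)) \<longlonglongrightarrow> L"
    using incseq_convergent trunc by metis
  have mc: "integrable N (\<lambda>\<omega>. (f (Y \<omega>))\<^sup>2)" "(LINT \<omega>|N. (f (Y \<omega>))\<^sup>2) = L"
  proof -
    have mono: "AE \<omega> in N. mono (\<lambda>m. min (real m) ((f (Y \<omega>))\<^sup>2))" by (auto simp: mono_def)
    have lim: "AE \<omega> in N. (\<lambda>m. min (real m) ((f (Y \<omega>))\<^sup>2)) \<longlonglongrightarrow> (f (Y \<omega>))\<^sup>2"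
    proof (rule AE_I2)
      fix \<omega>
      have "\<forall>\<^sub>F m in sequentially. min (real m) ((f (Y \<omega>))\<^sup>2) = (f (Y \<omega>))\<^sup>2"
        using eventually_ge_at_top[of "nat \<lceil>(f (Y \<omega>))\<^sup>2\<rceil>"] by eventually_elim linarith
      then show "(\<lambda>m. min (real m) ((f (Y \<omega>))\<^sup>2)) \<longlonglongrightarrow> (f (Y \<omega>))\<^sup>2" by (rule tendsto_eventually)
    qed
    show "integrable N (\<lambda>\<omega>. (f (Y \<omega>))\<^sup>2)"
      by (rule integrable_monotone_convergence[OF itr mono lim L]) auto
    show "(LINT \<omega>|N. (f (Y \<omega>))\<^sup>2) = L"
      by (rule integral_monotone_convergence[OF itr mono lim L]) auto
  qed
  then show "integrable N (\<lambda>\<omega>. (f (Y \<omega>))\<^sup>2)" by simp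
  have LC: "(LINT \<omega>|N. (f (Y \<omega>))\<^sup>2) \<le> C"
    unfolding mc by (rule LIMSEQ_le_const2[OF L]) (use trunc in auto)
  have int: "integrable M (\<lambda>\<omega>. f (X \<omega>))"
    and near: "\<bar>(LINT \<omega>|M. f (X \<omega>)) - (LINT \<omega>|M. max (- K) (min K (f (X \<omega>))))\<bar> \<le> C / K"
    if M: "prob_space M" and X: "X \<in> borel_measurable M" and i: "integrable M (\<lambda>\<omega>. (f (X \<omega>))\<^sup>2)"
      and le: "(LINT \<omega>|M. (f (X \<omega>))\<^sup>2) \<le> C" and K: "K > 0" for M :: "'z measure" and X K
  proof -
    interpret prob_space M by fact
    note X [measurable]
    show if': "integrable M (\<lambda>\<omega>. f (X \<omega>))"
    proof (rule Bochner_Integration.integrable_bound)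
      show "integrable M (\<lambda>\<omega>. 1 + (f (X \<omega>))\<^sup>2)" using i by simp
      have "\<bar>z\<bar> \<le> 1 + z\<^sup>2" for z :: real
        using zero_le_power2[of "\<bar>z\<bar> - 1"] by (simp add: power2_diff)
      then show "AE \<omega> in M. norm (f (X \<omega>)) \<le> norm (1 + (f (X \<omega>))\<^sup>2)" by auto
    qed simp
    have iK: "integrable M (\<lambda>\<omega>. max (- K) (min K (f (X \<omega>))))"
      by (rule integrable_const_bound[where B=K]) (use K in auto)
    have "\<bar>(LINT \<omega>|M. f (X \<omega>)) - (LINT \<omega>|M. max (- K) (min K (f (X \<omega>))))\<bar>
        = \<bar>LINT \<omega>|M. f (X \<omega>) - max (- K) (min K (f (X \<omega>)))\<bar>"
      using if' iK by simp
    also have "\<dots> \<le> (LINT \<omega>|M. \<bar>f (X \<omega>) - max (- K) (min K (f (X \<omega>)))\<bar>)"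
      by (rule integral_abs_bound)
    also have "\<dots> \<le> (LINT \<omega>|M. (f (X \<omega>))\<^sup>2 / K)"
      using if' iK i by (intro integral_mono abs_clamp_diff_le K) auto
    also have "\<dots> \<le> C / K" using le K by (simp add: divide_right_mono)
    finally show "\<bar>(LINT \<omega>|M. f (X \<omega>)) - (LINT \<omega>|M. max (- K) (min K (f (X \<omega>))))\<bar> \<le> C / K" .
  qed
  show "integrable N (\<lambda>\<omega>. f (Y \<omega>))" by (rule int[OF N mc(1) LC zero_less_one])
  show "(\<lambda>n. LINT \<omega>|P n. f (W n \<omega>)) \<longlonglongrightarrow> (LINT \<omega>|N. f (Y \<omega>))"
  proof (rule LIMSEQ_I)
    fix e :: real assume e: "e > 0"
    have "0 \<le> (LINT \<omega>|N. (f (Y \<omega>))\<^sup>2)" by (rule Bochner_Integration.integral_nonneg) simp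
    then have C: "C \<ge> 0" using LC by linarith
    define K where "K = 4 * (C + 1) / e"
    have K: "K > 0" using C e by (simp add: K_def)
    have CK: "C / K \<le> e / 4" using C e by (simp add: K_def field_simps)
    have "continuous_on UNIV (\<lambda>x. max (- K) (min K (f x))) \<and> bounded (range (\<lambda>x. max (- K) (min K (f x))))"
      by (intro conjI continuous_intros f boundedI[where B=K]) (use K in auto)
    then have "(\<lambda>n. LINT \<omega>|P n. max (- K) (min K (f (W n \<omega>)))) \<longlonglongrightarrow> (LINT \<omega>|N. max (- K) (min K (f (Y \<omega>))))"
      using conv unfolding converges_in_distribution_def by blast
    then obtain n0 where n0: "\<And>n. n \<ge> n0 \<Longrightarrow> \<bar>(LINT \<omega>|P n. max (- K) (min K (f (W n \<omega>)))) - (LINT \<omega>|N. max (- K) (min K (f (Y \<omega>))))\<bar> < e / 4"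
      using LIMSEQ_D[of _ _ "e / 4"] e by fastforce
    show "\<exists>n0. \<forall>n\<ge>n0. norm ((LINT \<omega>|P n. f (W n \<omega>)) - (LINT \<omega>|N. f (Y \<omega>))) < e"
    proof (intro exI allI impI)
      fix n assume "n \<ge> n0"
      then show "norm ((LINT \<omega>|P n. f (W n \<omega>)) - (LINT \<omega>|N. f (Y \<omega>))) < e"
        using n0[of n] near[OF P sq K, of n] near[OF N mc(1) LC K] CK e unfolding real_norm_def by linarith
    qed
  qed
qed

section \<open>Moment bounds for the pattern counts\<close>

lemma integrable_unif_perm [simp]: "integrable (measure_pmf (unif_perm n)) F" for F :: "nat list \<Rightarrow> real"
proof -
  have "perms n \<noteq> {}" using card_perms[of n] by (metis card.empty fact_nonzero)
  then have "finite (set_pmf (unif_perm n))" by (simp add: unif_perm_def)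
  then show ?thesis by (rule integrable_measure_pmf_finite)
qed

lemma exp_abs_normalized_occ_le:
  assumes "\<sigma> \<in> patterns" "t \<ge> 0"
  shows "measure_pmf.expectation (unif_perm n) (\<lambda>\<pi>. exp (t * \<bar>normalized_occ \<sigma> n \<pi>\<bar>)) \<le> 2 * exp (t\<^sup>2)"
proof -
  let ?E = "measure_pmf.expectation (unif_perm n)" and ?W = "normalized_occ \<sigma> n"
  have "?E (\<lambda>\<pi>. exp (t * \<bar>?W \<pi>\<bar>)) \<le> ?E (\<lambda>\<pi>. exp (t * ?W \<pi>) + exp ((- t) * ?W \<pi>))"
    by (rule integral_mono) (auto simp: abs_if)
  also have "\<dots> = ?E (\<lambda>\<pi>. exp (t * ?W \<pi>)) + ?E (\<lambda>\<pi>. exp ((- t) * ?W \<pi>))"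
    by simp
  also have "\<dots> \<le> exp (t\<^sup>2) + exp ((- t)\<^sup>2)"
    using assms(1) by (intro add_mono normalized_occ_exp_le) (auto simp: patterns_iff)
  finally show ?thesis by simp
qed

lemma abs_power_le_exp: "\<bar>x\<bar> ^ p \<le> real p ^ p * exp \<bar>x\<bar>" for x :: real
proof (cases "p = 0")
  case False
  have "\<bar>x\<bar> / real p \<le> exp (\<bar>x\<bar> / real p)"
    using exp_ge_add_one_self[of "\<bar>x\<bar> / real p"] by linarith
  then have "\<bar>x\<bar> \<le> real p * exp (\<bar>x\<bar> / real p)"
    using False by (simp add: field_simps)
  then have "\<bar>x\<bar> ^ p \<le> (real p * exp (\<bar>x\<bar> / real p)) ^ p" by (intro power_mono) auto
  also have "\<dots> = real p ^ p * exp \<bar>x\<bar>"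
    using False by (simp add: power_mult_distrib exp_of_nat_mult[symmetric])
  finally show ?thesis .
qed simp

text \<open>
  This replaces the exponential of a sum by exponentials of single variables, so that no information
  about the joint distribution is needed.
\<close>

lemma exp_sum_abs_le:
  fixes x :: "'m::finite \<Rightarrow> real"
  shows "exp (\<Sum>i\<in>UNIV. \<bar>x i\<bar>) \<le> (\<Sum>i\<in>UNIV. exp (real CARD('m) * \<bar>x i\<bar>))"
proof -
  have "Max (range (\<lambda>i. \<bar>x i\<bar>)) \<in> range (\<lambda>i. \<bar>x i\<bar>)" by (rule Max_in) auto
  then obtain i0 where i0: "Max (range (\<lambda>i. \<bar>x i\<bar>)) = \<bar>x i0\<bar>" by blast
  have "(\<Sum>i\<in>UNIV. \<bar>x i\<bar>) \<le> (\<Sum>i\<in>(UNIV::'m set). \<bar>x i0\<bar>)"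
    by (rule sum_mono) (simp add: i0[symmetric])
  then have "exp (\<Sum>i\<in>UNIV. \<bar>x i\<bar>) \<le> exp (real CARD('m) * \<bar>x i0\<bar>)" by simp
  also have "\<dots> \<le> (\<Sum>i\<in>UNIV. exp (real CARD('m) * \<bar>x i\<bar>))"
    by (rule member_le_sum) auto
  finally show ?thesis .
qed

lemma prod_power_sq_le:
  fixes x :: "'m::finite \<Rightarrow> real"
  shows "(\<Prod>i\<in>UNIV. x i ^ r i)\<^sup>2
    \<le> (\<Prod>i\<in>UNIV. real (2 * r i) ^ (2 * r i)) * (\<Sum>i\<in>UNIV. exp (real CARD('m) * \<bar>x i\<bar>))"
proof -
  have "(x i ^ r i)\<^sup>2 = \<bar>x i\<bar> ^ (2 * r i)" for i
    by (metis dvd_triv_left power_even_abs power_even_eq)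
  then have "(\<Prod>i\<in>UNIV. x i ^ r i)\<^sup>2 = (\<Prod>i\<in>UNIV. \<bar>x i\<bar> ^ (2 * r i))"
    by (simp only: prod_power_distrib)
  also have "\<dots> \<le> (\<Prod>i\<in>UNIV. real (2 * r i) ^ (2 * r i) * exp \<bar>x i\<bar>)"
    by (intro prod_mono conjI abs_power_le_exp) auto
  also have "\<dots> = (\<Prod>i\<in>UNIV. real (2 * r i) ^ (2 * r i)) * exp (\<Sum>i\<in>UNIV. \<bar>x i\<bar>)"
    by (simp add: prod.distrib exp_sum)
  also have "\<dots> \<le> (\<Prod>i\<in>UNIV. real (2 * r i) ^ (2 * r i)) * (\<Sum>i\<in>UNIV. exp (real CARD('m) * \<bar>x i\<bar>))"
    by (intro mult_left_mono exp_sum_abs_le prod_nonneg) auto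
  finally show ?thesis .
qed

section \<open>Asymptotic normality\<close>

lemma borel_measurable_vec_lambda:
  fixes f :: "'m::finite \<Rightarrow> 'a \<Rightarrow> real"
  assumes "\<And>i. f i \<in> borel_measurable M"
  shows "(\<lambda>\<omega>. \<chi> i. f i \<omega>) \<in> borel_measurable M"
  by (subst borel_measurable_euclidean_space) (auto simp: Basis_vec_def inner_axis assms)

locale pattern_normal_family = prob_space M for M :: "'a measure" +
  fixes Z :: "nat list \<Rightarrow> 'a \<Rightarrow> real"
  assumes normal: "jointly_normal M patterns Z"
    and mean: "\<sigma> \<in> patterns \<Longrightarrow> expectation (Z \<sigma>) = 0"
    and cov: "\<sigma> \<in> patterns \<Longrightarrow> \<tau> \<in> patterns \<Longrightarrow> covariance M (Z \<sigma>) (Z \<tau>) = Sigma_cov \<sigma> \<tau>"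
begin

lemma normal_rv_Z: "\<sigma> \<in> patterns \<Longrightarrow> normal_rv M (Z \<sigma>)"
  using normal[unfolded jointly_normal_def, rule_format, of "{\<sigma>}" "\<lambda>_. 1"] by simp

lemma measurable_Z: "\<sigma> \<in> patterns \<Longrightarrow> Z \<sigma> \<in> borel_measurable M"
  using normal_rv_Z by (simp add: normal_rv_def)

lemma integrable_Z: "\<sigma> \<in> patterns \<Longrightarrow> integrable M (Z \<sigma>)"
  by (rule normal_rv_integrable(1)[OF normal_rv_Z])

lemma integrable_Z_mult:
  assumes "\<sigma> \<in> patterns" "\<tau> \<in> patterns"
  shows "integrable M (\<lambda>\<omega>. Z \<sigma> \<omega> * Z \<tau> \<omega>)"
proof (rule Bochner_Integration.integrable_bound)
  show "integrable M (\<lambda>\<omega>. (Z \<sigma> \<omega>)\<^sup>2 + (Z \<tau> \<omega>)\<^sup>2)"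
    using assms by (intro Bochner_Integration.integrable_add normal_rv_integrable(2) normal_rv_Z)
  have "\<bar>a * b\<bar> \<le> a\<^sup>2 + b\<^sup>2" for a b :: real
  proof -
    have "2 * \<bar>a * b\<bar> \<le> a\<^sup>2 + b\<^sup>2"
      using zero_le_power2[of "\<bar>a\<bar> - \<bar>b\<bar>"] by (simp add: power2_diff abs_mult)
    then show ?thesis using abs_ge_zero[of "a * b"] by linarith
  qed
  then show "AE \<omega> in M. norm (Z \<sigma> \<omega> * Z \<tau> \<omega>) \<le> norm ((Z \<sigma> \<omega>)\<^sup>2 + (Z \<tau> \<omega>)\<^sup>2)" by auto
qed (use assms measurable_Z in auto)

lemma expectation_Z_mult:
  "\<sigma> \<in> patterns \<Longrightarrow> \<tau> \<in> patterns \<Longrightarrow> expectation (\<lambda>\<omega>. Z \<sigma> \<omega> * Z \<tau> \<omega>) = Sigma_cov \<sigma> \<tau>"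
  using cov[of \<sigma> \<tau>] by (simp add: covariance_def mean)

text \<open>
  Joint normality speaks of sets of patterns while \<open>\<sigma>s\<close> may repeat a pattern, so the coefficients of
  equal patterns are added up first.
\<close>

lemma expectation_cos_Z:
  assumes I: "finite I" and \<sigma>s: "\<And>a. a \<in> I \<Longrightarrow> \<sigma>s a \<in> patterns"
  shows "expectation (\<lambda>\<omega>. cos ((\<Sum>a\<in>I. c a * Z (\<sigma>s a) \<omega>) + b)) = exp (- lin_var I \<sigma>s c / 2) * cos b"
proof -
  let ?X = "\<lambda>\<omega>. \<Sum>a\<in>I. c a * Z (\<sigma>s a) \<omega>"
  have "?X = (\<lambda>\<omega>. \<Sum>\<sigma>\<in>\<sigma>s ` I. (\<Sum>a\<in>{a\<in>I. \<sigma>s a = \<sigma>}. c a) * Z \<sigma> \<omega>)"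
  proof
    fix \<omega>
    have "?X \<omega> = (\<Sum>\<sigma>\<in>\<sigma>s ` I. \<Sum>a\<in>{a\<in>I. \<sigma>s a = \<sigma>}. c a * Z (\<sigma>s a) \<omega>)"
      by (rule sum.image_gen[OF I])
    also have "\<dots> = (\<Sum>\<sigma>\<in>\<sigma>s ` I. (\<Sum>a\<in>{a\<in>I. \<sigma>s a = \<sigma>}. c a) * Z \<sigma> \<omega>)"
      by (simp add: sum_distrib_right)
    finally show "?X \<omega> = (\<Sum>\<sigma>\<in>\<sigma>s ` I. (\<Sum>a\<in>{a\<in>I. \<sigma>s a = \<sigma>}. c a) * Z \<sigma> \<omega>)" .
  qed
  moreover have "normal_rv M (\<lambda>\<omega>. \<Sum>\<sigma>\<in>\<sigma>s ` I. (\<Sum>a\<in>{a\<in>I. \<sigma>s a = \<sigma>}. c a) * Z \<sigma> \<omega>)"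
    using normal[unfolded jointly_normal_def, rule_format, of "\<sigma>s ` I" "\<lambda>\<sigma>. \<Sum>a\<in>{a\<in>I. \<sigma>s a = \<sigma>}. c a"] I \<sigma>s by blast
  ultimately have n: "normal_rv M ?X" by simp
  have m: "expectation ?X = 0"
    using \<sigma>s by (simp add: Bochner_Integration.integral_sum integrable_Z mean)
  have "(\<lambda>\<omega>. (?X \<omega>)\<^sup>2) = (\<lambda>\<omega>. \<Sum>a\<in>I. \<Sum>b\<in>I. c a * c b * (Z (\<sigma>s a) \<omega> * Z (\<sigma>s b) \<omega>))"
    unfolding power2_eq_square sum_product by (intro ext sum.cong) (simp_all add: ac_simps)
  then have v: "expectation (\<lambda>\<omega>. (?X \<omega>)\<^sup>2) = lin_var I \<sigma>s c"
    using \<sigma>s by (simp add: Bochner_Integration.integral_sum integrable_Z_mult expectation_Z_mult lin_var_def)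
  show ?thesis using normal_rv_expectation_cos[OF n m, of b] unfolding v .
qed

lemma expectation_cos_normalized_occ_limit:
  assumes "finite I" "\<And>a. a \<in> I \<Longrightarrow> \<sigma>s a \<in> patterns"
  shows "(\<lambda>n. measure_pmf.expectation (unif_perm n) (\<lambda>\<pi>. cos ((\<Sum>a\<in>I. c a * normalized_occ (\<sigma>s a) n \<pi>) + b)))
     \<longlonglongrightarrow> expectation (\<lambda>\<omega>. cos ((\<Sum>a\<in>I. c a * Z (\<sigma>s a) \<omega>) + b))"
  using expectation_cos_limit[of I \<sigma>s c b, OF assms] expectation_cos_Z[of I \<sigma>s c b, OF assms] by simp

lemma weak_conv_normalized_occ:
  assumes \<sigma>: "\<sigma> \<in> patterns"
  shows "weak_conv_m (\<lambda>n. distr (measure_pmf (unif_perm n)) borel (normalized_occ \<sigma> n)) (distr M borel (Z \<sigma>))"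
proof (rule levy_continuity)
  show "real_distribution (distr (measure_pmf (unif_perm n)) borel (normalized_occ \<sigma> n))" for n
    by (rule prob_space.real_distribution_distr) (auto simp: measure_pmf.prob_space_axioms)
  show "real_distribution (distr M borel (Z \<sigma>))"
    by (rule real_distribution_distr) (rule measurable_Z[OF \<sigma>])
  have meas: "normalized_occ \<sigma> n \<in> borel_measurable (measure_pmf (unif_perm n))" for n by simp
  fix t
  have "(\<lambda>n. measure_pmf.expectation (unif_perm n) (\<lambda>\<pi>. cos (t * normalized_occ \<sigma> n \<pi> + b)))
     \<longlonglongrightarrow> expectation (\<lambda>\<omega>. cos (t * Z \<sigma> \<omega> + b))" for b
    using expectation_cos_normalized_occ_limit[of "{\<sigma>}" "\<lambda>\<sigma>. \<sigma>" "\<lambda>_. t" b] \<sigma> by simp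
  \<comment> \<open>The phases \<open>0\<close> and \<open>- \<pi> / 2\<close> give the real and the imaginary part.\<close>
  then show "(\<lambda>n. char (distr (measure_pmf (unif_perm n)) borel (normalized_occ \<sigma> n)) t) \<longlonglongrightarrow> char (distr M borel (Z \<sigma>)) t"
    by (simp only: char_distr_eq[OF measure_pmf.prob_space_axioms meas] char_distr_eq[OF prob_space_axioms measurable_Z[OF \<sigma>]] tendsto_Complex)
qed

lemma joint_convergence:
  fixes \<sigma>s :: "'m::finite \<Rightarrow> nat list"
  assumes \<sigma>s: "\<And>i. \<sigma>s i \<in> patterns"
  shows "converges_in_distribution (\<lambda>n. measure_pmf (unif_perm n))
           (\<lambda>n \<pi>. (\<chi> i. normalized_occ (\<sigma>s i) n \<pi>) :: real ^ 'm) M (\<lambda>\<omega>. \<chi> i. Z (\<sigma>s i) \<omega>)"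
proof -
  let ?Y = "\<lambda>\<omega>. (\<chi> i. Z (\<sigma>s i) \<omega>) :: real ^ 'm"
  let ?W = "\<lambda>n \<pi>. (\<chi> i. normalized_occ (\<sigma>s i) n \<pi>) :: real ^ 'm"
  have Y [measurable]: "?Y \<in> borel_measurable M"
    by (rule borel_measurable_vec_lambda) (rule measurable_Z[OF \<sigma>s])
  have iY: "integrable M (\<lambda>\<omega>. norm (?Y \<omega>))"
  proof (rule Bochner_Integration.integrable_bound)
    show "integrable M (\<lambda>\<omega>. \<Sum>i\<in>UNIV. \<bar>Z (\<sigma>s i) \<omega>\<bar>)"
      by (intro Bochner_Integration.integrable_sum integrable_abs integrable_Z \<sigma>s)
    show "AE \<omega> in M. norm (norm (?Y \<omega>)) \<le> norm (\<Sum>i\<in>UNIV. \<bar>Z (\<sigma>s i) \<omega>\<bar>)"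
      using norm_le_l1_cart[of "?Y _"] by (auto simp: sum_nonneg)
  qed simp
  have bW: "measure_pmf.expectation (unif_perm n) (\<lambda>\<pi>. norm (?W n \<pi>)) \<le> real CARD('m) * (2 * exp 1)" for n
  proof -
    have "measure_pmf.expectation (unif_perm n) (\<lambda>\<pi>. norm (?W n \<pi>))
       \<le> measure_pmf.expectation (unif_perm n) (\<lambda>\<pi>. \<Sum>i\<in>UNIV. exp (1 * \<bar>normalized_occ (\<sigma>s i) n \<pi>\<bar>))"
    proof (rule integral_mono)
      fix \<pi>
      have "norm (?W n \<pi>) \<le> (\<Sum>i\<in>UNIV. \<bar>normalized_occ (\<sigma>s i) n \<pi>\<bar>)"
        using norm_le_l1_cart[of "?W n \<pi>"] by simp
      also have "\<dots> \<le> (\<Sum>i\<in>UNIV. exp (1 * \<bar>normalized_occ (\<sigma>s i) n \<pi>\<bar>))"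
      proof (rule sum_mono)
        show "\<bar>normalized_occ (\<sigma>s i) n \<pi>\<bar> \<le> exp (1 * \<bar>normalized_occ (\<sigma>s i) n \<pi>\<bar>)" for i
          using exp_ge_add_one_self[of "\<bar>normalized_occ (\<sigma>s i) n \<pi>\<bar>"] unfolding mult_1 by linarith
      qed
      finally show "norm (?W n \<pi>) \<le> (\<Sum>i\<in>UNIV. exp (1 * \<bar>normalized_occ (\<sigma>s i) n \<pi>\<bar>))" .
    qed simp_all
    also have "\<dots> = (\<Sum>i\<in>UNIV. measure_pmf.expectation (unif_perm n) (\<lambda>\<pi>. exp (1 * \<bar>normalized_occ (\<sigma>s i) n \<pi>\<bar>)))"
      by (rule Bochner_Integration.integral_sum) simp
    also have "\<dots> \<le> (\<Sum>i\<in>(UNIV::'m set). 2 * exp (1\<^sup>2))"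
      by (intro sum_mono exp_abs_normalized_occ_le \<sigma>s) simp
    finally show ?thesis by simp
  qed
  show ?thesis
  proof (rule converges_in_distribution_if_cos_limits)
    show "(\<lambda>n. LINT \<pi>|measure_pmf (unif_perm n). cos (t \<bullet> ?W n \<pi> + b)) \<longlonglongrightarrow> expectation (\<lambda>\<omega>. cos (t \<bullet> ?Y \<omega> + b))" for t b
      using expectation_cos_normalized_occ_limit[of UNIV \<sigma>s "\<lambda>i. t $ i" b] \<sigma>s by (simp add: inner_vec_def)
    show "(LINT \<pi>|measure_pmf (unif_perm n). norm (?W n \<pi>)) \<le> max (real CARD('m) * (2 * exp 1)) (expectation (\<lambda>\<omega>. norm (?Y \<omega>)))" for n
      using bW[of n] by linarith
  qed (use iY prob_space_axioms in \<open>auto simp: measure_pmf.prob_space_axioms\<close>)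
qed

text \<open>
  The square of a monomial is dominated by exponentials of the single variables, whose means are bounded
  uniformly in \<open>n\<close>.
\<close>

lemma joint_moments:
  fixes \<sigma>s :: "'m::finite \<Rightarrow> nat list" and r :: "'m \<Rightarrow> nat"
  assumes \<sigma>s: "\<And>i. \<sigma>s i \<in> patterns"
  shows "integrable M (\<lambda>\<omega>. \<Prod>i\<in>UNIV. Z (\<sigma>s i) \<omega> ^ r i)"
    "(\<lambda>n. measure_pmf.expectation (unif_perm n) (\<lambda>\<pi>. \<Prod>i\<in>UNIV. normalized_occ (\<sigma>s i) n \<pi> ^ r i))
       \<longlonglongrightarrow> (LINT \<omega>|M. (\<Prod>i\<in>UNIV. Z (\<sigma>s i) \<omega> ^ r i))"
proof -
  let ?Y = "\<lambda>\<omega>. (\<chi> i. Z (\<sigma>s i) \<omega>) :: real ^ 'm"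
  let ?W = "\<lambda>n \<pi>. (\<chi> i. normalized_occ (\<sigma>s i) n \<pi>) :: real ^ 'm"
  let ?f = "\<lambda>x :: real ^ 'm. \<Prod>i\<in>UNIV. x $ i ^ r i"
  define K where "K = (\<Prod>i\<in>UNIV. real (2 * r i) ^ (2 * r i))"
  let ?m = "real CARD('m)"
  have Y: "?Y \<in> borel_measurable M"
    by (rule borel_measurable_vec_lambda) (rule measurable_Z[OF \<sigma>s])
  have sq: "measure_pmf.expectation (unif_perm n) (\<lambda>\<pi>. (?f (?W n \<pi>))\<^sup>2) \<le> K * (?m * (2 * exp (?m\<^sup>2)))" for n
  proof -
    have "measure_pmf.expectation (unif_perm n) (\<lambda>\<pi>. (?f (?W n \<pi>))\<^sup>2)
      \<le> measure_pmf.expectation (unif_perm n) (\<lambda>\<pi>. K * (\<Sum>i\<in>UNIV. exp (?m * \<bar>normalized_occ (\<sigma>s i) n \<pi>\<bar>)))"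
      unfolding K_def by (rule integral_mono) (simp_all only: integrable_unif_perm vec_lambda_beta prod_power_sq_le)
    also have "\<dots> = K * (\<Sum>i\<in>UNIV. measure_pmf.expectation (unif_perm n) (\<lambda>\<pi>. exp (?m * \<bar>normalized_occ (\<sigma>s i) n \<pi>\<bar>)))"
      by (simp add: Bochner_Integration.integral_sum)
    also have "\<dots> \<le> K * (\<Sum>i\<in>(UNIV::'m set). 2 * exp (?m\<^sup>2))"
    proof (rule mult_left_mono)
      show "(\<Sum>i\<in>UNIV. measure_pmf.expectation (unif_perm n) (\<lambda>\<pi>. exp (?m * \<bar>normalized_occ (\<sigma>s i) n \<pi>\<bar>)))
         \<le> (\<Sum>i\<in>(UNIV::'m set). 2 * exp (?m\<^sup>2))"
        by (intro sum_mono exp_abs_normalized_occ_le \<sigma>s) simp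
      show "K \<ge> 0" unfolding K_def by (intro prod_nonneg) auto
    qed
    finally show ?thesis by simp
  qed
  have f: "continuous_on UNIV ?f" by (intro continuous_intros)
  have P: "prob_space (measure_pmf (unif_perm n))" for n by (rule measure_pmf.prob_space_axioms)
  have W: "?W n \<in> borel_measurable (measure_pmf (unif_perm n))" for n by simp
  note lim = expectation_limit_if_bounded_squares[OF P W prob_space_axioms Y joint_convergence[of \<sigma>s, OF \<sigma>s] f _ sq]
  show "integrable M (\<lambda>\<omega>. \<Prod>i\<in>UNIV. Z (\<sigma>s i) \<omega> ^ r i)"
    using lim(2) by simp
  show "(\<lambda>n. measure_pmf.expectation (unif_perm n) (\<lambda>\<pi>. \<Prod>i\<in>UNIV. normalized_occ (\<sigma>s i) n \<pi> ^ r i))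
       \<longlonglongrightarrow> (LINT \<omega>|M. (\<Prod>i\<in>UNIV. Z (\<sigma>s i) \<omega> ^ r i))"
    using lim(3) by simp
qed

lemma covariance_limit:
  assumes \<sigma>: "\<sigma> \<in> patterns" and \<tau>: "\<tau> \<in> patterns"
  shows "(\<lambda>n. covariance (measure_pmf (unif_perm n)) (\<lambda>\<pi>. real (occ \<sigma> \<pi>)) (\<lambda>\<pi>. real (occ \<tau> \<pi>))
                / real n ^ (length \<sigma> + length \<tau> - 1)) \<longlonglongrightarrow> Sigma_cov \<sigma> \<tau>"
proof -
  let ?k = "length \<sigma>" and ?m = "length \<tau>"
  have "(\<lambda>n. measure_pmf.expectation (unif_perm n) (\<lambda>\<pi>. normalized_occ \<sigma> n \<pi> * normalized_occ \<tau> n \<pi>))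
     \<longlonglongrightarrow> expectation (\<lambda>\<omega>. Z \<sigma> \<omega> * Z \<tau> \<omega>)"
    using joint_moments(2)[of "\<lambda>b. if b then \<sigma> else \<tau>" "\<lambda>_. 1"] \<sigma> \<tau> by (simp add: UNIV_bool mult.commute)
  then have 1: "(\<lambda>n. measure_pmf.expectation (unif_perm n) (\<lambda>\<pi>. normalized_occ \<sigma> n \<pi> * normalized_occ \<tau> n \<pi>))
     \<longlonglongrightarrow> Sigma_cov \<sigma> \<tau>"
    by (simp add: expectation_Z_mult \<sigma> \<tau>)
  have "\<forall>\<^sub>F n in sequentially. measure_pmf.expectation (unif_perm n) (\<lambda>\<pi>. normalized_occ \<sigma> n \<pi> * normalized_occ \<tau> n \<pi>)
     = covariance (measure_pmf (unif_perm n)) (\<lambda>\<pi>. real (occ \<sigma> \<pi>)) (\<lambda>\<pi>. real (occ \<tau> \<pi>)) / real n ^ (?k + ?m - 1)"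
    using eventually_gt_at_top[of 0]
  proof eventually_elim
    case (elim n)
    have "?k > 0" using \<sigma> by (simp add: patterns_iff)
    then have "?k + ?m = Suc (?k + ?m - 1)" by simp
    then have "real n ^ ?k * real n ^ ?m = real n * real n ^ (?k + ?m - 1)"
      by (metis power_add power_Suc)
    then have "real n powr (real ?k - 1 / 2) * real n powr (real ?m - 1 / 2) = real n ^ (?k + ?m - 1)"
      unfolding powr_minus_half[OF elim] using elim by simp
    then have "normalized_occ \<sigma> n \<pi> * normalized_occ \<tau> n \<pi>
       = (real (occ \<sigma> \<pi>) - mean_occ \<sigma> n) * (real (occ \<tau> \<pi>) - mean_occ \<tau> n) / real n ^ (?k + ?m - 1)" for \<pi>
      by (simp add: normalized_occ_def)
    then show ?case by (simp add: covariance_def mean_occ_def)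
  qed
  then show ?thesis using 1 by (rule Lim_transform_eventually[rotated])
qed

end

theorem theorem4p1:
  fixes M :: "'a measure"
    and Z :: "nat list \<Rightarrow> 'a \<Rightarrow> real"
    and \<sigma>s :: "'m::finite \<Rightarrow> nat list"
  assumes "prob_space M"
    and "jointly_normal M patterns Z"
    and "\<And>\<sigma>. \<sigma> \<in> patterns \<Longrightarrow> (LINT \<omega>|M. Z \<sigma> \<omega>) = 0"
    and "\<And>\<sigma> \<tau>. \<sigma> \<in> patterns \<Longrightarrow> \<tau> \<in> patterns \<Longrightarrow> covariance M (Z \<sigma>) (Z \<tau>) = Sigma_cov \<sigma> \<tau>"
    and "\<And>i. \<sigma>s i \<in> patterns"
  shows "(\<forall>\<sigma>\<in>patterns.
           (\<forall>n. mean_occ \<sigma> n = 1 / fact (length \<sigma>) * real (n choose length \<sigma>)) \<and>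
           weak_conv_m (\<lambda>n. distr (measure_pmf (unif_perm n)) borel (normalized_occ \<sigma> n))
             (distr M borel (Z \<sigma>))) \<and>
         (converges_in_distribution (\<lambda>n. measure_pmf (unif_perm n))
           (\<lambda>n \<pi>. (\<chi> i. normalized_occ (\<sigma>s i) n \<pi>) :: real ^ 'm)
           M (\<lambda>\<omega>. \<chi> i. Z (\<sigma>s i) \<omega>)) \<and>
         (\<forall>r :: 'm \<Rightarrow> nat.
           integrable M (\<lambda>\<omega>. \<Prod>i\<in>UNIV. Z (\<sigma>s i) \<omega> ^ r i) \<and>
           (\<lambda>n. measure_pmf.expectation (unif_perm n)
                  (\<lambda>\<pi>. \<Prod>i\<in>UNIV. normalized_occ (\<sigma>s i) n \<pi> ^ r i))
             \<longlonglongrightarrow> (LINT \<omega>|M. (\<Prod>i\<in>UNIV. Z (\<sigma>s i) \<omega> ^ r i))) \<and>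
         (\<forall>\<sigma>\<in>patterns. \<forall>\<tau>\<in>patterns.
           (\<lambda>n. covariance (measure_pmf (unif_perm n))
                  (\<lambda>\<pi>. real (occ \<sigma> \<pi>)) (\<lambda>\<pi>. real (occ \<tau> \<pi>))
                / real n ^ (length \<sigma> + length \<tau> - 1))
             \<longlonglongrightarrow> Sigma_cov \<sigma> \<tau>)"
proof -
  interpret pattern_normal_family M Z
    by (intro pattern_normal_family.intro pattern_normal_family_axioms.intro assms(1-4))
  show ?thesis
  proof (intro conjI ballI allI)
    show "mean_occ \<sigma> n = 1 / fact (length \<sigma>) * real (n choose length \<sigma>)" if "\<sigma> \<in> patterns" for \<sigma> n
      using that by (intro mean_occ_eq) (simp add: patterns_iff)
  qed (intro weak_conv_normalized_occ joint_convergence joint_moments covariance_limit assms(5); assumption)+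
qed

end
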